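(* Let $(S^6,ds_0^2)$ be the standard sphere, i.e. the unit sphere in $\mathbb{R}^7$ with the induced round metric (constant sectional curvature $1$). There is no smooth almost complex structure $J$ on $S^6$ that is orthogonal with respect to $ds_0^2$ (that is, $J^2=-\mathrm{Id}$ and $ds_0^2(JX,JY)=ds_0^2(X,Y)$ for all $X,Y\in TS^6$) and whose Nijenhuis tensor $N$ satisfies $|N|^2<\frac{64}{5}$ at every point of $S^6$.
   Context: The Nijenhuis tensor of an almost complex structure $J$ is $N(X,Y)=[JX,JY]-[X,Y]-J[JX,Y]-J[X,JY]$ for vector fields $X,Y$. Its squared norm with respect to the metric $ds_0^2$ is $|N|^2=\sum_{A,B=1}^{6}|N(e_A,e_B)|^2$, where $(e_1,\dots,e_6)$ is any local orthonormal frame and the sum runs over all ordered pairs $(A,B)$. *)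

theory Defs
  imports "HOL-Analysis.Analysis"
begin

primrec Ck_on :: "nat \<Rightarrow> ('a::euclidean_space \<Rightarrow> 'b::real_normed_vector) \<Rightarrow> 'a set \<Rightarrow> bool" where
  "Ck_on 0 f U \<longleftrightarrow> continuous_on U f"
| "Ck_on (Suc k) f U \<longleftrightarrow>
     (\<forall>x\<in>U. f differentiable (at x)) \<and> (\<forall>v. Ck_on k (\<lambda>x. frechet_derivative f (at x) v) U)"

text \<open>Smoothness of a map on a subset of a Euclidean space (below: a relatively open subset of
  the sphere): locally it is the restriction of a smooth map on an open set. For embedded
  submanifolds this is smoothness in charts.\<close>

definition smooth_on :: "'a::euclidean_space set \<Rightarrow> ('a \<Rightarrow> 'b::real_normed_vector) \<Rightarrow> bool" where
  "smooth_on A f \<longleftrightarrow>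
     (\<forall>x\<in>A. \<exists>U g. open U \<and> x \<in> U \<and> (\<forall>k. Ck_on k g U) \<and> (\<forall>y\<in>U \<inter> A. g y = f y))"

definition S6 :: "(real^7) set" where
  "S6 = sphere 0 1"

definition tangent_space :: "real^7 \<Rightarrow> (real^7) set" where
  "tangent_space x = {v. v \<bullet> x = 0}"

definition vector_field_on :: "(real^7) set \<Rightarrow> (real^7 \<Rightarrow> real^7) \<Rightarrow> bool" where
  "vector_field_on U X \<longleftrightarrow> smooth_on U X \<and> (\<forall>x\<in>U. X x \<in> tangent_space x)"

text \<open>Only the values of \<open>J x\<close> on \<open>tangent_space x\<close>, for \<open>x \<in> S6\<close>, are meaningful. Smoothness of
  the endomorphism field is expressed by its preserving smooth vector fields.\<close>

definition almost_complex_structure :: "(real^7 \<Rightarrow> real^7 \<Rightarrow> real^7) \<Rightarrow> bool" where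
  "almost_complex_structure J \<longleftrightarrow>
     (\<forall>x\<in>S6. \<forall>u\<in>tangent_space x. J x u \<in> tangent_space x \<and> J x (J x u) = - u) \<and>
     (\<forall>x\<in>S6. \<forall>u\<in>tangent_space x. \<forall>v\<in>tangent_space x. \<forall>c.
        J x (u + v) = J x u + J x v \<and> J x (c *\<^sub>R u) = c *\<^sub>R J x u) \<and>
     (\<forall>X. vector_field_on S6 X \<longrightarrow> vector_field_on S6 (\<lambda>x. J x (X x)))"

definition orthogonal_acs :: "(real^7 \<Rightarrow> real^7 \<Rightarrow> real^7) \<Rightarrow> bool" where
  "orthogonal_acs J \<longleftrightarrow>
     (\<forall>x\<in>S6. \<forall>u\<in>tangent_space x. \<forall>v\<in>tangent_space x. J x u \<bullet> J x v = u \<bullet> v)"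

text \<open>The derivative of a map on (an open part of) the sphere along a tangent vector, computed
  from the radially constant extension; by the lemma below, every extension gives the same
  value.\<close>

definition tangential_deriv :: "(real^7 \<Rightarrow> real^7) \<Rightarrow> real^7 \<Rightarrow> real^7 \<Rightarrow> real^7" where
  "tangential_deriv X x v = frechet_derivative (\<lambda>y. X (sgn y)) (at x) v"

lemma sgn_has_derivative_on_sphere:
  assumes "x \<in> S6"
  shows "(sgn has_derivative (\<lambda>v. v - (v \<bullet> x) *\<^sub>R x)) (at x)"
proof -
  have n: "norm x = 1" using assms by (simp add: S6_def)
  then have "x \<noteq> 0" by auto
  have "(norm has_derivative (\<lambda>h. h \<bullet> x)) (at x)"
    using GDERIV_norm[OF \<open>x \<noteq> 0\<close>] n by (simp add: gderiv_def sgn_div_norm)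
  then have "((\<lambda>y. inverse (norm y) *\<^sub>R y) has_derivative (\<lambda>v. v - (v \<bullet> x) *\<^sub>R x)) (at x)"
    using n \<open>x \<noteq> 0\<close>
    by (auto intro!: derivative_eq_intros simp: sgn_div_norm inner_commute)
  then show ?thesis by (simp add: sgn_div_norm [abs_def])
qed

lemma tangential_deriv_eq_extension:
  assumes x: "x \<in> S6" and v: "v \<in> tangent_space x"
    and U: "open U" "x \<in> U" and g: "g differentiable (at x)"
    and eq: "\<And>y. y \<in> U \<inter> S6 \<Longrightarrow> g y = X y"
  shows "tangential_deriv X x v = frechet_derivative g (at x) v"
proof -
  have n: "norm x = 1" using x by (simp add: S6_def)
  then have x0: "x \<noteq> 0" "sgn x = x" by (auto simp: sgn_div_norm)
  let ?D = "frechet_derivative g (at x)"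
  have "(g has_derivative ?D) (at x)" using g by (simp add: frechet_derivative_works)
  then have D: "((\<lambda>y. g (sgn y)) has_derivative (\<lambda>v. ?D (v - (v \<bullet> x) *\<^sub>R x))) (at x)"
    using has_derivative_compose[OF sgn_has_derivative_on_sphere[OF x], of g ?D] x0 by simp
  have "(sgn \<longlongrightarrow> x) (at x)"
    using tendsto_sgn[OF tendsto_ident_at x0(1), of UNIV] x0 by simp
  then have "\<forall>\<^sub>F y in at x. sgn y \<in> U" using U topological_tendstoD by blast
  moreover have "\<forall>\<^sub>F y in at x. y \<noteq> 0"
    using tendsto_imp_eventually_ne[OF tendsto_ident_at x0(1), of UNIV] by simp
  ultimately have "\<forall>\<^sub>F y in at x. g (sgn y) = X (sgn y)"
    by eventually_elim (auto intro!: eq simp: S6_def norm_sgn)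
  moreover have "g (sgn x) = X (sgn x)" using eq U x x0 by simp
  ultimately have "((\<lambda>y. X (sgn y)) has_derivative (\<lambda>v. ?D (v - (v \<bullet> x) *\<^sub>R x))) (at x)"
    using has_derivative_transform_eventually[OF D] by simp
  then show ?thesis
    using v by (simp add: tangential_deriv_def tangent_space_def frechet_derivative_at[symmetric])
qed

definition lie_bracket :: "(real^7 \<Rightarrow> real^7) \<Rightarrow> (real^7 \<Rightarrow> real^7) \<Rightarrow> real^7 \<Rightarrow> real^7" where
  "lie_bracket X Y x = tangential_deriv Y x (X x) - tangential_deriv X x (Y x)"

definition nijenhuis ::
  "(real^7 \<Rightarrow> real^7 \<Rightarrow> real^7) \<Rightarrow> (real^7 \<Rightarrow> real^7) \<Rightarrow> (real^7 \<Rightarrow> real^7) \<Rightarrow> real^7 \<Rightarrow> real^7" where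
  "nijenhuis J X Y x =
     lie_bracket (\<lambda>y. J y (X y)) (\<lambda>y. J y (Y y)) x - lie_bracket X Y x
     - J x (lie_bracket (\<lambda>y. J y (X y)) Y x) - J x (lie_bracket X (\<lambda>y. J y (Y y)) x)"

definition orthonormal_frame_on :: "(real^7) set \<Rightarrow> (nat \<Rightarrow> real^7 \<Rightarrow> real^7) \<Rightarrow> bool" where
  "orthonormal_frame_on U e \<longleftrightarrow>
     (\<forall>A\<in>{1..6}. vector_field_on U (e A)) \<and>
     (\<forall>x\<in>U. \<forall>A\<in>{1..6}. \<forall>B\<in>{1..6}. e A x \<bullet> e B x = (if A = B then 1 else 0))"

text \<open>The choice of frame is harmless: the sum does not depend on it because the Nijenhuis
  expression is tensorial, and frames exist near every point \<open>p\<close>, for instance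
  \<open>e A y = b A - ((b A \<bullet> y) / (1 + p \<bullet> y)) *\<^sub>R (p + y)\<close> away from \<open>- p\<close>, for an orthonormal
  basis \<open>b\<close> of the tangent space at \<open>p\<close>.\<close>

definition nijenhuis_norm2 :: "(real^7 \<Rightarrow> real^7 \<Rightarrow> real^7) \<Rightarrow> real^7 \<Rightarrow> real" where
  "nijenhuis_norm2 J x =
     (let e = (SOME e. \<exists>U. openin (top_of_set S6) U \<and> x \<in> U \<and> orthonormal_frame_on U e)
      in \<Sum>A=1..6. \<Sum>B=1..6. (norm (nijenhuis J (e A) (e B) x))\<^sup>2)"

end

(* A point x of S^6 and J_x give an orthogonal complex structure JJ(x) on R^8 = T_x + R x + R, and
   omega(u,v) = tr (JJ dJJ(u) dJJ(v)) is the pullback of the Kaehler form of SO(8)/U(4), hence closed.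
   Split the covariant derivative of J into B + C, where B(JX) = J B(X) and C(JX) = - J C(X). Then
   - omega(X,JX) >= 4 |X|^2 - |C(X)|^2, and C is controlled by the Nijenhuis tensor:
   4 |C(X)|^2 <= |N|^2 |X|^2. So |N|^2 < 16 forces omega to be nondegenerate everywhere.

   This is impossible: H^2(S^6) = 0 makes omega exact, so omega^3 would integrate to 0. The last step
   is carried out on R^6 in a stereographic chart, where omega decays like |y|^(-4): with the
   radial primitive alpha of omega, the flux of alpha wedge omega^2 through large spheres tends to 0,
   while its divergence is a multiple of the Pfaffian of omega, which has no zeros. *)

theory Submission
  imports Defs
begin

subsection \<open>Calculus of the classes \<open>C^k\<close>\<close>

text \<open>Why \<open>R^8\<close>: with the Levi-Civita derivative on the tangent bundle, curvature
  terms would enter the exterior derivative of tr (J dJ dJ). In a fixed vector space second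
  derivatives commute, and closedness follows by differentiating JJ^2 = -1 twice. The two extra
  dimensions also produce the positive term. Since JJ(x) sends the last unit vector to x, dJJ(X)
  sends it to X whatever J is; together with its image under JJ and skewness this gives four copies
  of |X|^2 in B, while C vanishes on the added plane.

  The threshold is 16 = 4 * 4: one factor is this 4, the other comes from squaring 1/2 in C(X)Y -
  C(Y)X = (1/2) J N(X,Y).

  The chart is not compact and omits the pole, so the decay has to be uniform up to it. dJJ is
  bounded relative to the length of the tangent vector by compactness of the sphere, and the
  conformal factor 2 / (1 + |y|^2) enters once for each of the two derivatives in omega. The
  primitive grows at most linearly, so the vector field dual to alpha wedge omega^2 is O(|y|^(-7));
  O(|y|^(-6)) is enough in dimension 6.\<close>

lemma frechet_derivative_cong_open:
  assumes "open U" "x \<in> U" "\<And>y. y \<in> U \<Longrightarrow> f y = g y"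
  shows "f differentiable (at x) \<longleftrightarrow> g differentiable (at x)"
    and "frechet_derivative f (at x) = frechet_derivative g (at x)"
proof -
  have "(f has_derivative D) (at x) \<longleftrightarrow> (g has_derivative D) (at x)" for D
    using has_derivative_transform_within_open[of f D x UNIV U g]
      has_derivative_transform_within_open[of g D x UNIV U f] assms by auto
  then show "f differentiable (at x) \<longleftrightarrow> g differentiable (at x)"
    and "frechet_derivative f (at x) = frechet_derivative g (at x)"
    by (auto simp: differentiable_def frechet_derivative_def)
qed

lemma Ck_on_cong:
  assumes "open U" "\<And>x. x \<in> U \<Longrightarrow> f x = g x"
  shows "Ck_on k f U \<longleftrightarrow> Ck_on k g U"
  using assms(2)
proof (induction k arbitrary: f g)
  case 0
  then show ?case by (auto intro: continuous_on_cong[THEN iffD1])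
next
  case (Suc k)
  show ?case
    using frechet_derivative_cong_open[OF assms(1) _ Suc.prems]
      Suc.IH[of "\<lambda>x. frechet_derivative f (at x) v" "\<lambda>x. frechet_derivative g (at x) v" for v]
    by simp
qed

text \<open>\<open>Ck_on\<close> refers to the chosen \<open>frechet_derivative\<close>; this rule
  accepts any explicit derivative formula, which drives the inductions on \<open>k\<close>
  below.\<close>

lemma Ck_on_SucI:
  assumes "open U"
    and "\<And>x. x \<in> U \<Longrightarrow> (f has_derivative f' x) (at x)"
    and "\<And>v. Ck_on k (\<lambda>x. f' x v) U"
  shows "Ck_on (Suc k) f U"
proof -
  have "frechet_derivative f (at x) = f' x" if "x \<in> U" for x
    using frechet_derivative_at[OF assms(2)[OF that]] by simp
  then have "Ck_on k (\<lambda>x. frechet_derivative f (at x) v) U" for v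
    using Ck_on_cong[OF assms(1), of "\<lambda>x. frechet_derivative f (at x) v" "\<lambda>x. f' x v"] assms(3)
    by simp
  then show ?thesis using assms(2) by (auto simp: differentiable_def)
qed

lemma Ck_on_Suc_has_derivative:
  "Ck_on (Suc k) f U \<Longrightarrow> x \<in> U \<Longrightarrow> (f has_derivative frechet_derivative f (at x)) (at x)"
  by (simp add: frechet_derivative_works)

lemma Ck_on_Suc_derivative: "Ck_on (Suc k) f U \<Longrightarrow> Ck_on k (\<lambda>x. frechet_derivative f (at x) v) U"
  by simp

lemma Ck_on_SucD: "Ck_on (Suc k) f U \<Longrightarrow> Ck_on k f U"
proof (induction k arbitrary: f)
  case 0
  then show ?case
    by (auto simp: continuous_on_eq_continuous_at intro!: continuous_at_imp_continuous_on
        differentiable_imp_continuous_within)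
qed auto

lemma Ck_on_subset: "Ck_on k f U \<Longrightarrow> V \<subseteq> U \<Longrightarrow> Ck_on k f V"
  by (induction k arbitrary: f) (auto intro: continuous_on_subset)

lemma Ck_on_local:
  assumes "\<And>x. x \<in> U \<Longrightarrow> \<exists>V. open V \<and> x \<in> V \<and> Ck_on k f V"
  shows "Ck_on k f U"
  using assms
proof (induction k arbitrary: f)
  case 0
  then show ?case
    by (metis Ck_on.simps(1) continuous_at_imp_continuous_on continuous_on_eq_continuous_at)
next
  case (Suc k)
  then show ?case by (simp) (metis)
qed

lemma Ck_on_const: "open U \<Longrightarrow> Ck_on k (\<lambda>x. c) U"
  by (induction k arbitrary: c) (auto intro!: Ck_on_SucI[where f' = "\<lambda>_ _. 0"] simp del: Ck_on.simps(2))

lemma Ck_on_bounded_linear: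
  assumes "bounded_linear L" "open U"
  shows "Ck_on k L U"
proof (cases k)
  case 0
  then show ?thesis using assms by (simp add: linear_continuous_on)
next
  case (Suc n)
  then show ?thesis
    using Ck_on_SucI[of U L "\<lambda>_. L" n] assms Ck_on_const bounded_linear_imp_has_derivative by metis
qed

lemma Ck_on_add:
  assumes "open U"
  shows "Ck_on k f U \<Longrightarrow> Ck_on k g U \<Longrightarrow> Ck_on k (\<lambda>x. f x + g x) U"
proof (induction k arbitrary: f g)
  case 0
  then show ?case by (auto intro: continuous_intros)
next
  case (Suc k)
  show ?case
  proof (rule Ck_on_SucI[OF assms])
    show "((\<lambda>x. f x + g x) has_derivative
        (\<lambda>v. frechet_derivative f (at x) v + frechet_derivative g (at x) v)) (at x)" if "x \<in> U" for x
      by (intro has_derivative_add Suc.prems[THEN Ck_on_Suc_has_derivative, OF that])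
    show "Ck_on k (\<lambda>x. frechet_derivative f (at x) v + frechet_derivative g (at x) v) U" for v
      by (intro Suc.IH Ck_on_Suc_derivative Suc.prems)
  qed
qed

text \<open>The product rule gives two terms of the same bilinear shape, so the induction runs over
  all \<open>f\<close> and \<open>g\<close> at once.\<close>

lemma Ck_on_bilinear:
  assumes "open U" "bounded_bilinear B"
  shows "Ck_on k f U \<Longrightarrow> Ck_on k g U \<Longrightarrow> Ck_on k (\<lambda>x. B (f x) (g x)) U"
proof (induction k arbitrary: f g)
  case 0
  then show ?case using bounded_bilinear.continuous_on[OF assms(2)] by auto
next
  case (Suc k)
  show ?case
  proof (rule Ck_on_SucI[OF assms(1)])
    show "((\<lambda>x. B (f x) (g x)) has_derivative
        (\<lambda>v. B (f x) (frechet_derivative g (at x) v) + B (frechet_derivative f (at x) v) (g x))) (at x)"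
      if "x \<in> U" for x
      by (intro bounded_bilinear.FDERIV assms(2) Suc.prems[THEN Ck_on_Suc_has_derivative, OF that])
    show "Ck_on k (\<lambda>x. B (f x) (frechet_derivative g (at x) v) + B (frechet_derivative f (at x) v) (g x)) U"
      for v
      by (intro Ck_on_add assms(1) Suc.IH Suc.prems[THEN Ck_on_SucD] Suc.prems[THEN Ck_on_Suc_derivative])
  qed
qed

lemmas Ck_on_scaleR = Ck_on_bilinear[OF _ bounded_bilinear_scaleR]
  and Ck_on_mult = Ck_on_bilinear[OF _ bounded_bilinear_mult]
  and Ck_on_inner = Ck_on_bilinear[OF _ bounded_bilinear_inner]

lemma Ck_on_id: "open U \<Longrightarrow> Ck_on k (\<lambda>x. x) U"
  by (rule Ck_on_bounded_linear[OF bounded_linear_ident])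

lemma Ck_on_diff:
  assumes "open U" "Ck_on k f U" "Ck_on k g U"
  shows "Ck_on k (\<lambda>x. f x - g x) U"
  using Ck_on_add[OF assms(1,2) Ck_on_scaleR[OF assms(1) Ck_on_const[OF assms(1), of k "-1"] assms(3)]]
  by simp

lemma Ck_on_sum:
  assumes "open U" "\<And>i. i \<in> I \<Longrightarrow> Ck_on k (f i) U"
  shows "Ck_on k (\<lambda>x. \<Sum>i\<in>I. f i x) U"
  using assms(2)
  by (induction I rule: infinite_finite_induct) (auto intro: Ck_on_const Ck_on_add assms(1))

lemma Ck_on_inverse:
  fixes f :: "'a::euclidean_space \<Rightarrow> real"
  assumes "open U" "\<And>x. x \<in> U \<Longrightarrow> f x \<noteq> 0"
  shows "Ck_on k f U \<Longrightarrow> Ck_on k (\<lambda>x. inverse (f x)) U"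
proof (induction k)
  case 0
  then show ?case using assms by (auto intro: continuous_intros)
next
  case (Suc k)
  \<comment> \<open>The derivative of \<open>1 / f\<close> is a product of
    \<open>inverse (f x)\<close>, the derivative of \<open>f\<close> and
    \<open>inverse (f x)\<close> again, and the outer factors are \<open>C^k\<close> by
    induction.\<close>
  note c = Suc.IH[OF Ck_on_SucD[OF Suc.prems]]
  show ?case
  proof (rule Ck_on_SucI[OF assms(1)])
    show "((\<lambda>x. inverse (f x)) has_derivative
        (\<lambda>v. (-1) * (inverse (f x) * frechet_derivative f (at x) v * inverse (f x)))) (at x)"
      if "x \<in> U" for x
      using Deriv.has_derivative_inverse[OF assms(2)[OF that] Ck_on_Suc_has_derivative[OF Suc.prems that]] by simp
    show "Ck_on k (\<lambda>x. (-1) * (inverse (f x) * frechet_derivative f (at x) v * inverse (f x))) U" for v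
      by (intro Ck_on_mult assms(1) c Ck_on_Suc_derivative[OF Suc.prems] Ck_on_const)
  qed
qed

lemma Ck_on_compose:
  fixes f :: "'a::euclidean_space \<Rightarrow> 'b::euclidean_space" and g :: "'b \<Rightarrow> 'c::real_normed_vector"
  assumes "open U" "f ` U \<subseteq> V"
  shows "Ck_on k f U \<Longrightarrow> Ck_on k g V \<Longrightarrow> Ck_on k (\<lambda>x. g (f x)) U"
proof (induction k arbitrary: g)
  case 0
  then show ?case using assms by (auto intro: continuous_on_compose2)
next
  case (Suc k)
  show ?case
  proof (rule Ck_on_SucI[OF assms(1)])
    \<comment> \<open>The direction in which \<open>g\<close> is differentiated varies with
      \<open>x\<close>, whereas \<open>Ck_on\<close> fixes it; a basis expansion leaves fixed
      directions with variable coefficients.\<close>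
    let ?D = "\<lambda>x v. \<Sum>b\<in>Basis. (frechet_derivative f (at x) v \<bullet> b) *\<^sub>R frechet_derivative g (at (f x)) b"
    have exp: "L w = (\<Sum>b\<in>Basis. (w \<bullet> b) *\<^sub>R L b)" if "linear L" for L :: "'b \<Rightarrow> 'c" and w
      using arg_cong[OF euclidean_representation[of w], of L] that by (simp add: linear_sum linear_scale)
    show "((\<lambda>x. g (f x)) has_derivative ?D x) (at x)" if "x \<in> U" for x
    proof -
      have g: "(g has_derivative frechet_derivative g (at (f x))) (at (f x))"
        using Ck_on_Suc_has_derivative[OF Suc.prems(2)] that assms by auto
      have eq: "?D x = (\<lambda>v. frechet_derivative g (at (f x)) (frechet_derivative f (at x) v))"
        by (rule ext) (rule exp[OF has_derivative_linear[OF g], symmetric])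
      show ?thesis
        unfolding eq by (rule has_derivative_compose[OF Ck_on_Suc_has_derivative[OF Suc.prems(1) that] g])
    qed
    show "Ck_on k (\<lambda>x. ?D x v) U" for v
    proof (rule Ck_on_sum[OF assms(1)], rule Ck_on_scaleR[OF assms(1)])
      show "Ck_on k (\<lambda>x. frechet_derivative f (at x) v \<bullet> b) U" for b
        by (rule Ck_on_inner[OF assms(1) Ck_on_Suc_derivative[OF Suc.prems(1)] Ck_on_const[OF assms(1)]])
      show "Ck_on k (\<lambda>x. frechet_derivative g (at (f x)) b) U" for b
        by (rule Suc.IH[OF Ck_on_SucD[OF Suc.prems(1)] Ck_on_Suc_derivative[OF Suc.prems(2)]])
    qed
  qed
qed

subsection \<open>The divergence theorem for decaying vector fields\<close>

lemma integrable_compact_support: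
  fixes g :: "'a::euclidean_space \<Rightarrow> real"
  assumes "continuous_on UNIV g" "\<And>x. norm x > R \<Longrightarrow> g x = 0"
  shows "integrable lborel g"
proof -
  have "integrable lborel (\<lambda>x. indicator (cball 0 R) x *\<^sub>R g x)"
    using assms(1) by (intro borel_integrable_compact) (auto intro: continuous_on_subset)
  also have "(\<lambda>x. indicator (cball 0 R) x *\<^sub>R g x) = g"
    using assms(2) by (auto simp: fun_eq_iff indicator_def)
  finally show ?thesis .
qed

lemma integral_shift:
  fixes g :: "'a::euclidean_space \<Rightarrow> real"
  assumes "integrable lborel g"
  shows "integrable lborel (\<lambda>x. g (c + x))" "integral\<^sup>L lborel (\<lambda>x. g (c + x)) = integral\<^sup>L lborel g"
proof -
  have m: "(+) c \<in> measurable lborel borel" "g \<in> borel_measurable borel"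
    using assms by (auto dest: borel_measurable_integrable)
  show "integrable lborel (\<lambda>x. g (c + x))"
    using integrable_distr_eq[OF m] assms by (simp add: lborel_distr_plus)
  show "integral\<^sup>L lborel (\<lambda>x. g (c + x)) = integral\<^sup>L lborel g"
    using integral_distr[OF m] by (simp add: lborel_distr_plus)
qed

lemma directional_mvt:
  fixes g :: "'a::real_normed_vector \<Rightarrow> real"
  assumes g: "\<And>x. (g has_derivative g' x) (at x)" and h: "0 < h"
  obtains s where "0 < s" "s < h" "g (x + h *\<^sub>R u) - g x = h * g' (x + s *\<^sub>R u) u"
proof -
  have "((\<lambda>s. g (x + s *\<^sub>R u)) has_real_derivative g' (x + s *\<^sub>R u) u) (at s)" for s
  proof -
    have "((\<lambda>s. g (x + s *\<^sub>R u)) has_derivative (\<lambda>t. g' (x + s *\<^sub>R u) (t *\<^sub>R u))) (at s)"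
      by (rule has_derivative_compose[OF _ g]) (auto intro!: derivative_eq_intros)
    then show ?thesis
      using has_derivative_linear[OF g] by (simp add: has_field_derivative_def linear_scale mult_commute_abs)
  qed
  from MVT2[OF h this] that show thesis by auto
qed

text \<open>Translation invariance of Lebesgue measure makes every difference quotient integrate to
  \<open>0\<close>; dominated convergence passes to the derivative.\<close>

lemma integral_derivative_compact_support:
  fixes g :: "'a::euclidean_space \<Rightarrow> real"
  assumes g: "\<And>x. (g has_derivative g' x) (at x)"
    and c: "continuous_on UNIV (\<lambda>x. g' x u)"
    and s: "\<And>x. norm x > R \<Longrightarrow> g x = 0"
  shows "integral\<^sup>L lborel (\<lambda>x. g' x u) = 0"
proof -
  let ?f = "\<lambda>n x. real (Suc n) * (g ((1 / real (Suc n)) *\<^sub>R u + x) - g x)"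
  \<comment> \<open>Large enough to contain \<open>x + t *\<^sub>R u\<close> for all
    \<open>t\<close> in \<open>[0, 1]\<close> whenever \<open>norm x\<close> is at most
    \<open>R + norm u\<close>; for larger \<open>x\<close> both terms of the difference quotient
    vanish.\<close>
  let ?C = "cball 0 (R + 2 * norm u) :: 'a set"
  have cg: "continuous_on UNIV g"
    using g by (meson continuous_at_imp_continuous_on has_derivative_continuous)
  have ig: "integrable lborel g" by (rule integrable_compact_support[OF cg s])
  have "compact ((\<lambda>x. g' x u) ` ?C)"
    by (intro compact_continuous_image continuous_on_subset[OF c]) auto
  from compact_imp_bounded[OF this] obtain M where M: "\<And>x. x \<in> ?C \<Longrightarrow> \<bar>g' x u\<bar> \<le> M"
    unfolding bounded_iff by (metis imageI real_norm_def)
  have mvt: "\<exists>t. 0 < t \<and> t < 1 / real (Suc n) \<and> ?f n x = g' (x + t *\<^sub>R u) u" for n x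
  proof -
    have h: "0 < 1 / real (Suc n)" by simp
    obtain t where t: "0 < t" "t < 1 / real (Suc n)"
      "g (x + (1 / real (Suc n)) *\<^sub>R u) - g x = (1 / real (Suc n)) * g' (x + t *\<^sub>R u) u"
      using directional_mvt[OF g h] by blast
    have "?f n x = g' (x + t *\<^sub>R u) u" using t(3) by (simp add: add.commute)
    then show ?thesis using t by blast
  qed
  have bound: "norm (?f n x) \<le> indicator ?C x * M" for n x
  proof (cases "norm x > R + norm u")
    case True
    have "norm ((1 / real (Suc n)) *\<^sub>R u) \<le> norm u"
      by (simp add: divide_le_eq mult_le_cancel_left1)
    then have "norm ((1 / real (Suc n)) *\<^sub>R u + x) > R"
      using True norm_diff_ineq[of x "(1 / real (Suc n)) *\<^sub>R u"] by (simp add: add.commute)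
    moreover have "norm x > R" using True norm_ge_zero[of u] by linarith
    ultimately have "?f n x = 0" using s by simp
    moreover have "0 \<le> indicator ?C x * M"
      using M[of x] by (auto simp: indicator_def)
    ultimately show ?thesis by simp
  next
    case False
    obtain t where t: "0 < t" "t < 1 / real (Suc n)" "?f n x = g' (x + t *\<^sub>R u) u" using mvt by blast
    have "1 / real (Suc n) \<le> 1" by simp
    then have "t < 1" using t(2) by linarith
    have "norm (x + t *\<^sub>R u) \<le> norm x + t * norm u"
      using norm_triangle_ineq[of x "t *\<^sub>R u"] t by simp
    moreover have "t * norm u \<le> norm u" using t(1) \<open>t < 1\<close> by (simp add: mult_left_le_one_le)
    ultimately have "x + t *\<^sub>R u \<in> ?C" "x \<in> ?C"
      using False norm_ge_zero[of u] unfolding mem_cball dist_0_norm by linarith+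
    then show ?thesis using M t by simp
  qed
  have lim: "(\<lambda>n. ?f n x) \<longlonglongrightarrow> g' x u" for x
  proof -
    obtain t where t: "\<And>n. 0 < t n" "\<And>n. t n < 1 / real (Suc n)"
      "\<And>n. ?f n x = g' (x + t n *\<^sub>R u) u" using mvt[of _ x] by metis
    have "t \<longlonglongrightarrow> 0"
    proof (rule tendsto_sandwich[OF _ _ tendsto_const LIMSEQ_inverse_real_of_nat])
      show "\<forall>\<^sub>F n in sequentially. 0 \<le> t n"
        using t(1) less_imp_le by (intro always_eventually allI) blast
      show "\<forall>\<^sub>F n in sequentially. t n \<le> inverse (real (Suc n))"
        using t(2) less_imp_le unfolding inverse_eq_divide by (intro always_eventually allI) blast
    qed
    then have "(\<lambda>n. x + t n *\<^sub>R u) \<longlonglongrightarrow> x + 0 *\<^sub>R u" by (intro tendsto_intros)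
    moreover have "isCont (\<lambda>x. g' x u) x" using c by (simp add: continuous_on_eq_continuous_at)
    ultimately have "(\<lambda>n. g' (x + t n *\<^sub>R u) u) \<longlonglongrightarrow> g' x u"
      using isCont_tendsto_compose[of x "\<lambda>x. g' x u"] by simp
    then show ?thesis unfolding t(3) .
  qed
  have "(\<lambda>n. integral\<^sup>L lborel (?f n)) \<longlonglongrightarrow> integral\<^sup>L lborel (\<lambda>x. g' x u)"
  proof (rule integral_dominated_convergence[where w = "\<lambda>x. indicator ?C x * M"])
    show "integrable lborel (\<lambda>x. indicator ?C x * M)"
      using borel_integrable_compact[of ?C "\<lambda>_. M"] by simp
    show "(\<lambda>x. g' x u) \<in> borel_measurable lborel"
      using borel_measurable_continuous_onI[OF c] by simp
    show "?f n \<in> borel_measurable lborel" for n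
      using borel_measurable_continuous_onI[OF cg] by simp
  qed (use bound lim in auto)
  moreover have "integral\<^sup>L lborel (?f n) = 0" for n
    using integral_shift[OF ig, of "(1 / real (Suc n)) *\<^sub>R u"] ig by simp
  ultimately show ?thesis by (simp add: LIMSEQ_const_iff)
qed


text \<open>\<open>sqpos (1 - sqpos (1 - s))\<close> is a \<open>C^1\<close> cutoff: 0 for \<open>s \<le> 0\<close> and 1 for \<open>s \<ge> 1\<close>.\<close>

definition sqpos :: "real \<Rightarrow> real" where
  "sqpos s = (max 0 s)\<^sup>2"

lemma sqpos_deriv [derivative_intros]:
  assumes "(f has_derivative f') (at x)"
  shows "((\<lambda>x. sqpos (f x)) has_derivative (\<lambda>h. 2 * max 0 (f x) * f' h)) (at x)"
proof -
  have "(sqpos has_real_derivative 2 * max 0 s) (at s)" for s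
  proof -
    consider "s < 0" | "s > 0" | "s = 0" by linarith
    then show ?thesis
    proof cases
      case 1
      have "((\<lambda>_. 0) has_real_derivative 2 * max 0 s) (at s)" using 1 by simp
      then show ?thesis
        by (rule has_field_derivative_transform_within_open[of _ _ _ "{..<0}"])
          (use 1 in \<open>auto simp: sqpos_def\<close>)
    next
      case 2
      have "((\<lambda>s. s\<^sup>2) has_real_derivative 2 * max 0 s) (at s)"
        using 2 by (auto intro!: derivative_eq_intros)
      then show ?thesis
        by (rule has_field_derivative_transform_within_open[of _ _ _ "{0<..}"])
          (use 2 in \<open>auto simp: sqpos_def\<close>)
    next
      case 3
      have "((\<lambda>h. max 0 h) \<longlongrightarrow> max 0 0) (at (0::real))" by (intro tendsto_intros)
      moreover have "sqpos h / h = max 0 h" for h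
        by (cases "h > 0") (auto simp: sqpos_def power2_eq_square max_def)
      ultimately show ?thesis using 3 by (simp add: DERIV_def sqpos_def)
    qed
  qed
  from has_derivative_compose[OF assms this[of "f x", unfolded has_field_derivative_def]] show ?thesis .
qed

text \<open>On a shell of radius about \<open>R\<close> the cutoff has gradient
  \<open>O(1/R)\<close>, the field is \<open>O(R^(-n))\<close> and the volume is
  \<open>O(R^n)\<close>. The boundary term is thus \<open>O(1/R)\<close>, while the divergence over
  the unit ball alone contributes a fixed positive amount.\<close>

lemma no_positive_divergence:
  fixes V :: "'a::euclidean_space \<Rightarrow> 'a"
  assumes V: "\<And>x. (V has_derivative V' x) (at x)"
    and c: "\<And>u. continuous_on UNIV (\<lambda>x. V' x u)"
    and decay: "\<And>x. norm x ^ DIM('a) * norm (V x) \<le> K"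
    and pos: "\<And>x. 0 < (\<Sum>b\<in>Basis. V' x b \<bullet> b)"
  shows False
proof -
  let ?p = "\<lambda>x. \<Sum>b\<in>Basis. V' x b \<bullet> b" and ?n = "DIM('a)"
  let ?mu = "measure lborel (cball 0 1 :: 'a set)"
  have cp: "continuous_on UNIV ?p" by (intro continuous_intros c)
  have cV: "continuous_on UNIV V"
    using V by (meson continuous_at_imp_continuous_on has_derivative_continuous)
  obtain x0 where "\<forall>y\<in>cball 0 1. ?p x0 \<le> ?p y"
    using continuous_attains_inf[of "cball 0 1" ?p] continuous_on_subset[OF cp] by auto
  then obtain m where m: "0 < m" "\<And>y. y \<in> cball 0 1 \<Longrightarrow> m \<le> ?p y" using pos by blast
  have mu: "0 < ?mu" using content_cball_pos[of 1 "0::'a"] by simp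
  have K: "0 \<le> K" using decay[of 0] by (simp add: zero_power)
  have est: "m * ?mu \<le> (16 * K * 2 ^ ?n * ?mu) / R" if R: "1 \<le> R" for R
  proof -
    \<comment> \<open>\<open>s\<close> is at least \<open>1\<close> on the ball of radius
      \<open>R\<close> and negative outside the ball of radius \<open>2 * R\<close>, so
      \<open>chi\<close> is \<open>1\<close> on the former and \<open>0\<close> outside the
      latter.\<close>
    define s where "s = (\<lambda>x::'a. 2 - (x \<bullet> x) / R\<^sup>2)"
    define chi where "chi = (\<lambda>x. sqpos (1 - sqpos (1 - s x)))"
    define dchi where "dchi = (\<lambda>x u. 4 * max 0 (1 - sqpos (1 - s x)) * max 0 (1 - s x) * (- 2 * (x \<bullet> u) / R\<^sup>2))"
    have R0: "0 < R" using R by simp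
    have ds: "(s has_derivative (\<lambda>u. - 2 * (x \<bullet> u) / R\<^sup>2)) (at x)" for x
      unfolding s_def using R0
      by (auto intro!: derivative_eq_intros simp: inner_commute field_simps)
    have dchi: "(chi has_derivative dchi x) (at x)" for x
      unfolding chi_def dchi_def
      by (rule has_derivative_eq_rhs, (rule derivative_intros ds)+) (auto simp: fun_eq_iff)
    have cs: "continuous_on UNIV s" unfolding s_def by (intro continuous_intros) (use R0 in auto)
    have csq: "continuous_on UNIV (\<lambda>x. 1 - sqpos (1 - s x))"
      unfolding sqpos_def by (intro continuous_intros cs)
    have cdchi: "continuous_on UNIV (\<lambda>x. dchi x (W x))" if "continuous_on UNIV W" for W
      unfolding dchi_def by (intro continuous_intros csq cs that) (use R0 in auto)
    have cchi: "continuous_on UNIV chi"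
      unfolding chi_def sqpos_def[of "1 - sqpos _"] by (intro continuous_intros csq)
    have out: "s x < 0" if "norm x > 2 * R" for x
    proof -
      have "(2 * R)\<^sup>2 < (norm x)\<^sup>2" using that R0 by (intro power_strict_mono) auto
      moreover have "(2 * R)\<^sup>2 = 4 * R\<^sup>2" "0 < R\<^sup>2" using R0 by (auto simp: power_mult_distrib)
      ultimately have "2 * R\<^sup>2 < (norm x)\<^sup>2" by linarith
      then show ?thesis using R0 by (simp add: s_def power2_norm_eq_inner[symmetric] field_simps)
    qed
    have s0: "chi x = 0" "dchi x u = 0" if "s x < 0" for x u
    proof -
      have "1 < (1 - s x)\<^sup>2" using that by (simp add: one_less_power)
      then have "1 < sqpos (1 - s x)" using that by (simp add: sqpos_def)
      then have "max 0 (1 - sqpos (1 - s x)) = 0" by simp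
      then show "chi x = 0" "dchi x u = 0" by (auto simp: chi_def dchi_def sqpos_def)
    qed
    have s1: "chi x = 1" "dchi x u = 0" if "1 \<le> s x" for x u
      using that by (auto simp: chi_def dchi_def sqpos_def)
    have chi_ge: "0 \<le> chi x" for x by (simp add: chi_def sqpos_def)
    have supp: "norm x > 2 * R \<Longrightarrow> chi x * c = 0" "norm x > 2 * R \<Longrightarrow> dchi x u = 0" for x c u
      using s0 out by auto
    have lin: "linear (dchi x)" for x using dchi has_derivative_linear by blast
    \<comment> \<open>Summed over \<open>b\<close>, this is the divergence theorem for
      \<open>chi\<close> times \<open>V\<close>.\<close>
    have part: "integral\<^sup>L lborel (\<lambda>x. chi x * (V' x b \<bullet> b) + dchi x b * (V x \<bullet> b)) = 0" for b
    proof (rule integral_derivative_compact_support[where g = "\<lambda>x. chi x * (V x \<bullet> b)" and R = "2 * R" and u = b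
          and g' = "\<lambda>x u. chi x * (V' x u \<bullet> b) + dchi x u * (V x \<bullet> b)"])
      show "((\<lambda>x. chi x * (V x \<bullet> b)) has_derivative (\<lambda>u. chi x * (V' x u \<bullet> b) + dchi x u * (V x \<bullet> b))) (at x)" for x
        by (rule has_derivative_eq_rhs, (rule derivative_intros dchi V)+) (auto simp: fun_eq_iff)
      show "continuous_on UNIV (\<lambda>x. chi x * (V' x b \<bullet> b) + dchi x b * (V x \<bullet> b))"
        by (intro continuous_intros cchi c cV cdchi)
    qed (use supp in auto)
    have int1: "integrable lborel (\<lambda>x. chi x * (V' x b \<bullet> b) + dchi x b * (V x \<bullet> b))" for b
      by (rule integrable_compact_support[where R = "2 * R"])
        (use supp in \<open>auto intro!: continuous_intros cchi c cV cdchi\<close>)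
    have sum_eq: "(\<Sum>b\<in>Basis. chi x * (V' x b \<bullet> b) + dchi x b * (V x \<bullet> b)) = chi x * ?p x + dchi x (V x)" for x
    proof -
      have "dchi x (V x) = (\<Sum>b\<in>Basis. (V x \<bullet> b) * dchi x b)"
        using arg_cong[OF euclidean_representation[of "V x"], of "dchi x"] lin[of x]
        by (simp add: linear_sum linear_scale)
      then show ?thesis by (simp add: sum.distrib sum_distrib_left mult.commute)
    qed
    have i1: "integrable lborel (\<lambda>x. chi x * ?p x)"
      by (rule integrable_compact_support[where R = "2 * R"]) (use supp in \<open>auto intro!: continuous_intros cchi c\<close>)
    have i2: "integrable lborel (\<lambda>x. dchi x (V x))"
      by (rule integrable_compact_support[where R = "2 * R"]) (use supp in \<open>auto intro!: cdchi cV\<close>)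
    have "(\<Sum>b\<in>Basis. integral\<^sup>L lborel (\<lambda>x. chi x * (V' x b \<bullet> b) + dchi x b * (V x \<bullet> b))) = 0"
      using part by simp
    then have "integral\<^sup>L lborel (\<lambda>x. chi x * ?p x + dchi x (V x)) = 0"
      by (subst (asm) Bochner_Integration.integral_sum[symmetric]) (use int1 sum_eq in auto)
    then have eq: "integral\<^sup>L lborel (\<lambda>x. chi x * ?p x) = - integral\<^sup>L lborel (\<lambda>x. dchi x (V x))"
      using i1 i2 by simp
    have "m * ?mu = integral\<^sup>L lborel (\<lambda>x. indicator (cball 0 1 :: 'a set) x * m)"
      by simp
    also have "\<dots> \<le> integral\<^sup>L lborel (\<lambda>x. chi x * ?p x)"
    proof (rule integral_mono)
      show "integrable lborel (\<lambda>x. indicator (cball 0 1 :: 'a set) x * m)"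
        using borel_integrable_compact[of "cball 0 1 :: 'a set" "\<lambda>_. m"] by simp
      show "indicator (cball 0 1) x * m \<le> chi x * ?p x" for x
      proof (cases "x \<in> cball 0 1")
        case True
        then have "(norm x)\<^sup>2 \<le> R\<^sup>2" using R by (intro power_mono) auto
        then have "1 \<le> s x" using R0 by (simp add: s_def power2_norm_eq_inner[symmetric] field_simps)
        then show ?thesis using True m s1 by simp
      next
        case False
        then show ?thesis using pos[of x] chi_ge[of x] by simp
      qed
    qed (rule i1)
    also have "\<dots> \<le> integral\<^sup>L lborel (\<lambda>x. indicator (cball 0 (2 * R) :: 'a set) x * (16 * K / R ^ (?n + 1)))"
    proof -
      have "- dchi x (V x) \<le> indicator (cball 0 (2 * R)) x * (16 * K / R ^ (?n + 1))" for x
      \<comment> \<open>Elsewhere the cutoff is constant. On this shell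
        \<open>R \<le> norm x \<le> 2 * R\<close>, and \<open>16 = 4 * 2 * 2\<close> collects the
        factor in \<open>dchi\<close>, the derivative of the square and the bound on
        \<open>norm x\<close>.\<close>
      proof (cases "0 \<le> s x \<and> s x \<le> 1")
        case False
        then have "dchi x (V x) = 0" using s0 s1 by force
        then show ?thesis using K R0 by simp
      next
        case True
        then have xin: "norm x \<le> 2 * R" using out[of x] by force
        have "R\<^sup>2 \<le> (norm x)\<^sup>2"
          using True R0 by (simp add: s_def power2_norm_eq_inner[symmetric] field_simps)
        then have xR: "R \<le> norm x" using R0 by (simp add: power2_le_iff_abs_le)
        then have "R ^ ?n * norm (V x) \<le> norm x ^ ?n * norm (V x)"
          using R0 by (intro mult_right_mono power_mono) auto
        also have "\<dots> \<le> K" by (rule decay)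
        finally have nV: "norm (V x) \<le> K / R ^ ?n" using R0 by (simp add: field_simps)
        have "0 \<le> sqpos (1 - s x)" "max 0 (1 - s x) \<le> 1" using True by (auto simp: sqpos_def)
        then have mm: "max 0 (1 - sqpos (1 - s x)) * max 0 (1 - s x) \<le> 1 * 1"
          by (intro mult_mono) auto
        have "\<bar>dchi x (V x)\<bar> = 4 * (max 0 (1 - sqpos (1 - s x)) * max 0 (1 - s x)) * (2 * \<bar>x \<bullet> V x\<bar> / R\<^sup>2)"
          unfolding dchi_def by (simp add: abs_mult)
        also have "\<dots> \<le> 4 * (1 * 1) * (2 * \<bar>x \<bullet> V x\<bar> / R\<^sup>2)"
          using mm by (intro mult_right_mono mult_left_mono) auto
        also have "\<dots> \<le> 4 * (1 * 1) * (2 * (2 * R * (K / R ^ ?n)) / R\<^sup>2)"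
        proof -
          have "\<bar>x \<bullet> V x\<bar> \<le> norm x * norm (V x)" by (rule Cauchy_Schwarz_ineq2)
          also have "\<dots> \<le> 2 * R * (K / R ^ ?n)" using xin nV R0 by (intro mult_mono) auto
          finally show ?thesis by (intro mult_left_mono divide_right_mono) auto
        qed
        also have "\<dots> = 16 * K / R ^ (?n + 1)" using R0 by (simp add: field_simps power2_eq_square)
        finally show ?thesis using xin by simp
      qed
      moreover have "integrable lborel (\<lambda>x. indicator (cball 0 (2 * R) :: 'a set) x * (16 * K / R ^ (?n + 1)))"
        using borel_integrable_compact[of "cball 0 (2 * R) :: 'a set" "\<lambda>_. 16 * K / R ^ (?n + 1)"] by simp
      ultimately have "integral\<^sup>L lborel (\<lambda>x. - dchi x (V x)) \<le>
          integral\<^sup>L lborel (\<lambda>x. indicator (cball 0 (2 * R) :: 'a set) x * (16 * K / R ^ (?n + 1)))"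
        using i2 by (intro integral_mono) auto
      then show ?thesis using eq by simp
    qed
    also have "\<dots> = (2 * R) ^ ?n * ?mu * (16 * K / R ^ (?n + 1))"
      using R0 by (simp add: content_cball)
    also have "\<dots> = (16 * K * 2 ^ ?n * ?mu) / R" using R0 by (simp add: field_simps power_mult_distrib)
    finally show ?thesis .
  qed
  let ?A = "16 * K * 2 ^ ?n * ?mu"
  \<comment> \<open>For this radius \<open>est\<close> would bound the fixed positive number
    \<open>m * ?mu\<close> by something smaller.\<close>
  define R where "R = max 1 (?A / (m * ?mu) + 1)"
  have A0: "0 \<le> ?A" using K mu by simp
  have R: "1 \<le> R" "?A / (m * ?mu) < R" by (auto simp: R_def)
  then have "?A / R < m * ?mu" using m mu by (simp add: field_simps)
  with est[OF R(1)] show False by simp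
qed

subsection \<open>Pfaffians of six-dimensional skew matrices\<close>

text \<open>\<open>pf_adj w w\<close> is the Pfaffian adjugate of a skew \<open>6 \<times> 6\<close> matrix \<open>w\<close>, built from the Pfaffians of
  its \<open>4 \<times> 4\<close> minors; \<open>pf_adj w v\<close> polarizes it, so that it can be differentiated.\<close>

definition pf_polar :: "(nat \<Rightarrow> nat \<Rightarrow> real) \<Rightarrow> (nat \<Rightarrow> nat \<Rightarrow> real) \<Rightarrow> nat list \<Rightarrow> real" where
  "pf_polar w v l =
     w (l!0) (l!1) * v (l!2) (l!3) - w (l!0) (l!2) * v (l!1) (l!3) + w (l!0) (l!3) * v (l!1) (l!2)"

definition pf_adj :: "(nat \<Rightarrow> nat \<Rightarrow> real) \<Rightarrow> (nat \<Rightarrow> nat \<Rightarrow> real) \<Rightarrow> nat \<Rightarrow> nat \<Rightarrow> real" where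
  "pf_adj w v i j =
     (if i < j then (-1) ^ (i + j + 1) else if j < i then (-1) ^ (i + j) else 0) *
     pf_polar w v (filter (\<lambda>k. k \<noteq> i \<and> k \<noteq> j) [0..<6])"

definition pf6 :: "(nat \<Rightarrow> nat \<Rightarrow> real) \<Rightarrow> real" where
  "pf6 w = (\<Sum>j<6. w 0 j * pf_adj w w 0 j)"

lemma sum_lessThan_6: "(\<Sum>i<6. f i) = f 0 + f 1 + f 2 + f 3 + f 4 + f (5::nat)"
  by (simp add: eval_nat_numeral add.assoc)

lemma less_6_cases: "i < 6 \<longleftrightarrow> i = 0 \<or> i = 1 \<or> i = 2 \<or> i = 3 \<or> i = 4 \<or> i = (5::nat)"
  by auto

lemma upt6: "[0..<6] = [0, 1, 2, 3, 4, 5]" by (simp add: eval_nat_numeral)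

lemma pf_adj_skew: "pf_adj w v j i = - pf_adj w v i j"
proof -
  have "(\<lambda>k. k \<noteq> j \<and> k \<noteq> i) = (\<lambda>k. k \<noteq> i \<and> k \<noteq> j)" by auto
  then show ?thesis by (simp add: pf_adj_def add.commute)
qed

lemma pf_adj_table:
  shows "pf_adj w v 0 1 = (w 2 3 * v 4 5 - w 2 4 * v 3 5 + w 2 5 * v 3 4)"
    "pf_adj w v 0 2 = -(w 1 3 * v 4 5 - w 1 4 * v 3 5 + w 1 5 * v 3 4)"
    "pf_adj w v 0 3 = (w 1 2 * v 4 5 - w 1 4 * v 2 5 + w 1 5 * v 2 4)"
    "pf_adj w v 0 4 = -(w 1 2 * v 3 5 - w 1 3 * v 2 5 + w 1 5 * v 2 3)"
    "pf_adj w v 0 5 = (w 1 2 * v 3 4 - w 1 3 * v 2 4 + w 1 4 * v 2 3)"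
    "pf_adj w v 1 2 = (w 0 3 * v 4 5 - w 0 4 * v 3 5 + w 0 5 * v 3 4)"
    "pf_adj w v 1 3 = -(w 0 2 * v 4 5 - w 0 4 * v 2 5 + w 0 5 * v 2 4)"
    "pf_adj w v 1 4 = (w 0 2 * v 3 5 - w 0 3 * v 2 5 + w 0 5 * v 2 3)"
    "pf_adj w v 1 5 = -(w 0 2 * v 3 4 - w 0 3 * v 2 4 + w 0 4 * v 2 3)"
    "pf_adj w v 2 3 = (w 0 1 * v 4 5 - w 0 4 * v 1 5 + w 0 5 * v 1 4)"
    "pf_adj w v 2 4 = -(w 0 1 * v 3 5 - w 0 3 * v 1 5 + w 0 5 * v 1 3)"
    "pf_adj w v 2 5 = (w 0 1 * v 3 4 - w 0 3 * v 1 4 + w 0 4 * v 1 3)"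
    "pf_adj w v 3 4 = (w 0 1 * v 2 5 - w 0 2 * v 1 5 + w 0 5 * v 1 2)"
    "pf_adj w v 3 5 = -(w 0 1 * v 2 4 - w 0 2 * v 1 4 + w 0 4 * v 1 2)"
    "pf_adj w v 4 5 = (w 0 1 * v 2 3 - w 0 2 * v 1 3 + w 0 3 * v 1 2)"
  by (simp_all add: pf_adj_def pf_polar_def upt6)

lemma pf_adj_below: "j < i \<Longrightarrow> pf_adj w v i j = - pf_adj w v j i"
  by (rule pf_adj_skew)

lemma pf_adj_diag: "pf_adj w v i i = 0"
  by (simp add: pf_adj_def)

lemmas pf_adj_simps = sum_lessThan_6 pf_adj_below pf_adj_diag pf_adj_table

text \<open>The cofactor expansion of the Pfaffian: for \<open>i = k\<close> an expansion along row
  \<open>i\<close>, otherwise the expansion of a Pfaffian with a repeated row. The sign comes from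
  contracting with the first index of the skew \<open>pf_adj\<close>.\<close>

lemma pf_adj_inverse:
  assumes "\<And>i j. w i j = - w j i" "i < 6" "k < 6"
  shows "(\<Sum>j<6. w i j * pf_adj w w j k) = (if i = k then - pf6 w else 0)"
proof -
  have sk: "w j i = - w i j" if "i < j" for i j using assms(1)[of j i] .
  have dg: "w i i = 0" for i using assms(1)[of i i] by simp
  show ?thesis
    using assms(2,3) unfolding less_6_cases
    by (elim disjE; simp add: pf_adj_simps pf6_def sk dg del: One_nat_def; simp add: algebra_simps del: One_nat_def)
qed

text \<open>With \<open>D i k l\<close> as the derivative of \<open>w k l\<close> in direction
  \<open>i\<close>, this is d(omega^2) = 0: \<open>pf_adj w w\<close> is, up to a factor, the dual
  bivector of omega^2, and its divergence is a combination of cyclic sums of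
  \<open>D\<close>.\<close>

lemma pf_adj_closed:
  assumes sk: "\<And>i j. w i j = - w j i" and D: "\<And>i k l. D i k l = - D i l k"
    and cl: "\<And>i k l. D i k l + D k l i + D l i k = 0" and "j < 6"
  shows "(\<Sum>i<6. pf_adj w (D i) i j + pf_adj (D i) w i j) = 0"
proof -
  have sk': "w j i = - w i j" if "i < j" for i j using sk[of j i] .
  have D': "D i l k = - D i k l" if "k < l" for i k l using D[of i l k] .
  have cl': "D i k l = D l k i - D k l i" if "k < l" "l < i" for i k l
    using cl[of i k l] D[of l i k] by simp
  show ?thesis
    using assms(4) unfolding less_6_cases
    by (elim disjE; simp add: pf_adj_simps sk' D' cl' del: One_nat_def; simp add: algebra_simps del: One_nat_def)
qed

text \<open>The coordinate form of d alpha wedge omega^2 = omega^3, with \<open>A i j\<close> the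
  derivative of alpha_j in direction \<open>i\<close>. As \<open>pf_adj\<close> is skew, only the
  antisymmetric half of \<open>A\<close> counts, and \<open>3\<close> is half of the six row
  expansions of the Pfaffian.\<close>

lemma pf_adj_trace:
  assumes "\<And>i j. i < 6 \<Longrightarrow> j < 6 \<Longrightarrow> A i j - A j i = w i j"
  shows "(\<Sum>i<6. \<Sum>j<6. A i j * pf_adj w w i j) = 3 * pf6 w"
proof -
  have sk: "w j i = - w i j" if "i < 6" "j < 6" for i j using assms[of i j] assms[of j i] that by simp
  have "(\<Sum>j<6. w i j * pf_adj w w i j) = pf6 w" if "i < 6" for i
  proof -
    \<comment> \<open>\<open>pf_adj_inverse\<close> asks for skewness at all indices, so the matrix
      is cut off to those below \<open>6\<close>.\<close>
    define v where "v = (\<lambda>i j. if i < 6 \<and> j < 6 then w i j else 0)"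
    have "v i j = - v j i" for i j unfolding v_def using assms[of i j] assms[of j i] by auto
    from pf_adj_inverse[of v, OF this that that]
    have "(\<Sum>j<6. v i j * pf_adj v v i j) = pf6 v"
      by (subst (asm) pf_adj_skew) (simp add: sum_negf)
    moreover have "pf_adj v v i j = pf_adj w w i j" if "i < 6" "j < 6" for i j
      using that unfolding less_6_cases
      by (elim disjE; simp add: pf_adj_simps v_def del: One_nat_def)
    ultimately show ?thesis using that by (simp add: pf6_def v_def)
  qed
  then have "(\<Sum>i<6. \<Sum>j<6. w i j * pf_adj w w i j) = 6 * pf6 w" by simp
  moreover have "(\<Sum>i<6. \<Sum>j<6. w i j * pf_adj w w i j) =
      (\<Sum>i<6. \<Sum>j<6. A i j * pf_adj w w i j) - (\<Sum>i<6. \<Sum>j<6. A j i * pf_adj w w i j)"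
    by (simp add: assms[symmetric] left_diff_distrib sum_subtractf)
  moreover have "(\<Sum>i<6. \<Sum>j<6. A j i * pf_adj w w i j) = (\<Sum>i<6. \<Sum>j<6. A j i * - pf_adj w w j i)"
    by (intro sum.cong refl arg_cong2[where f = "(*)"] pf_adj_skew)
  moreover have "\<dots> = - (\<Sum>i<6. \<Sum>j<6. A i j * pf_adj w w i j)"
    by (subst sum.swap) (simp add: sum_negf)
  ultimately show ?thesis by simp
qed

text \<open>Sorting the indices by adjacent transpositions only changes the sign, and repeated
  indices give \<open>0\<close>. This reduces a statement about all quadruples to the fifteen
  increasing ones.\<close>

lemma alternating_4_eq_0:
  fixes Q :: "nat \<Rightarrow> nat \<Rightarrow> nat \<Rightarrow> nat \<Rightarrow> real"
  assumes swap: "\<And>a b c d. Q a b c d = - Q b a c d" "\<And>a b c d. Q a b c d = - Q a c b d"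
      "\<And>a b c d. Q a b c d = - Q a b d c"
    and inc: "\<And>a b c d. a < b \<Longrightarrow> b < c \<Longrightarrow> c < d \<Longrightarrow> d < 6 \<Longrightarrow> Q a b c d = 0"
    and "a < 6" "b < 6" "c < 6" "d < 6"
  shows "Q a b c d = 0"
proof -
  have eq: "Q a b c d = 0" if "a = b \<or> a = c \<or> a = d \<or> b = c \<or> b = d \<or> c = d" for a b c d
    using swap(1)[of a b c d] swap(2)[of a b c d] swap(3)[of a b c d]
      swap(1)[of a c b d] swap(3)[of a c b d] swap(2)[of a b d c] swap(1)[of a d b c] that by fastforce
  \<comment> \<open>Once the largest index stands last, the six orders of the other three remain.
    The cases below move the largest index there.\<close>
  have last: "Q a b c d = 0" if "c < d" "b < d" "a < d" "d < 6" for a b c d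
    using inc[of a b c d] inc[of b a c d] inc[of a c b d] inc[of b c a d] inc[of c a b d] inc[of c b a d]
      swap(1)[of a b c d] swap(2)[of a b c d] swap(2)[of b a c d] swap(1)[of a c b d] swap(1)[of b c a d]
      swap(2)[of c a b d] swap(1)[of c b a d] that
    by (metis linorder_neqE_nat neg_equal_zero neg_equal_0_iff_equal)
  consider "a = b \<or> a = c \<or> a = d \<or> b = c \<or> b = d \<or> c = d"
    | "a < d" "b < d" "c < d" | "a < c" "b < c" "d < c" | "a < b" "c < b" "d < b" | "b < a" "c < a" "d < a"
    by linarith
  then show ?thesis
  proof cases
    case 1
    then show ?thesis by (rule eq)
  next
    case 2
    then show ?thesis using last[of c d b a] assms(8) by simp
  next
    case 3
    then show ?thesis using last[of d c b a] last[of a b d c] swap(3)[of a b c d] assms(7) by simp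
  next
    case 4
    then show ?thesis using last[of d b c a] last[of a c d b] swap(2)[of a b c d] swap(3)[of a c b d] assms(6) by simp
  next
    case 5
    then show ?thesis
      using last[of d a c b] last[of b c d a] swap(1)[of a b c d] swap(2)[of b a c d] swap(3)[of b c a d] assms(5) by simp
  qed
qed

text \<open>A nonzero column of \<open>pf_adj w w\<close> lies in the kernel by
  \<open>pf_adj_inverse\<close>. If there is none, all \<open>4 \<times> 4\<close> Pfaffians vanish,
  so \<open>w\<close> has rank at most two and a kernel vector can be written down from its
  entries.\<close>

lemma pf6_eq_0_imp_degenerate:
  assumes skew: "\<And>i j. w i j = - w j i" and pf: "pf6 w = 0"
  obtains c :: "nat \<Rightarrow> real" and k where "k < 6" "c k \<noteq> 0" "\<And>i. i < 6 \<Longrightarrow> (\<Sum>j<6. w i j * c j) = 0"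
proof (cases "\<exists>j<6. \<exists>k<6. pf_adj w w j k \<noteq> 0")
  case True
  then obtain j k where "j < 6" "k < 6" "pf_adj w w j k \<noteq> 0" by blast
  then show ?thesis using that[of j "\<lambda>j. pf_adj w w j k"] pf_adj_inverse[of w, OF skew] pf by simp
next
  case False
  have sk: "w j i = - w i j" if "i < j" for i j using skew[of j i] .
  have dg: "w i i = 0" for i using skew[of i i] by simp
  have z: "pf_adj w w i j = 0" if "i < 6" "j < 6" for i j using False that by blast
  show ?thesis
  proof (cases "\<exists>i<6. \<exists>j<6. i < j \<and> w i j \<noteq> 0")
    case False
    then have "w i j = 0" if "i < 6" "j < 6" for i j using sk dg that by (metis linorder_neqE_nat neg_0_equal_iff_equal)
    then show ?thesis using that[of 0 "\<lambda>_. 1"] by simp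
  next
    case True
    then obtain i j where ij: "i < 6" "j < 6" "i < j" "w i j \<noteq> 0" by blast
    \<comment> \<open>Any third index would do.\<close>
    define k :: nat where "k = (if i \<noteq> 0 then 0 else if j \<noteq> 1 then 1 else 2)"
    have k: "k < 6" "k \<noteq> i" "k \<noteq> j" using ij by (auto simp: k_def)
    \<comment> \<open>Row \<open>l\<close> of \<open>w\<close> applied to this vector is the
      Pfaffian of the minor with indices \<open>l\<close>, \<open>i\<close>, \<open>j\<close>,
      \<open>k\<close>, which vanishes; the entry at \<open>k\<close> is \<open>w i j\<close>, which
      does not.\<close>
    define c where "c = (\<lambda>m. if m = i then w j k else if m = j then - w i k else if m = k then w i j else 0)"
    have sum_c: "(\<Sum>m<6. w l m * c m) = w l i * w j k - w l j * w i k + w l k * w i j" if "l < 6" for l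
    proof -
      have "(\<Sum>m<6. w l m * c m) = (\<Sum>m\<in>{i, j, k}. w l m * c m)"
        using ij k by (intro sum.mono_neutral_right) (auto simp: c_def)
      then show ?thesis using ij k by (simp add: c_def)
    qed
    have z_table: "w 2 3 * w 4 5 - w 2 4 * w 3 5 + w 2 5 * w 3 4 = 0"
      "w 1 3 * w 4 5 - w 1 4 * w 3 5 + w 1 5 * w 3 4 = 0"
      "w 1 2 * w 4 5 - w 1 4 * w 2 5 + w 1 5 * w 2 4 = 0"
      "w 1 2 * w 3 5 - w 1 3 * w 2 5 + w 1 5 * w 2 3 = 0"
      "w 1 2 * w 3 4 - w 1 3 * w 2 4 + w 1 4 * w 2 3 = 0"
      "w 0 3 * w 4 5 - w 0 4 * w 3 5 + w 0 5 * w 3 4 = 0"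
      "w 0 2 * w 4 5 - w 0 4 * w 2 5 + w 0 5 * w 2 4 = 0"
      "w 0 2 * w 3 5 - w 0 3 * w 2 5 + w 0 5 * w 2 3 = 0"
      "w 0 2 * w 3 4 - w 0 3 * w 2 4 + w 0 4 * w 2 3 = 0"
      "w 0 1 * w 4 5 - w 0 4 * w 1 5 + w 0 5 * w 1 4 = 0"
      "w 0 1 * w 3 5 - w 0 3 * w 1 5 + w 0 5 * w 1 3 = 0"
      "w 0 1 * w 3 4 - w 0 3 * w 1 4 + w 0 4 * w 1 3 = 0"
      "w 0 1 * w 2 5 - w 0 2 * w 1 5 + w 0 5 * w 1 2 = 0"
      "w 0 1 * w 2 4 - w 0 2 * w 1 4 + w 0 4 * w 1 2 = 0"
      "w 0 1 * w 2 3 - w 0 2 * w 1 3 + w 0 3 * w 1 2 = 0"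
      using z[of 0 1] z[of 0 2] z[of 0 3] z[of 0 4] z[of 0 5] z[of 1 2] z[of 1 3] z[of 1 4] z[of 1 5] z[of 2 3] z[of 2 4] z[of 2 5] z[of 3 4] z[of 3 5] z[of 4 5]
      by (simp_all add: pf_adj_table del: One_nat_def)
    define Q where "Q = (\<lambda>a b c d. w a b * w c d - w a c * w b d + w a d * w b c)"
    have "Q l i j k = 0" if "l < 6" for l
    proof (rule alternating_4_eq_0)
      show "Q a b c d = - Q b a c d" "Q a b c d = - Q a c b d" "Q a b c d = - Q a b d c" for a b c d
        unfolding Q_def using skew[of b a] skew[of c b] skew[of d c] by simp_all
      show "Q a b c d = 0" if "a < b" "b < c" "c < d" "d < 6" for a b c d
      proof -
        have "a = 0 \<or> a = 1 \<or> a = 2" "b = 1 \<or> b = 2 \<or> b = 3" "c = 2 \<or> c = 3 \<or> c = 4" "d = 3 \<or> d = 4 \<or> d = 5"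
          using that by auto
        then show ?thesis
          using that unfolding Q_def
          by (elim disjE) (simp_all add: z_table del: One_nat_def)
      qed
    qed (use that ij k in auto)
    then have "w l i * w j k - w l j * w i k + w l k * w i j = 0" if "l < 6" for l
      using that by (simp add: Q_def)
    with sum_c show ?thesis using that[of k c] k ij by (simp add: c_def)
  qed
qed

subsection \<open>Closed two-forms on a six-dimensional space\<close>

text \<open>Differentiation under the integral sign. The weight \<open>t\<close> is the one in the
  homotopy operator for two-forms, and the chain rule supplies a second factor
  \<open>t\<close>.\<close>

lemma radial_integral:
  fixes f :: "'a::euclidean_space \<Rightarrow> real"
  assumes f: "\<And>x. (f has_derivative f' x) (at x)"
    and c: "\<And>h. continuous_on UNIV (\<lambda>x. f' x h)"
  shows "((\<lambda>x. integral {0..1} (\<lambda>t. t * f (t *\<^sub>R x))) has_derivative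
      (\<lambda>h. integral {0..1} (\<lambda>t. t\<^sup>2 * f' (t *\<^sub>R x) h))) (at x)"
    and "continuous_on UNIV (\<lambda>x. integral {0..1} (\<lambda>t. t\<^sup>2 * f' (t *\<^sub>R x) h))"
proof -
  have cf: "continuous_on UNIV f"
    using f by (meson continuous_at_imp_continuous_on has_derivative_continuous)
  \<comment> \<open>The Leibniz rule wants the derivative as one operator-valued function; its
    continuity is checked vector by vector.\<close>
  define G where "G = (\<lambda>x t. t\<^sup>2 *\<^sub>R Blinfun (f' (t *\<^sub>R x)))"
  have G: "blinfun_apply (G x t) h = t\<^sup>2 * f' (t *\<^sub>R x) h" for x t h
    using f has_derivative_bounded_linear unfolding G_def
    by (metis bounded_linear_Blinfun_apply real_scaleR_def scaleR_blinfun.rep_eq)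
  have cG: "continuous_on S (\<lambda>(x, t). G x t)" for S
  proof (rule continuous_on_blinfun_componentwise)
    show "continuous_on S (\<lambda>p. blinfun_apply (case p of (x, t) \<Rightarrow> G x t) h)" for h
      unfolding split_beta G
      by (intro continuous_intros continuous_on_compose2[OF c[of h]]) auto
  qed
  have "((\<lambda>x. integral (cbox 0 1) (\<lambda>t. t * f (t *\<^sub>R x))) has_derivative
      blinfun_apply (integral (cbox 0 1) (G x))) (at x within UNIV)"
  proof (rule leibniz_rule[OF _ _ cG])
    show "((\<lambda>x. t * f (t *\<^sub>R x)) has_derivative blinfun_apply (G x t)) (at x within UNIV)" for x t
    proof -
      have "((\<lambda>x. f (t *\<^sub>R x)) has_derivative (\<lambda>h. f' (t *\<^sub>R x) (t *\<^sub>R h))) (at x)"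
        by (rule has_derivative_compose[OF _ f]) (auto intro!: derivative_eq_intros)
      then have "((\<lambda>x. t * f (t *\<^sub>R x)) has_derivative (\<lambda>h. t * f' (t *\<^sub>R x) (t *\<^sub>R h))) (at x)"
        by (rule has_derivative_mult_right)
      moreover have "(\<lambda>h. t * f' (t *\<^sub>R x) (t *\<^sub>R h)) = blinfun_apply (G x t)"
        using has_derivative_linear[OF f] by (simp add: fun_eq_iff G linear_scale power2_eq_square)
      ultimately show ?thesis by simp
    qed
    show "(\<lambda>t. t * f (t *\<^sub>R x)) integrable_on cbox 0 1" for x
      by (intro integrable_continuous continuous_intros continuous_on_compose2[OF cf]) auto
  qed auto
  moreover have "blinfun_apply (integral (cbox 0 1) (G x)) h = integral (cbox 0 1) (\<lambda>t. t\<^sup>2 * f' (t *\<^sub>R x) h)" for h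
  proof (subst blinfun_apply_integral)
    have "continuous_on (cbox 0 1) (\<lambda>t. case (x, t) of (x, t) \<Rightarrow> G x t)"
      by (rule continuous_on_compose2[OF cG[of UNIV]]) (auto intro!: continuous_intros)
    then show "G x integrable_on cbox 0 1" by (intro integrable_continuous) simp
  qed (simp add: G)
  then have "blinfun_apply (integral (cbox 0 1) (G x)) = (\<lambda>h. integral (cbox 0 1) (\<lambda>t. t\<^sup>2 * f' (t *\<^sub>R x) h))"
    by (rule ext)
  ultimately show "((\<lambda>x. integral {0..1} (\<lambda>t. t * f (t *\<^sub>R x))) has_derivative
      (\<lambda>h. integral {0..1} (\<lambda>t. t\<^sup>2 * f' (t *\<^sub>R x) h))) (at x)"
    by simp
  have "continuous_on UNIV (\<lambda>x. integral (cbox 0 1) (\<lambda>t. t\<^sup>2 * f' (t *\<^sub>R x) h))"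
    by (rule integral_continuous_on_param)
      (auto simp: split_beta intro!: continuous_intros continuous_on_compose2[OF c[of h]])
  then show "continuous_on UNIV (\<lambda>x. integral {0..1} (\<lambda>t. t\<^sup>2 * f' (t *\<^sub>R x) h))" by simp
qed

text \<open>\<open>dW x h u v\<close> differentiates the coefficient \<open>W x u v\<close> in
  direction \<open>h\<close> with \<open>u\<close> and \<open>v\<close> constant, so the exterior
  derivative has no bracket terms and closedness is a cyclic sum.\<close>

locale closed_two_form =
  fixes W :: "'a::euclidean_space \<Rightarrow> 'a \<Rightarrow> 'a \<Rightarrow> real" and dW :: "'a \<Rightarrow> 'a \<Rightarrow> 'a \<Rightarrow> 'a \<Rightarrow> real"
  assumes deriv: "\<And>x u v. ((\<lambda>x. W x u v) has_derivative (\<lambda>h. dW x h u v)) (at x)"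
    and cont: "\<And>h u v. continuous_on UNIV (\<lambda>x. dW x h u v)"
    and lin: "\<And>x v. linear (\<lambda>u. W x u v)" and dlin: "\<And>x h v. linear (\<lambda>u. dW x h u v)"
    and skew: "\<And>x u v. W x u v = - W x v u" and dskew: "\<And>x h u v. dW x h u v = - dW x h v u"
    and closed: "\<And>x a b c. dW x a b c + dW x b c a + dW x c a b = 0"
begin

text \<open>The primitive of \<open>W\<close> given by the Poincare lemma: \<open>pot x v\<close> is the integral of \<open>t * W (t x) x v\<close>.\<close>

definition pot :: "'a \<Rightarrow> 'a \<Rightarrow> real" where
  "pot x v = (\<Sum>b\<in>Basis. (x \<bullet> b) * integral {0..1} (\<lambda>t. t * W (t *\<^sub>R x) b v))"

definition dpot :: "'a \<Rightarrow> 'a \<Rightarrow> 'a \<Rightarrow> real" where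
  "dpot x h v = (\<Sum>b\<in>Basis. (h \<bullet> b) * integral {0..1} (\<lambda>t. t * W (t *\<^sub>R x) b v)
     + (x \<bullet> b) * integral {0..1} (\<lambda>t. t\<^sup>2 * dW (t *\<^sub>R x) h b v))"

lemma continuous_W: "continuous_on UNIV (\<lambda>x. W x u v)"
  using deriv by (meson continuous_at_imp_continuous_on has_derivative_continuous)

lemma pot_deriv: "((\<lambda>x. pot x v) has_derivative (\<lambda>h. dpot x h v)) (at x)"
  unfolding pot_def dpot_def
  by (rule has_derivative_eq_rhs, (rule derivative_intros radial_integral(1)[OF deriv cont])+)
    (auto simp: fun_eq_iff intro!: sum.cong)

lemma continuous_dpot: "continuous_on UNIV (\<lambda>x. dpot x h v)"
proof -
  have "continuous_on UNIV (\<lambda>x. integral {0..1} (\<lambda>t. t * W (t *\<^sub>R x) b v))" for b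
    using radial_integral(1)[OF deriv cont]
    by (meson continuous_at_imp_continuous_on has_derivative_continuous)
  then show ?thesis
    unfolding dpot_def by (intro continuous_intros radial_integral(2)[OF deriv cont])
qed

lemma integrable_W: "(\<lambda>t. t * W (t *\<^sub>R x) u v) integrable_on {0..1}"
  by (intro integrable_continuous_real continuous_intros continuous_on_compose2[OF continuous_W]) auto

lemma integrable_dW: "(\<lambda>t. t\<^sup>2 * dW (t *\<^sub>R x) h u v) integrable_on {0..1}"
  by (intro integrable_continuous_real continuous_intros continuous_on_compose2[OF cont]) auto

lemma linear_expand: "linear f \<Longrightarrow> f w = (\<Sum>b\<in>Basis. (w \<bullet> b) * f b)" for f :: "'a \<Rightarrow> real"
  using arg_cong[OF euclidean_representation[of w], of f] by (simp add: linear_sum linear_scale)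

lemma sum_integral_W:
  "(\<Sum>b\<in>Basis. (w \<bullet> b) * integral {0..1} (\<lambda>t. t * W (t *\<^sub>R x) b v)) = integral {0..1} (\<lambda>t. t * W (t *\<^sub>R x) w v)"
  (is "?l = ?r")
proof -
  have "?l = integral {0..1} (\<lambda>t. \<Sum>b\<in>Basis. (w \<bullet> b) * (t * W (t *\<^sub>R x) b v))"
    by (subst integral_sum) (auto intro!: integrable_on_mult_right integrable_W)
  also have "\<dots> = ?r"
  proof -
    have "(\<Sum>b\<in>Basis. (w \<bullet> b) * (t * W (t *\<^sub>R x) b v)) = t * W (t *\<^sub>R x) w v" for t
    by (subst linear_expand[OF lin[of "t *\<^sub>R x" v], of w]) (simp add: sum_distrib_left mult_ac)
    then show ?thesis by (simp only:)
  qed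
  finally show ?thesis .
qed

lemma sum_integral_dW:
  "(\<Sum>b\<in>Basis. (w \<bullet> b) * integral {0..1} (\<lambda>t. t\<^sup>2 * dW (t *\<^sub>R x) h b v)) =
     integral {0..1} (\<lambda>t. t\<^sup>2 * dW (t *\<^sub>R x) h w v)"
  (is "?l = ?r")
proof -
  have "?l = integral {0..1} (\<lambda>t. \<Sum>b\<in>Basis. (w \<bullet> b) * (t\<^sup>2 * dW (t *\<^sub>R x) h b v))"
    by (subst integral_sum) (auto intro!: integrable_on_mult_right integrable_dW)
  also have "\<dots> = ?r"
  proof -
    have "(\<Sum>b\<in>Basis. (w \<bullet> b) * (t\<^sup>2 * dW (t *\<^sub>R x) h b v)) = t\<^sup>2 * dW (t *\<^sub>R x) h w v" for t
    by (subst linear_expand[OF dlin[of "t *\<^sub>R x" h v], of w]) (simp add: sum_distrib_left mult_ac)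
    then show ?thesis by (simp only:)
  qed
  finally show ?thesis .
qed

text \<open>By closedness the antisymmetrized integrand is the \<open>t\<close>-derivative of
  \<open>t\<^sup>2 * W (t *\<^sub>R x) h v\<close>, so the integral is its value at
  \<open>t = 1\<close>.\<close>

lemma exterior_derivative_pot: "dpot x h v - dpot x v h = W x h v"
proof -
  have dpot: "dpot x h v = integral {0..1} (\<lambda>t. t * W (t *\<^sub>R x) h v) + integral {0..1} (\<lambda>t. t\<^sup>2 * dW (t *\<^sub>R x) h x v)"
    for h v by (simp add: dpot_def sum.distrib sum_integral_W sum_integral_dW)
  have "dpot x h v - dpot x v h =
      integral {0..1} (\<lambda>t. t * W (t *\<^sub>R x) h v + t\<^sup>2 * dW (t *\<^sub>R x) h x v - (t * W (t *\<^sub>R x) v h + t\<^sup>2 * dW (t *\<^sub>R x) v x h))"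
    by (simp add: dpot integral_diff integral_add integrable_W integrable_dW integrable_add)
  also have "\<dots> = integral {0..1} (\<lambda>t. 2 * t * W (t *\<^sub>R x) h v + t\<^sup>2 * dW (t *\<^sub>R x) x h v)"
  proof (rule arg_cong[where f = "integral {0..1}"], rule ext)
    fix t
    have "dW (t *\<^sub>R x) h x v - dW (t *\<^sub>R x) v x h = dW (t *\<^sub>R x) x h v"
      using closed[of "t *\<^sub>R x" h x v] dskew[of "t *\<^sub>R x" v x h] dskew[of "t *\<^sub>R x" x v h] by simp
    then have "t\<^sup>2 * dW (t *\<^sub>R x) h x v - t\<^sup>2 * dW (t *\<^sub>R x) v x h = t\<^sup>2 * dW (t *\<^sub>R x) x h v"
      by (metis right_diff_distrib)
    then show "t * W (t *\<^sub>R x) h v + t\<^sup>2 * dW (t *\<^sub>R x) h x v - (t * W (t *\<^sub>R x) v h + t\<^sup>2 * dW (t *\<^sub>R x) v x h) =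
        2 * t * W (t *\<^sub>R x) h v + t\<^sup>2 * dW (t *\<^sub>R x) x h v"
      using skew[of "t *\<^sub>R x" v h] by simp
  qed
  also have "\<dots> = W x h v"
  proof (rule integral_unique)
    have "((\<lambda>t. t\<^sup>2 * W (t *\<^sub>R x) h v) has_vector_derivative (2 * t * W (t *\<^sub>R x) h v + t\<^sup>2 * dW (t *\<^sub>R x) x h v))
        (at t within {0..1})" for t
    proof -
      have "((\<lambda>t. W (t *\<^sub>R x) h v) has_derivative (\<lambda>s. dW (t *\<^sub>R x) (s *\<^sub>R x) h v)) (at t)"
        by (rule has_derivative_compose[OF _ deriv]) (auto intro!: derivative_eq_intros)
      then have "((\<lambda>t. W (t *\<^sub>R x) h v) has_real_derivative dW (t *\<^sub>R x) x h v) (at t)"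
        using linear_scale[OF has_derivative_linear[OF deriv[of h v "t *\<^sub>R x"]]]
        by (simp add: has_field_derivative_def mult_commute_abs)
      then have "((\<lambda>t. t\<^sup>2 * W (t *\<^sub>R x) h v) has_real_derivative (2 * t * W (t *\<^sub>R x) h v + t\<^sup>2 * dW (t *\<^sub>R x) x h v)) (at t)"
        by (auto intro!: derivative_eq_intros)
      then show ?thesis
        by (meson has_field_derivative_at_within has_real_derivative_iff_has_vector_derivative)
    qed
    from fundamental_theorem_of_calculus[OF _ this]
    show "((\<lambda>t. 2 * t * W (t *\<^sub>R x) h v + t\<^sup>2 * dW (t *\<^sub>R x) x h v) has_integral W x h v) {0..1}" by fastforce
  qed
  finally show ?thesis .
qed

text \<open>A crude bound by linear growth suffices, because the other two factors of alpha wedge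
  omega^2 carry all the decay that is needed.\<close>

lemma pot_bound:
  assumes "\<And>x u v. \<bar>W x u v\<bar> \<le> K * norm u * norm v"
  shows "\<bar>pot x v\<bar> \<le> K * norm x * norm v"
proof -
  have "pot x v = integral {0..1} (\<lambda>t. t * W (t *\<^sub>R x) x v)"
    by (simp add: pot_def sum_integral_W)
  moreover have "norm (integral {0..1} (\<lambda>t. t * W (t *\<^sub>R x) x v)) \<le> (K * norm x * norm v) * (1 - 0)"
  proof (rule integral_bound)
    show "continuous_on {0..1} (\<lambda>t. t * W (t *\<^sub>R x) x v)"
      by (intro continuous_intros continuous_on_compose2[OF continuous_W]) auto
    show "norm (t * W (t *\<^sub>R x) x v) \<le> K * norm x * norm v" if "t \<in> {0..1}" for t
    proof -
      have "norm (t * W (t *\<^sub>R x) x v) \<le> 1 * \<bar>W (t *\<^sub>R x) x v\<bar>"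
        unfolding real_norm_def abs_mult using that by (intro mult_right_mono) auto
      then show ?thesis using assms[of "t *\<^sub>R x" x v] by simp
    qed
  qed simp
  ultimately show ?thesis by simp
qed

end

section \<open>The Pfaffian of a decaying closed two-form\<close>

lemma pf_adj_has_derivative:
  assumes "\<And>i j. ((\<lambda>x. w x i j) has_derivative w' i j) (at x)"
  shows "((\<lambda>x. pf_adj (w x) (w x) i j) has_derivative
      (\<lambda>h. pf_adj (w x) (\<lambda>k l. w' k l h) i j + pf_adj (\<lambda>k l. w' k l h) (w x) i j)) (at x)"
  unfolding pf_adj_def pf_polar_def
  by (rule has_derivative_eq_rhs, (rule derivative_intros assms)+) (auto simp: fun_eq_iff algebra_simps)

lemma pf_adj_continuous:
  assumes "\<And>i j. continuous_on S (\<lambda>x. w x i j)" "\<And>i j. continuous_on S (\<lambda>x. v x i j)"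
  shows "continuous_on S (\<lambda>x. pf_adj (w x) (v x) i j)"
  unfolding pf_adj_def pf_polar_def by (intro continuous_intros assms)

lemma pf_adj_bound:
  assumes w: "\<And>i j. i < 6 \<Longrightarrow> j < 6 \<Longrightarrow> \<bar>w i j\<bar> \<le> B" and ij: "i < 6" "j < 6" and B: "0 \<le> B"
  shows "\<bar>pf_adj w w i j\<bar> \<le> 3 * B\<^sup>2"
proof -
  have p: "\<bar>w a b * w c d\<bar> \<le> B\<^sup>2" if "a < 6" "b < 6" "c < 6" "d < 6" for a b c d
    unfolding abs_mult power2_eq_square using w that B by (intro mult_mono) auto
  have q: "\<bar>w a b * w c d - w a c * w b d + w a d * w b c\<bar> \<le> 3 * B\<^sup>2"
    if "a < 6" "b < 6" "c < 6" "d < 6" for a b c d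
    using p[of a b c d] p[of a c b d] p[of a d b c] that by linarith
  have t: "\<bar>pf_adj w w i j\<bar> \<le> 3 * B\<^sup>2" if "i < j" "j < 6" for i j
  proof -
    have "(i = 0 \<or> i = 1 \<or> i = 2 \<or> i = 3 \<or> i = 4) \<and> (j = 1 \<or> j = 2 \<or> j = 3 \<or> j = 4 \<or> j = 5)" using that by auto
    then show ?thesis using that
      by (elim conjE disjE) (simp_all only: pf_adj_table abs_minus_cancel, (rule q; simp)+)
  qed
  show ?thesis
    using t[of i j] t[of j i] ij pf_adj_skew[of w w i j] by (cases i j rule: linorder_cases) (auto simp: pf_adj_diag)
qed


text \<open>If \<open>W\<close> were nondegenerate everywhere, the Pfaffian would keep one sign. It
  is a third of the divergence of the field dual to alpha wedge omega^2, which decays too fast for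
  \<open>no_positive_divergence\<close>.\<close>

lemma (in closed_two_form) degenerate_somewhere:
  assumes dim: "DIM('a) = 6"
    and decay: "\<And>x u v. \<bar>W x u v\<bar> \<le> K / (1 + (norm x)\<^sup>2)\<^sup>2 * norm u * norm v"
  shows "\<exists>x u. u \<noteq> 0 \<and> (\<forall>v. W x u v = 0)"
proof (rule ccontr)
  assume "\<not> ?thesis"
  then have nondeg: "u \<noteq> 0 \<Longrightarrow> \<exists>v. W x u v \<noteq> 0" for x u by blast
  obtain b :: "nat \<Rightarrow> 'a" where b: "bij_betw b {..<6} Basis"
    using ex_bij_betw_nat_finite[of "Basis :: 'a set"] dim by (auto simp: atLeast0LessThan)
  have bB: "b i \<in> Basis" if "i < 6" for i using b that by (auto simp: bij_betw_def)
  have bsum: "(\<Sum>c\<in>Basis. f c) = (\<Sum>i<6. f (b i))" for f :: "'a \<Rightarrow> real"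
    using sum.reindex_bij_betw[OF b, of f] by simp
  have binner: "b i \<bullet> b j = (if i = j then 1 else 0)" if "i < 6" "j < 6" for i j
    using bB that b by (auto simp: inner_Basis bij_betw_def inj_on_def)
  define w where "w = (\<lambda>x i j. W x (b i) (b j))"
  define D where "D = (\<lambda>x h i j. dW x h (b i) (b j))"
  have wd: "((\<lambda>x. w x i j) has_derivative (\<lambda>h. D x h i j)) (at x)" for i j x
    unfolding w_def D_def by (rule deriv)
  have wskew: "w x i j = - w x j i" for x i j unfolding w_def by (rule skew)
  have Dskew: "D x h i j = - D x h j i" for x h i j unfolding D_def by (rule dskew)
  have cw: "continuous_on UNIV (\<lambda>x. w x i j)" for i j unfolding w_def by (rule continuous_W)
  have cD: "continuous_on UNIV (\<lambda>x. D x h i j)" for h i j unfolding D_def by (rule cont)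
  \<comment> \<open>Contracting the primitive with the Pfaffian adjugate gives the dual vector of
    alpha wedge omega^2, up to a constant.\<close>
  define V where "V = (\<lambda>x. \<Sum>i<6. (\<Sum>j<6. pot x (b j) * pf_adj (w x) (w x) i j) *\<^sub>R b i)"
  define dP where "dP = (\<lambda>x h i j. pf_adj (w x) (D x h) i j + pf_adj (D x h) (w x) i j)"
  define V' where "V' = (\<lambda>x h. \<Sum>i<6. (\<Sum>j<6. pot x (b j) * dP x h i j + dpot x h (b j) * pf_adj (w x) (w x) i j) *\<^sub>R b i)"
  have dP: "((\<lambda>x. pf_adj (w x) (w x) i j) has_derivative (\<lambda>h. dP x h i j)) (at x)" for i j x
    unfolding dP_def by (rule pf_adj_has_derivative[OF wd])
  have V: "(V has_derivative V' x) (at x)" for x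
    unfolding V_def V'_def
    by (rule has_derivative_eq_rhs, (rule derivative_intros pot_deriv dP)+) (simp add: fun_eq_iff)
  have cpot: "continuous_on UNIV (\<lambda>x. pot x v)" for v
    using pot_deriv by (meson continuous_at_imp_continuous_on has_derivative_continuous)
  have cV: "continuous_on UNIV (\<lambda>x. V' x h)" for h
    unfolding V'_def dP_def
    by (intro continuous_intros pf_adj_continuous cpot continuous_dpot cw cD)
  have div: "(\<Sum>c\<in>Basis. V' x c \<bullet> c) = 3 * pf6 (w x)" for x
  proof -
    have "V' x h \<bullet> b k = (\<Sum>j<6. pot x (b j) * dP x h k j + dpot x h (b j) * pf_adj (w x) (w x) k j)"
      if "k < 6" for k h
    proof -
      have "V' x h \<bullet> b k = (\<Sum>i<6. (\<Sum>j<6. pot x (b j) * dP x h i j + dpot x h (b j) * pf_adj (w x) (w x) i j) *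
          (if i = k then 1 else 0))"
        unfolding V'_def inner_sum_left using binner that by (intro sum.cong) auto
      then show ?thesis using that by (simp add: if_distrib[of "\<lambda>z. _ * z"] sum.delta cong: if_cong)
    qed
    then have "(\<Sum>c\<in>Basis. V' x c \<bullet> c) =
        (\<Sum>i<6. \<Sum>j<6. pot x (b j) * dP x (b i) i j + dpot x (b i) (b j) * pf_adj (w x) (w x) i j)"
      by (simp add: bsum)
    also have "\<dots> = (\<Sum>i<6. \<Sum>j<6. pot x (b j) * dP x (b i) i j) +
        (\<Sum>i<6. \<Sum>j<6. dpot x (b i) (b j) * pf_adj (w x) (w x) i j)"
      by (simp add: sum.distrib)
    also have "(\<Sum>i<6. \<Sum>j<6. pot x (b j) * dP x (b i) i j) = (\<Sum>j<6. pot x (b j) * (\<Sum>i<6. dP x (b i) i j))"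
      by (subst sum.swap) (simp add: sum_distrib_left)
    \<comment> \<open>The part of the divergence that differentiates omega^2 vanishes; the part that
      differentiates alpha is \<open>pf_adj_trace\<close>.\<close>
    also have "\<dots> = 0"
    proof (rule sum.neutral, rule ballI)
      fix j :: nat assume "j \<in> {..<6}"
      then have "(\<Sum>i<6. dP x (b i) i j) = 0"
        unfolding dP_def
      proof (intro pf_adj_closed)
        show "D x (b i) k l + D x (b k) l i + D x (b l) i k = 0" for i k l
          unfolding D_def by (rule closed)
      qed (rule wskew Dskew | simp)+
      then show "pot x (b j) * (\<Sum>i<6. dP x (b i) i j) = 0" by simp
    qed
    also have "(\<Sum>i<6. \<Sum>j<6. dpot x (b i) (b j) * pf_adj (w x) (w x) i j) = 3 * pf6 (w x)"
      by (rule pf_adj_trace) (simp add: exterior_derivative_pot w_def)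
    finally show ?thesis by simp
  qed
  have pf_nz: "pf6 (w x) \<noteq> 0" for x
  proof
    assume pf0: "pf6 (w x) = 0"
    obtain c k where k: "k < 6" "c k \<noteq> (0::real)" and c: "\<And>i. i < 6 \<Longrightarrow> (\<Sum>j<6. w x i j * c j) = 0"
      by (rule pf6_eq_0_imp_degenerate[of "w x", OF wskew pf0]) blast
    define u where "u = (\<Sum>j<6. c j *\<^sub>R b j)"
    have "u \<bullet> b k = (\<Sum>j<6. c j * (if j = k then 1 else 0))"
      unfolding u_def inner_sum_left using binner k by (intro sum.cong) auto
    then have "u \<bullet> b k = c k" using k by (simp add: if_distrib[of "\<lambda>z. _ * z"] sum.delta cong: if_cong)
    then have "u \<noteq> 0" using k by auto
    then obtain v where v: "W x u v \<noteq> 0" using nondeg by blast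
    have "W x v u = (\<Sum>i<6. (v \<bullet> b i) * W x (b i) u)"
      by (subst linear_expand[OF lin[of x u], of v]) (simp add: bsum)
    moreover have "W x (b i) u = 0" if "i < 6" for i
    proof -
      have "W x (b i) u = - W x u (b i)" by (rule skew)
      also have "W x u (b i) = (\<Sum>j<6. c j * W x (b j) (b i))"
        unfolding u_def using linear_sum[OF lin] linear_scale[OF lin] by (simp add: linear_sum[OF lin] linear_scale[OF lin])
      also have "\<dots> = - (\<Sum>j<6. w x i j * c j)"
        unfolding sum_negf[symmetric] w_def using skew[of x "b _" "b i"] by (intro sum.cong) (auto simp: mult.commute)
      finally show ?thesis using c[OF that] by simp
    qed
    ultimately show False using v skew[of x u v] by simp
  qed
  have K: "0 \<le> K"
  proof -
    have "0 \<le> \<bar>W 0 (b 0) (b 0)\<bar>" by simp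
    also have "\<dots> \<le> K" using decay[of 0 "b 0" "b 0"] bB[of 0] by simp
    finally show ?thesis .
  qed
  have W_bound: "\<bar>W x u v\<bar> \<le> K * norm u * norm v" for x u v
  proof -
    have "1 \<le> (1 + (norm x)\<^sup>2)\<^sup>2" by (rule one_le_power) simp
    then have "K / (1 + (norm x)\<^sup>2)\<^sup>2 \<le> K" using K by (simp add: divide_le_eq mult_le_cancel_left1)
    then have "K / (1 + (norm x)\<^sup>2)\<^sup>2 * norm u * norm v \<le> K * norm u * norm v" by (intro mult_right_mono) auto
    then show ?thesis using decay[of x u v] by linarith
  qed
  \<comment> \<open>\<open>108 = 6 * 6 * 3\<close>: the number of terms in the double sum times the
    \<open>3\<close> in \<open>pf_adj_bound\<close>.\<close>
  have V_bound: "norm x ^ DIM('a) * norm (V x) \<le> 108 * K ^ 3" for x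
  proof -
    define r where "r = norm x"
    have r: "0 \<le> r" by (simp add: r_def)
    define B where "B = K / (1 + r\<^sup>2)\<^sup>2"
    have pos: "0 < 1 + r\<^sup>2" by (simp add: add_pos_nonneg)
    have B: "0 \<le> B" unfolding B_def using K by simp
    have "\<bar>w x i j\<bar> \<le> B" if "i < 6" "j < 6" for i j
      unfolding w_def using decay[of x "b i" "b j"] bB that by (simp add: B_def r_def)
    then have adj: "\<bar>pf_adj (w x) (w x) i j\<bar> \<le> 3 * B\<^sup>2" if "i < 6" "j < 6" for i j
      using pf_adj_bound B that by blast
    have "norm (V x) \<le> (\<Sum>i<6::nat. \<Sum>j<6::nat. (K * r) * (3 * B\<^sup>2))"
      unfolding V_def
    proof (rule sum_norm_le)
      fix i :: nat assume i: "i \<in> {..<6}"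
      have "norm ((\<Sum>j<6. pot x (b j) * pf_adj (w x) (w x) i j) *\<^sub>R b i) = \<bar>\<Sum>j<6. pot x (b j) * pf_adj (w x) (w x) i j\<bar>"
        using bB i by simp
      also have "\<dots> \<le> (\<Sum>j<6. \<bar>pot x (b j) * pf_adj (w x) (w x) i j\<bar>)" by (rule sum_abs)
      also have "\<dots> \<le> (\<Sum>j<6::nat. (K * r) * (3 * B\<^sup>2))"
      proof (rule sum_mono)
        fix j :: nat assume j: "j \<in> {..<6}"
        have "\<bar>pot x (b j)\<bar> \<le> K * r" using pot_bound[OF W_bound, of x "b j"] bB j by (simp add: r_def)
        then show "\<bar>pot x (b j) * pf_adj (w x) (w x) i j\<bar> \<le> (K * r) * (3 * B\<^sup>2)"
          unfolding abs_mult using adj i j r K by (intro mult_mono) auto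
      qed
      finally show "norm ((\<Sum>j<6. pot x (b j) * pf_adj (w x) (w x) i j) *\<^sub>R b i) \<le> (\<Sum>j<6::nat. (K * r) * (3 * B\<^sup>2))" .
    qed
    then have "norm (V x) \<le> 108 * (K * r * B\<^sup>2)" by simp
    then have "norm x ^ DIM('a) * norm (V x) \<le> r ^ 6 * (108 * (K * r * B\<^sup>2))"
      unfolding dim r_def[symmetric] using r by (intro mult_left_mono) auto
    also have "\<dots> = 108 * K ^ 3 * (r ^ 7 / (1 + r\<^sup>2) ^ 4)"
      using pos by (simp add: B_def field_simps power_divide eval_nat_numeral)
    \<comment> \<open>Since \<open>r \<le> 1 + r\<^sup>2\<close>, the seventh power of
      \<open>r\<close> is absorbed by the fourth power of \<open>1 + r\<^sup>2\<close>.\<close>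
    also have "\<dots> \<le> 108 * K ^ 3 * 1"
    proof (rule mult_left_mono)
      have "0 \<le> (r - 1)\<^sup>2" by simp
      then have "r \<le> 1 + r\<^sup>2" using r by (simp add: power2_diff)
      moreover have "(r\<^sup>2) ^ 3 \<le> (1 + r\<^sup>2) ^ 3" by (rule power_mono) auto
      ultimately have "r * (r\<^sup>2) ^ 3 \<le> (1 + r\<^sup>2) * (1 + r\<^sup>2) ^ 3" using r by (intro mult_mono) auto
      then have "r ^ 7 \<le> (1 + r\<^sup>2) ^ 4" by (simp add: eval_nat_numeral mult_ac)
      then show "r ^ 7 / (1 + r\<^sup>2) ^ 4 \<le> 1" using pos by simp
    qed (use K in simp)
    finally show ?thesis by simp
  qed
  have cpf: "continuous_on UNIV (\<lambda>x. pf6 (w x))"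
    unfolding pf6_def by (intro continuous_intros pf_adj_continuous cw)
  \<comment> \<open>A continuous function without zeros has constant sign on a connected space. For
    the negative sign \<open>V\<close> is replaced by \<open>- V\<close>.\<close>
  consider "\<forall>x. 0 < pf6 (w x)" | "\<forall>x. pf6 (w x) < 0"
  proof -
    have "connected (range (\<lambda>x. pf6 (w x)))"
      by (rule connected_continuous_image[OF cpf convex_connected[OF convex_UNIV]])
    then have "\<not> (pf6 (w x) < 0 \<and> 0 < pf6 (w y))" for x y
      using connectedD_interval[of "range (\<lambda>x. pf6 (w x))" "pf6 (w x)" "pf6 (w y)" 0] pf_nz
      by (metis less_imp_le rangeE rangeI)
    then show thesis using that pf_nz by (metis linorder_neqE_linordered_idom)
  qed
  then show False
  proof cases
    case 1
    show False
      by (rule no_positive_divergence[OF V cV V_bound]) (use 1 div in auto)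
  next
    case 2
    have "((\<lambda>x. - V x) has_derivative (\<lambda>h. - V' x h)) (at x)" for x
      by (rule has_derivative_minus[OF V])
    then show False
    proof (rule no_positive_divergence)
      show "norm x ^ DIM('a) * norm (- V x) \<le> 108 * K ^ 3" for x using V_bound by simp
      show "0 < (\<Sum>c\<in>Basis. - V' x c \<bullet> c)" for x using 2 div[of x] by (simp add: sum_negf)
    qed (intro continuous_intros cV)
  qed
qed

subsection \<open>The trace form of a family of complex structures\<close>

text \<open>The mean value theorem is applied in direction \<open>u\<close> to the first difference
  along \<open>v\<close>, then in direction \<open>v\<close> to the derivative along
  \<open>u\<close>.\<close>

lemma second_difference_mvt:
  fixes f :: "'a::real_normed_vector \<Rightarrow> real"
  assumes f: "\<And>x. (f has_derivative f' x) (at x)"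
    and f': "\<And>x u. ((\<lambda>x. f' x u) has_derivative f'' x u) (at x)" and h: "0 < h"
  shows "\<exists>p. norm (p - x) \<le> h * (norm u + norm v) \<and>
      f (x + h *\<^sub>R u + h *\<^sub>R v) - f (x + h *\<^sub>R u) - f (x + h *\<^sub>R v) + f x = h\<^sup>2 * f'' p u v"
proof -
  have d: "((\<lambda>y. f (y + h *\<^sub>R v) - f y) has_derivative (\<lambda>w. f' (y + h *\<^sub>R v) w - f' y w)) (at y)" for y
    by (intro has_derivative_diff f has_derivative_compose[OF _ f, of "\<lambda>y. y + h *\<^sub>R v" "\<lambda>w. w"])
      (auto intro!: derivative_eq_intros)
  obtain s where s: "0 < s" "s < h"
    "f (x + h *\<^sub>R u + h *\<^sub>R v) - f (x + h *\<^sub>R u) - (f (x + h *\<^sub>R v) - f x) =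
       h * (f' (x + s *\<^sub>R u + h *\<^sub>R v) u - f' (x + s *\<^sub>R u) u)"
    using directional_mvt[of "\<lambda>y. f (y + h *\<^sub>R v) - f y" _ h x u, OF d h] by blast
  obtain r where r: "0 < r" "r < h"
    "f' (x + s *\<^sub>R u + h *\<^sub>R v) u - f' (x + s *\<^sub>R u) u = h * f'' (x + s *\<^sub>R u + r *\<^sub>R v) u v"
    using directional_mvt[of "\<lambda>y. f' y u" _ h "x + s *\<^sub>R u" v, OF f' h] by blast
  have "norm (x + s *\<^sub>R u + r *\<^sub>R v - x) \<le> norm (s *\<^sub>R u) + norm (r *\<^sub>R v)"
    using norm_triangle_ineq[of "s *\<^sub>R u" "r *\<^sub>R v"] by (simp add: algebra_simps)
  also have "\<dots> \<le> h * norm u + h * norm v"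
    using s r by (intro add_mono) (auto intro!: mult_right_mono)
  finally show ?thesis
    using s r by (intro exI[of _ "x + s *\<^sub>R u + r *\<^sub>R v"]) (simp add: algebra_simps power2_eq_square)
qed

text \<open>The second difference is symmetric in \<open>u\<close> and \<open>v\<close>, and both
  second derivatives are limits of it divided by \<open>h\<^sup>2\<close>.\<close>

lemma symmetric_second_derivative:
  fixes f :: "'a::real_normed_vector \<Rightarrow> real"
  assumes f: "\<And>x. (f has_derivative f' x) (at x)"
    and f': "\<And>x u. ((\<lambda>x. f' x u) has_derivative f'' x u) (at x)"
    and c: "\<And>u v. continuous_on UNIV (\<lambda>x. f'' x u v)"
  shows "f'' x u v = f'' x v u"
proof -
  define h where "h = (\<lambda>n. inverse (real (Suc n)))"
  have h: "0 < h n" for n by (simp add: h_def)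
  obtain p where p: "\<And>n. norm (p n - x) \<le> h n * (norm u + norm v)"
    "\<And>n. f (x + h n *\<^sub>R u + h n *\<^sub>R v) - f (x + h n *\<^sub>R u) - f (x + h n *\<^sub>R v) + f x = (h n)\<^sup>2 * f'' (p n) u v"
    using second_difference_mvt[OF f f' h, where x = x and u = u and v = v] by metis
  obtain q where q: "\<And>n. norm (q n - x) \<le> h n * (norm v + norm u)"
    "\<And>n. f (x + h n *\<^sub>R v + h n *\<^sub>R u) - f (x + h n *\<^sub>R v) - f (x + h n *\<^sub>R u) + f x = (h n)\<^sup>2 * f'' (q n) v u"
    using second_difference_mvt[OF f f' h, where x = x and u = v and v = u] by metis
  have eq: "f'' (p n) u v = f'' (q n) v u" for n
  proof -
    have "(h n)\<^sup>2 * f'' (p n) u v = (h n)\<^sup>2 * f'' (q n) v u"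
      unfolding p(2)[symmetric] q(2)[symmetric] by (simp add: add_ac)
    then show ?thesis using h[of n] by simp
  qed
  have lim: "(\<lambda>n. f'' (p n) a b) \<longlonglongrightarrow> f'' x a b" if "\<And>n. norm (p n - x) \<le> h n * C" for p C a b
  proof -
    have "(\<lambda>n. h n * C) \<longlonglongrightarrow> 0 * C"
      unfolding h_def by (intro tendsto_mult LIMSEQ_inverse_real_of_nat tendsto_const)
    then have "(\<lambda>n. h n * C) \<longlonglongrightarrow> 0" by simp
    moreover have "\<forall>\<^sub>F n in sequentially. norm (p n - x) \<le> h n * C"
      by (intro always_eventually allI that)
    ultimately have "(\<lambda>n. p n - x) \<longlonglongrightarrow> 0" by (rule Lim_null_comparison[rotated])
    then have "p \<longlonglongrightarrow> x" by (simp add: LIM_zero_iff)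
    moreover have "isCont (\<lambda>x. f'' x a b) x" using c by (simp add: continuous_on_eq_continuous_at)
    ultimately show ?thesis using isCont_tendsto_compose[of x "\<lambda>x. f'' x a b"] by simp
  qed
  show ?thesis
    using LIMSEQ_unique[OF lim[OF p(1)]] lim[OF q(1)] eq by simp
qed

section \<open>Traces of endomorphisms that anticommute with a complex structure\<close>

abbreviation bcomp :: "('b::real_normed_vector \<Rightarrow>\<^sub>L 'c::real_normed_vector) \<Rightarrow> ('a::real_normed_vector \<Rightarrow>\<^sub>L 'b) \<Rightarrow> ('a \<Rightarrow>\<^sub>L 'c)"
    (infixl "\<odot>" 70) where
  "A \<odot> B \<equiv> A o\<^sub>L B"

definition tr :: "('e::euclidean_space \<Rightarrow>\<^sub>L 'e) \<Rightarrow> real" where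
  "tr A = (\<Sum>b\<in>Basis. A b \<bullet> b)"

lemma bounded_linear_tr: "bounded_linear tr"
  unfolding tr_def by (intro bounded_linear_sum bounded_linear_blinfun_matrix)

lemmas tr_linear = linear_add[OF bounded_linear.linear[OF bounded_linear_tr]]
  linear_neg[OF bounded_linear.linear[OF bounded_linear_tr]]

lemma tr_commute:
  fixes A B :: "'e::euclidean_space \<Rightarrow>\<^sub>L 'e"
  shows "tr (A \<odot> B) = tr (B \<odot> A)"
proof -
  have e: "blinfun_apply A (blinfun_apply B b) \<bullet> b = (\<Sum>c\<in>Basis. (B b \<bullet> c) * (A c \<bullet> b))" for A B :: "'e \<Rightarrow>\<^sub>L 'e" and b
    using arg_cong[OF euclidean_representation[of "B b"], of "\<lambda>z. A z \<bullet> b"]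
    by (simp add: blinfun.bilinear_simps inner_sum_left)
  have "tr (A \<odot> B) = (\<Sum>b\<in>Basis. \<Sum>c\<in>Basis. (B b \<bullet> c) * (A c \<bullet> b))"
    by (simp add: tr_def e)
  also have "\<dots> = (\<Sum>c\<in>Basis. \<Sum>b\<in>Basis. (A c \<bullet> b) * (B b \<bullet> c))"
    by (subst sum.swap) (simp add: mult.commute)
  also have "\<dots> = tr (B \<odot> A)" by (simp add: tr_def e)
  finally show ?thesis .
qed

lemma tr_bound: "\<bar>tr (A :: 'e::euclidean_space \<Rightarrow>\<^sub>L 'e)\<bar> \<le> DIM('e) * norm A"
proof -
  have "\<bar>tr A\<bar> \<le> (\<Sum>b\<in>(Basis::'e set). norm A)"
    unfolding tr_def
  proof (rule order_trans[OF sum_abs sum_mono])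
    fix b :: 'e assume b: "b \<in> Basis"
    have "\<bar>A b \<bullet> b\<bar> \<le> norm (A b) * norm b" by (rule Cauchy_Schwarz_ineq2)
    also have "\<dots> \<le> norm A" using norm_blinfun[of A b] b by simp
    finally show "\<bar>A b \<bullet> b\<bar> \<le> norm A" .
  qed
  then show ?thesis by simp
qed

interpretation blinfun_compose: bounded_bilinear "(o\<^sub>L)"
  by (rule bounded_bilinear_blinfun_compose)

lemma blinfun_compose_assoc: "(A \<odot> B) \<odot> C = A \<odot> (B \<odot> C)"
  by (rule blinfun_eqI) simp

lemma blinfun_compose_id: "id_blinfun \<odot> A = A" "A \<odot> id_blinfun = A"
  by (auto intro: blinfun_eqI)

text \<open>A product of an odd number of anticommuting factors anticommutes with \<open>J\<close>.
  Conjugation by \<open>J\<close> therefore negates it, yet preserves its trace.\<close>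

lemma tr_anticommuting:
  assumes J: "J \<odot> J = - id_blinfun"
    and A: "A \<odot> J = - (J \<odot> A)" and B: "B \<odot> J = - (J \<odot> B)" and C: "C \<odot> J = - (J \<odot> C)"
  shows "tr (A \<odot> (B \<odot> C)) = 0"
proof -
  let ?P = "A \<odot> (B \<odot> C)"
  have "A \<odot> (B \<odot> (C \<odot> J)) = - (A \<odot> ((B \<odot> J) \<odot> C))"
    unfolding C by (simp add: blinfun_compose.minus_right blinfun_compose_assoc)
  also have "\<dots> = (A \<odot> J) \<odot> (B \<odot> C)"
    unfolding B by (simp add: blinfun_compose.minus_right blinfun_compose.minus_left blinfun_compose_assoc)
  also have "\<dots> = - (J \<odot> ?P)"
    unfolding A by (simp add: blinfun_compose.minus_left blinfun_compose_assoc)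
  finally have PJ: "?P \<odot> J = - (J \<odot> ?P)" by (simp add: blinfun_compose_assoc)
  have JJP: "J \<odot> (J \<odot> ?P) = - ?P"
    by (simp add: blinfun_compose_assoc[symmetric] J blinfun_compose.minus_left blinfun_compose_id)
  have "tr ?P = - tr (J \<odot> (J \<odot> ?P))" by (simp add: JJP tr_linear)
  also have "\<dots> = tr (J \<odot> (?P \<odot> J))" by (simp add: PJ blinfun_compose.minus_right tr_linear)
  also have "\<dots> = tr ((?P \<odot> J) \<odot> J)" by (rule tr_commute)
  also have "\<dots> = - tr ?P"
    by (simp only: blinfun_compose_assoc J blinfun_compose.minus_right blinfun_compose_id tr_linear)
  finally show ?thesis by simp
qed

text \<open>\<open>M\<close> plays a second derivative of \<open>J\<close>, and the hypothesis on it
  is \<open>J\<^sup>2 = -1\<close> differentiated twice. Multiplying by \<open>A\<close> and taking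
  traces leaves the two stated terms plus triple products killed by
  \<open>tr_anticommuting\<close>.\<close>

lemma tr_second_derivative:
  assumes J: "J \<odot> J = - id_blinfun"
    and A: "A \<odot> J = - (J \<odot> A)" and B: "B \<odot> J = - (J \<odot> B)" and C: "C \<odot> J = - (J \<odot> C)"
    and M: "M \<odot> J + B \<odot> C + C \<odot> B + J \<odot> M = 0"
  shows "tr (J \<odot> (M \<odot> A)) + tr (J \<odot> (A \<odot> M)) = 0"
proof -
  have "tr (J \<odot> (M \<odot> A)) = tr (A \<odot> (J \<odot> M))"
    by (metis blinfun_compose_assoc tr_commute)
  moreover have "tr (J \<odot> (A \<odot> M)) = tr (A \<odot> (M \<odot> J))"
    by (metis blinfun_compose_assoc tr_commute)
  moreover have "tr (A \<odot> (M \<odot> J + B \<odot> C + C \<odot> B + J \<odot> M)) = 0"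
    unfolding M by (simp add: tr_def)
  ultimately show ?thesis
    using tr_anticommuting[OF J A B C] tr_anticommuting[OF J A C B]
    by (simp add: blinfun_compose.add_right tr_linear)
qed

text \<open>Each of the two derivatives in the trace form contributes one factor
  \<open>1 / (1 + (norm x)\<^sup>2)\<close>, which is the decay required by
  \<open>degenerate_somewhere\<close>.\<close>

lemma trace_form_degenerate:
  fixes J :: "'a::euclidean_space \<Rightarrow> ('e::euclidean_space \<Rightarrow>\<^sub>L 'e)"
  assumes dim: "DIM('a) = 6" and smooth: "Ck_on 2 J UNIV"
    and JJ: "\<And>x. J x \<odot> J x = - id_blinfun"
    and J_bound: "\<And>x. norm (J x) \<le> C"
    and decay: "\<And>x u. norm (frechet_derivative J (at x) u) \<le> C / (1 + (norm x)\<^sup>2) * norm u"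
  shows "\<exists>x u. u \<noteq> 0 \<and> (\<forall>v. tr (J x \<odot> (frechet_derivative J (at x) u \<odot> frechet_derivative J (at x) v)) = 0)"
proof -
  define J1 where "J1 = (\<lambda>x u. frechet_derivative J (at x) u)"
  define J2 where "J2 = (\<lambda>x u v. frechet_derivative (\<lambda>x. J1 x u) (at x) v)"
  have Suc2: "Ck_on (Suc (Suc 0)) J UNIV" using smooth by (simp only: numeral_2_eq_2)
  have J1: "(J has_derivative J1 x) (at x)" for x
    using Ck_on_Suc_has_derivative[OF Suc2] by (simp add: J1_def)
  have Ck1: "Ck_on (Suc 0) (\<lambda>x. J1 x u) UNIV" for u
    using Ck_on_Suc_derivative[OF Suc2] by (simp add: J1_def del: Ck_on.simps)
  have J2: "((\<lambda>x. J1 x u) has_derivative J2 x u) (at x)" for x u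
    using Ck_on_Suc_has_derivative[OF Ck1] by (simp add: J2_def)
  have cJ2: "continuous_on UNIV (\<lambda>x. J2 x u v)" for u v
    using Ck_on_Suc_derivative[OF Ck1] by (simp add: J2_def)
  have cJ1: "continuous_on UNIV (\<lambda>x. J1 x u)" for u
    using J2 by (meson continuous_at_imp_continuous_on has_derivative_continuous)
  have cJ: "continuous_on UNIV J"
    using J1 by (meson continuous_at_imp_continuous_on has_derivative_continuous)
  have lin1: "linear (J1 x)" for x by (rule has_derivative_linear[OF J1])
  \<comment> \<open>Symmetry is known for real functions and is transferred through the matrix
    entries.\<close>
  have sym: "J2 x u v = J2 x v u" for x u v
  proof (rule blinfun_eqI, rule euclidean_eqI)
    fix i c :: 'e
    have bl: "bounded_linear (\<lambda>A::'e \<Rightarrow>\<^sub>L 'e. A i \<bullet> c)" by (rule bounded_linear_blinfun_matrix)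
    show "J2 x u v i \<bullet> c = J2 x v u i \<bullet> c"
      by (rule symmetric_second_derivative[of "\<lambda>x. J x i \<bullet> c" "\<lambda>x u. J1 x u i \<bullet> c" "\<lambda>x u v. J2 x u v i \<bullet> c"])
        (auto intro!: bounded_linear.has_derivative[OF bl] J1 J2
          bounded_linear.continuous_on[OF bl] cJ2)
  qed
  have lin2: "linear (\<lambda>u. J2 x u v)" for x v
    unfolding sym[of x _ v] by (rule has_derivative_linear[OF J2])
  have anti: "J1 x u \<odot> J x = - (J x \<odot> J1 x u)" for x u
  proof -
    have "((\<lambda>x. J x \<odot> J x) has_derivative (\<lambda>u. J x \<odot> J1 x u + J1 x u \<odot> J x)) (at x)"
      by (rule blinfun_compose.FDERIV[OF J1 J1])
    then have "((\<lambda>x. - id_blinfun) has_derivative (\<lambda>u. J x \<odot> J1 x u + J1 x u \<odot> J x)) (at x)"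
      by (simp only: JJ)
    from has_derivative_unique[OF this has_derivative_const]
    have "J x \<odot> J1 x u + J1 x u \<odot> J x = 0" by (rule fun_cong)
    then show ?thesis by (simp add: eq_neg_iff_add_eq_0 add.commute)
  qed
  have anti2: "J2 x u h \<odot> J x + J1 x u \<odot> J1 x h + J1 x h \<odot> J1 x u + J x \<odot> J2 x u h = 0" for x u h
  proof -
    have "((\<lambda>x. J1 x u \<odot> J x + J x \<odot> J1 x u) has_derivative
        (\<lambda>h. (J1 x u \<odot> J1 x h + J2 x u h \<odot> J x) + (J x \<odot> J2 x u h + J1 x h \<odot> J1 x u))) (at x)"
      by (intro has_derivative_add blinfun_compose.FDERIV J1 J2)
    then have "((\<lambda>x. 0) has_derivative
        (\<lambda>h. (J1 x u \<odot> J1 x h + J2 x u h \<odot> J x) + (J x \<odot> J2 x u h + J1 x h \<odot> J1 x u))) (at x)"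
      by (simp add: anti)
    from fun_cong[OF has_derivative_unique[OF this has_derivative_const], of h]
    show ?thesis by (simp add: add_ac)
  qed
  define W where "W = (\<lambda>x u v. tr (J x \<odot> (J1 x u \<odot> J1 x v)))"
  define dW where "dW = (\<lambda>x h u v. tr (J1 x h \<odot> (J1 x u \<odot> J1 x v)) +
      tr (J x \<odot> (J2 x u h \<odot> J1 x v)) + tr (J x \<odot> (J1 x u \<odot> J2 x v h)))"
  have first: "tr (J1 x h \<odot> (J1 x u \<odot> J1 x v)) = 0" for x h u v
    by (rule tr_anticommuting[OF JJ anti anti anti])
  have second: "tr (J x \<odot> (J2 x u h \<odot> J1 x v)) + tr (J x \<odot> (J1 x v \<odot> J2 x u h)) = 0" for x u v h
    by (rule tr_second_derivative[OF JJ anti anti anti anti2])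
  interpret closed_two_form W dW
  proof (rule closed_two_form.intro)
    show "((\<lambda>x. W x u v) has_derivative (\<lambda>h. dW x h u v)) (at x)" for x u v
    proof -
      have "((\<lambda>x. J x \<odot> (J1 x u \<odot> J1 x v)) has_derivative
          (\<lambda>h. J x \<odot> (J1 x u \<odot> J2 x v h + J2 x u h \<odot> J1 x v) + J1 x h \<odot> (J1 x u \<odot> J1 x v))) (at x)"
        by (intro blinfun_compose.FDERIV J1 J2)
      from bounded_linear.has_derivative[OF bounded_linear_tr this] show ?thesis
        by (simp add: W_def dW_def tr_linear blinfun_compose.add_right add_ac)
    qed
    show "continuous_on UNIV (\<lambda>x. dW x h u v)" for h u v
      unfolding dW_def
      by (intro continuous_intros bounded_linear.continuous_on[OF bounded_linear_tr]
          blinfun_compose.continuous_on cJ cJ1 cJ2)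
    show "linear (\<lambda>u. W x u v)" for x v
      unfolding W_def
      by (rule linearI)
        (simp_all add: linear_add[OF lin1] linear_scale[OF lin1] blinfun_compose.add_left blinfun_compose.add_right
          blinfun_compose.scaleR_left blinfun_compose.scaleR_right tr_linear linear_scale[OF bounded_linear.linear[OF bounded_linear_tr]])
    show "linear (\<lambda>u. dW x h u v)" for x h v
      unfolding dW_def
      by (rule linearI)
        (simp_all add: linear_add[OF lin1] linear_scale[OF lin1] linear_add[OF lin2] linear_scale[OF lin2]
          blinfun_compose.add_left blinfun_compose.add_right
          blinfun_compose.scaleR_left blinfun_compose.scaleR_right tr_linear
          linear_scale[OF bounded_linear.linear[OF bounded_linear_tr]] algebra_simps)
    show "W x u v = - W x v u" for x u v
    proof -
      have "tr (J x \<odot> (J1 x u \<odot> J1 x v)) = tr ((J1 x u \<odot> J1 x v) \<odot> J x)" by (rule tr_commute)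
      also have "\<dots> = - tr (J1 x u \<odot> (J x \<odot> J1 x v))"
        by (simp add: blinfun_compose_assoc anti blinfun_compose.minus_right tr_linear)
      also have "tr (J1 x u \<odot> (J x \<odot> J1 x v)) = tr (J x \<odot> (J1 x v \<odot> J1 x u))"
        by (metis blinfun_compose_assoc tr_commute)
      finally show ?thesis by (simp add: W_def)
    qed
    show "dW x h u v = - dW x h v u" for x h u v
      using first second[of x u h v] second[of x v h u] by (simp add: dW_def)
    \<comment> \<open>By symmetry of \<open>J2\<close>, each of the three second derivatives occurs
      once to the left and once to the right of the remaining first derivative; these pairs cancel
      by \<open>second\<close>.\<close>
    show "dW x a b c + dW x b c a + dW x c a b = 0" for x a b c
      using first second[of x b a c] second[of x c b a] second[of x a c b]
      by (simp add: dW_def sym[of x c a] sym[of x a b] sym[of x b c])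
  qed
  have C0: "0 \<le> C" using J_bound[of 0] norm_ge_zero[of "J 0"] by linarith
  have "\<bar>W x u v\<bar> \<le> (DIM('e) * C ^ 3) / (1 + (norm x)\<^sup>2)\<^sup>2 * norm u * norm v" for x u v
  proof -
    have "\<bar>W x u v\<bar> \<le> DIM('e) * norm (J x \<odot> (J1 x u \<odot> J1 x v))"
      unfolding W_def by (rule tr_bound)
    also have "norm (J x \<odot> (J1 x u \<odot> J1 x v)) \<le> norm (J x) * norm (J1 x u \<odot> J1 x v)"
      by (rule norm_blinfun_compose)
    also have "\<dots> \<le> C * (norm (J1 x u) * norm (J1 x v))"
      by (intro mult_mono J_bound norm_blinfun_compose C0) auto
    also have "\<dots> \<le> C * ((C / (1 + (norm x)\<^sup>2) * norm u) * (C / (1 + (norm x)\<^sup>2) * norm v))"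
      using decay C0 by (intro mult_left_mono mult_mono) (auto simp: J1_def)
    also have "\<dots> = C ^ 3 / (1 + (norm x)\<^sup>2)\<^sup>2 * norm u * norm v"
      by (simp add: eval_nat_numeral)
    finally show ?thesis by (simp add: mult_ac mult_left_mono)
  qed
  from degenerate_somewhere[OF dim this] show ?thesis by (simp add: W_def J1_def)
qed

subsection \<open>The trace form and the Nijenhuis tensor at a point\<close>

lemma orthonormal_family_expand:
  fixes f :: "'i \<Rightarrow> 'e::euclidean_space"
  assumes fin: "finite I" and card: "card I = DIM('e)"
    and on: "\<And>i k. i \<in> I \<Longrightarrow> k \<in> I \<Longrightarrow> f i \<bullet> f k = (if i = k then 1 else 0)"
  shows "(\<Sum>i\<in>I. (v \<bullet> f i) *\<^sub>R f i) = v"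
proof -
  have inj: "inj_on f I"
  proof (rule inj_onI)
    fix i k assume *: "i \<in> I" "k \<in> I" "f i = f k"
    then have "f i \<bullet> f k = 1" using on[of i i] by simp
    then show "i = k" using on[of i k] * by (simp split: if_splits)
  qed
  have orth: "pairwise orthogonal (f ` I)" and nrm: "\<And>x. x \<in> f ` I \<Longrightarrow> norm x = 1"
    using on by (auto simp: pairwise_def orthogonal_def norm_eq_1)
  have "0 \<notin> f ` I" using nrm by force
  then have "independent (f ` I)" using orth pairwise_orthogonal_independent by blast
  moreover have "card (f ` I) = dim (UNIV :: 'e set)" using inj card by (simp add: card_image)
  ultimately have "span (f ` I) = UNIV"
    using card_eq_dim[of "f ` I" UNIV] fin by auto
  then have "(\<Sum>i\<in>f ` I. (v \<bullet> i) *\<^sub>R i) = v"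
    using orthonormal_basis_expand[OF orth nrm, of v] fin by simp
  then show ?thesis using inj by (simp add: sum.reindex)
qed

lemma orthonormal_family_parseval:
  fixes f :: "'i \<Rightarrow> 'e::euclidean_space"
  assumes "finite I" "card I = DIM('e)"
    "\<And>i k. i \<in> I \<Longrightarrow> k \<in> I \<Longrightarrow> f i \<bullet> f k = (if i = k then 1 else 0)"
  shows "v \<bullet> w = (\<Sum>i\<in>I. (v \<bullet> f i) * (w \<bullet> f i))"
proof -
  have "v \<bullet> w = (\<Sum>i\<in>I. (v \<bullet> f i) *\<^sub>R f i) \<bullet> w"
    by (simp only: orthonormal_family_expand[OF assms])
  then show ?thesis by (simp add: inner_sum_left inner_commute[of "f _" w])
qed

lemma sum_cyclic3:
  fixes f :: "'i \<Rightarrow> 'i \<Rightarrow> 'i \<Rightarrow> real"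
  shows "(\<Sum>a\<in>I. \<Sum>b\<in>I. \<Sum>d\<in>I. f b d a) = (\<Sum>a\<in>I. \<Sum>b\<in>I. \<Sum>d\<in>I. f a b d)"
proof -
  have "(\<Sum>a\<in>I. \<Sum>b\<in>I. \<Sum>d\<in>I. f b d a) = (\<Sum>b\<in>I. \<Sum>a\<in>I. \<Sum>d\<in>I. f b d a)" by (rule sum.swap)
  also have "\<dots> = (\<Sum>b\<in>I. \<Sum>d\<in>I. \<Sum>a\<in>I. f b d a)" by (intro sum.cong refl sum.swap)
  finally show ?thesis .
qed

text \<open>The square of the totally antisymmetric part of \<open>T\<close> is nonnegative.\<close>

lemma sum_sq_antisymmetrization_ge:
  fixes T :: "'i \<Rightarrow> 'i \<Rightarrow> 'i \<Rightarrow> real"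
  assumes skew: "\<And>a b d. a \<in> I \<Longrightarrow> b \<in> I \<Longrightarrow> d \<in> I \<Longrightarrow> T a b d = - T a d b"
  shows "(\<Sum>a\<in>I. \<Sum>b\<in>I. \<Sum>d\<in>I. (T a b d)\<^sup>2) \<le> (\<Sum>a\<in>I. \<Sum>b\<in>I. \<Sum>d\<in>I. (T a b d - T b a d)\<^sup>2)"
proof -
  let ?S = "\<lambda>f::'i \<Rightarrow> 'i \<Rightarrow> 'i \<Rightarrow> real. \<Sum>a\<in>I. \<Sum>b\<in>I. \<Sum>d\<in>I. f a b d"
  let ?Q = "?S (\<lambda>a b d. (T a b d)\<^sup>2)" and ?P = "?S (\<lambda>a b d. T a b d * T b d a)"
  have q: "?S (\<lambda>a b d. (T b d a)\<^sup>2) = ?Q" "?S (\<lambda>a b d. (T d a b)\<^sup>2) = ?Q"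
    "?S (\<lambda>a b d. T b d a * T d a b) = ?P" "?S (\<lambda>a b d. T d a b * T a b d) = ?P"
    using sum_cyclic3[of "\<lambda>a b d. (T a b d)\<^sup>2" I] sum_cyclic3[of "\<lambda>a b d. (T b d a)\<^sup>2" I]
      sum_cyclic3[of "\<lambda>a b d. T a b d * T b d a" I] sum_cyclic3[of "\<lambda>a b d. T b d a * T d a b" I]
    by simp_all
  \<comment> \<open>Skewness in the last two slots reduces antisymmetrization over all three to a
    cyclic sum.\<close>
  have "0 \<le> ?S (\<lambda>a b d. (T a b d + T b d a + T d a b)\<^sup>2)" by (intro sum_nonneg) simp
  also have "\<dots> = ?S (\<lambda>a b d. ((T a b d)\<^sup>2 + (T b d a)\<^sup>2 + (T d a b)\<^sup>2) +
      2 * (T a b d * T b d a + T b d a * T d a b + T d a b * T a b d))"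
    by (intro sum.cong refl) (simp add: power2_eq_square algebra_simps)
  also have "\<dots> = 3 * ?Q + 6 * ?P"
    by (simp only: sum.distrib sum_distrib_left[symmetric] q) simp
  finally have P: "0 \<le> 3 * ?Q + 6 * ?P" .
  have sw: "?S (\<lambda>a b d. (T b a d)\<^sup>2) = ?Q" by (rule sum.swap)
  have "?S (\<lambda>a b d. (T a b d - T b a d)\<^sup>2) = ?S (\<lambda>a b d. ((T a b d)\<^sup>2 + (T b a d)\<^sup>2) + 2 * (T a b d * T b d a))"
  proof (intro sum.cong refl)
    fix a b d assume "a \<in> I" "b \<in> I" "d \<in> I"
    then have "T b a d = - T b d a" using skew by blast
    then show "(T a b d - T b a d)\<^sup>2 = ((T a b d)\<^sup>2 + (T b a d)\<^sup>2) + 2 * (T a b d * T b d a)"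
      by (simp add: power2_eq_square algebra_simps)
  qed
  \<comment> \<open>The excess over \<open>?Q\<close> is \<open>?Q + 2 * ?P\<close>, a third of the
    expression shown nonnegative in \<open>P\<close>.\<close>
  also have "\<dots> = 2 * ?Q + 2 * ?P"
    by (simp only: sum.distrib sum_distrib_left[symmetric] sw)
  finally show ?thesis using P by linarith
qed

text \<open>First-order data at one point \<open>p\<close>: \<open>J\<close> is the structure on
  \<open>R^8\<close>, \<open>M X\<close> its derivative along \<open>X\<close>, and \<open>e\<close>
  a frame at \<open>p\<close>. \<open>M\<close> is linear on all of \<open>real^7\<close>, as the
  derivative of an extension is, but the relations with \<open>J\<close> are available only for
  tangent \<open>X\<close>.\<close>

locale acs_point =
  fixes p :: "real^7" and J :: "((real^7) \<times> real) \<Rightarrow>\<^sub>L ((real^7) \<times> real)"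
    and M :: "real^7 \<Rightarrow> ((real^7) \<times> real) \<Rightarrow>\<^sub>L ((real^7) \<times> real)" and e :: "nat \<Rightarrow> real^7"
  assumes p: "p \<bullet> p = 1"
    and JJ: "J \<odot> J = - id_blinfun" and J_skew: "\<And>a b. J a \<bullet> b = - (a \<bullet> J b)"
    and J_north: "J (0, 1) = (p, 0)"
    and M_linear: "linear M"
    and M_J: "\<And>X. X \<bullet> p = 0 \<Longrightarrow> M X \<odot> J = - (J \<odot> M X)"
    and M_skew: "\<And>X a b. X \<bullet> p = 0 \<Longrightarrow> M X a \<bullet> b = - (a \<bullet> M X b)"
    and M_north: "\<And>X. X \<bullet> p = 0 \<Longrightarrow> M X (0, 1) = (X, 0)"
    and e_tangent: "\<And>A. A \<in> {1..6} \<Longrightarrow> e A \<bullet> p = 0"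
    and e_orthonormal: "\<And>A B. A \<in> {1..6} \<Longrightarrow> B \<in> {1..6} \<Longrightarrow> e A \<bullet> e B = (if A = B then 1 else 0)"
begin

definition j :: "real^7 \<Rightarrow> real^7" where
  "j X = fst (J (X, 0))"

text \<open>The expression of the Nijenhuis tensor by a torsion-free derivative of \<open>J\<close>,
  here with the flat derivative of \<open>R^8\<close>; \<open>N_eq_brackets\<close> compares it with
  brackets.\<close>

definition N :: "real^7 \<Rightarrow> real^7 \<Rightarrow> (real^7) \<times> real" where
  "N X Y = M (j X) (Y, 0) - M (j Y) (X, 0) + J (M Y (X, 0)) - J (M X (Y, 0))"

text \<open>An orthonormal basis of \<open>R^8\<close>: indices \<open>0\<close> and
  \<open>7\<close> span the plane added to the tangent space.\<close>

definition f :: "nat \<Rightarrow> (real^7) \<times> real" where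
  "f i = (if i = 0 then (0, 1) else if i = 7 then (p, 0) else (e i, 0))"

lemma JJa: "J (J a) = - a"
  using arg_cong[OF JJ, of "\<lambda>A. blinfun_apply A a"] by (simp add: blinfun.bilinear_simps)

lemma J_inner: "J a \<bullet> J b = a \<bullet> b"
  using J_skew[of a "J b"] by (simp add: JJa)

lemma J_tangent: "X \<bullet> p = 0 \<Longrightarrow> J (X, 0) = (j X, 0)"
proof -
  assume X: "X \<bullet> p = 0"
  have "snd (J (X, 0)) = J (X, 0) \<bullet> (0, 1)" by (simp add: inner_prod_def)
  also have "\<dots> = 0" unfolding J_skew J_north using X by (simp add: inner_prod_def)
  finally show ?thesis by (simp add: j_def prod_eq_iff)
qed

lemma j_tangent: "X \<bullet> p = 0 \<Longrightarrow> j X \<bullet> p = 0"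
proof -
  assume X: "X \<bullet> p = 0"
  have "J (X, 0) \<bullet> J (0, 1) = 0" unfolding J_inner by simp
  then show ?thesis by (simp add: J_tangent[OF X] J_north)
qed

lemma j_j: "X \<bullet> p = 0 \<Longrightarrow> j (j X) = - X"
  using JJa[of "(X, 0)"] J_tangent[of X] J_tangent[OF j_tangent] by simp

lemma j_inner: "X \<bullet> p = 0 \<Longrightarrow> Y \<bullet> p = 0 \<Longrightarrow> j X \<bullet> j Y = X \<bullet> Y"
  using J_inner[of "(X, 0)" "(Y, 0)"] by (simp add: J_tangent inner_prod_def)

lemma j_linear: "linear j"
  unfolding j_def
proof (rule linearI)
  show "fst (J (X + Y, 0)) = fst (J (X, 0)) + fst (J (Y, 0))" for X Y
    using blinfun.add_right[of J "(X, 0)" "(Y, 0)"] by simp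
  show "fst (J (c *\<^sub>R X, 0)) = c *\<^sub>R fst (J (X, 0))" for c X
    using blinfun.scaleR_right[of J c "(X, 0)"] by simp
qed

definition C :: "real^7 \<Rightarrow> ((real^7) \<times> real) \<Rightarrow>\<^sub>L ((real^7) \<times> real)" where
  "C X = (1/2) *\<^sub>R (M X + J \<odot> M (j X))"

definition B :: "real^7 \<Rightarrow> ((real^7) \<times> real) \<Rightarrow>\<^sub>L ((real^7) \<times> real)" where
  "B X = (1/2) *\<^sub>R (M X - J \<odot> M (j X))"

lemma M_Ja: "X \<bullet> p = 0 \<Longrightarrow> M X (J a) = - J (M X a)"
  using arg_cong[OF M_J, of X "\<lambda>A. blinfun_apply A a"] by (simp add: blinfun.bilinear_simps)

lemma C_apply: "C X a = (1/2) *\<^sub>R (M X a + J (M (j X) a))"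
  and B_apply: "B X a = (1/2) *\<^sub>R (M X a - J (M (j X) a))"
  by (simp_all add: C_def B_def blinfun.bilinear_simps)

lemma JM_skew: "X \<bullet> p = 0 \<Longrightarrow> J (M X a) \<bullet> b = - (a \<bullet> J (M X b))"
  using J_skew[of "M X a" b] M_skew[of X a "J b"] M_Ja[of X b] by simp

lemma C_skew: "X \<bullet> p = 0 \<Longrightarrow> C X a \<bullet> b = - (a \<bullet> C X b)"
  and B_skew: "X \<bullet> p = 0 \<Longrightarrow> B X a \<bullet> b = - (a \<bullet> B X b)"
  using M_skew[of X a b] JM_skew[OF j_tangent, of X a b]
  by (simp_all add: C_apply B_apply inner_add_left inner_add_right inner_diff_left inner_diff_right field_simps)

lemma C_J: "X \<bullet> p = 0 \<Longrightarrow> C X (J a) = - J (C X a)"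
  and B_J: "X \<bullet> p = 0 \<Longrightarrow> B X (J a) = - J (B X a)"
  by (simp_all add: C_apply B_apply M_Ja j_tangent JJa blinfun.bilinear_simps algebra_simps)

text \<open>\<open>M X (0, 1) = (X, 0)\<close> and \<open>J (M (j X) (0, 1)) = (- X, 0)\<close>
  cancel in \<open>C\<close> and reinforce each other in \<open>B\<close>.\<close>

lemma C_north: "X \<bullet> p = 0 \<Longrightarrow> C X (0, 1) = 0"
  and B_north: "X \<bullet> p = 0 \<Longrightarrow> B X (0, 1) = (X, 0)"
  by (simp_all add: C_apply B_apply M_north j_tangent J_tangent j_j scaleR_2[symmetric] zero_prod_def)

lemma C_p: "X \<bullet> p = 0 \<Longrightarrow> C X (p, 0) = 0"
  and B_p: "X \<bullet> p = 0 \<Longrightarrow> B X (p, 0) = (- j X, 0)"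
  using C_J[of X "(0, 1)"] B_J[of X "(0, 1)"]
  by (simp_all add: J_north C_north B_north blinfun.bilinear_simps J_tangent)

text \<open>The Nijenhuis tensor sees \<open>C\<close> only through this antisymmetrization;
  \<open>C\<close> itself is recovered by an inequality, using its skewness in the last two
  slots.\<close>

lemma C_antisym:
  assumes X: "X \<bullet> p = 0" and Y: "Y \<bullet> p = 0"
  shows "C X (Y, 0) - C Y (X, 0) = (1/2) *\<^sub>R J (N X Y)"
  by (simp add: C_apply N_def blinfun.bilinear_simps JJa algebra_simps)

lemma f_orthonormal:
  assumes "i \<in> {0..7}" "k \<in> {0..7}"
  shows "f i \<bullet> f k = (if i = k then 1 else 0)"
proof -
  have ik: "i = 0 \<or> i = 7 \<or> i \<in> {1..6}" "k = 0 \<or> k = 7 \<or> k \<in> {1..6}" using assms by auto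
  have t: "e A \<bullet> p = 0" "p \<bullet> e A = 0" if "A \<in> {1..6}" for A
    using e_tangent[OF that] by (simp_all add: inner_commute)
  show ?thesis using ik by (elim disjE) (auto simp: f_def p t e_orthonormal)
qed

lemma parseval: "v \<bullet> w = (\<Sum>i\<in>{0..7}. (v \<bullet> f i) * (w \<bullet> f i))"
  by (rule orthonormal_family_parseval[OF _ _ f_orthonormal]) auto

lemma sum_0_7: "(\<Sum>i\<in>{0..7}. g i) = g 0 + (\<Sum>A\<in>{1..6}. g A) + g 7" for g :: "nat \<Rightarrow> real"
  by (simp add: eval_nat_numeral)

text \<open>Changes from the standard basis, in which \<open>tr\<close> is defined, to the adapted
  basis \<open>f\<close>, by Parseval on both sides of a swap of sums.\<close>

lemma tr_skew_square:
  fixes A :: "((real^7) \<times> real) \<Rightarrow>\<^sub>L ((real^7) \<times> real)"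
  assumes "\<And>a b. A a \<bullet> b = - (a \<bullet> A b)"
  shows "tr (A \<odot> A) = - (\<Sum>i\<in>{0..7}. \<Sum>k\<in>{0..7}. (A (f i) \<bullet> f k)\<^sup>2)"
proof -
  have "tr (A \<odot> A) = - (\<Sum>b\<in>Basis. A b \<bullet> A b)"
    unfolding tr_def sum_negf[symmetric] by (intro sum.cong refl) (simp add: assms[of "A _"] )
  also have "(\<Sum>b\<in>Basis. A b \<bullet> A b) = (\<Sum>b\<in>Basis. \<Sum>i\<in>{0..7}. (A b \<bullet> f i) * (A b \<bullet> f i))"
    by (subst parseval) (rule refl)
  also have "\<dots> = (\<Sum>i\<in>{0..7}. \<Sum>b\<in>Basis. (A (f i) \<bullet> b) * (A (f i) \<bullet> b))"
    by (subst sum.swap) (intro sum.cong refl, simp add: assms inner_commute)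
  also have "\<dots> = (\<Sum>i\<in>{0..7}. A (f i) \<bullet> A (f i))"
    by (subst euclidean_inner) (rule refl)
  also have "\<dots> = (\<Sum>i\<in>{0..7}. \<Sum>k\<in>{0..7}. (A (f i) \<bullet> f k)\<^sup>2)"
    unfolding power2_eq_square by (subst parseval) (rule refl)
  finally show ?thesis .
qed

text \<open>\<open>M X = B X + C X\<close> and \<open>J \<odot> M (j X) = C X - B X\<close>; in the
  product the mixed terms cancel under the trace.\<close>

lemma trace_form_decomposition:
  assumes X: "X \<bullet> p = 0"
  shows "tr (J \<odot> (M X \<odot> M (j X))) = tr (B X \<odot> B X) - tr (C X \<odot> C X)"
proof -
  have MX: "M X = B X + C X" "J \<odot> M (j X) = C X - B X"
    by (simp_all add: B_def C_def algebra_simps scaleR_2[symmetric] flip: scaleR_left.add)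
  have "J \<odot> (M X \<odot> M (j X)) = - (M X \<odot> (J \<odot> M (j X)))"
    by (simp add: blinfun_compose_assoc[symmetric] M_J[OF X] blinfun_compose.minus_left)
  also have "\<dots> = - ((B X + C X) \<odot> (C X - B X))" unfolding MX(2) by (simp only: MX(1))
  finally show ?thesis
    using tr_commute[of "B X" "C X"]
    by (simp add: blinfun_compose.add_left blinfun_compose.diff_right tr_linear
        linear_diff[OF bounded_linear.linear[OF bounded_linear_tr]])
qed

text \<open>Rows \<open>0\<close> and \<open>7\<close> of \<open>B X\<close> are \<open>X\<close>
  and \<open>- j X\<close>, of square length \<open>X \<bullet> X\<close> each, and skewness repeats
  them as columns.\<close>

lemma tr_B:
  assumes X: "X \<bullet> p = 0"
  shows "tr (B X \<odot> B X) \<le> - 4 * (X \<bullet> X)"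
proof -
  let ?q = "\<lambda>i k. (B X (f i) \<bullet> f k)\<^sup>2"
  have f07: "f 0 = (0, 1)" "f 7 = (p, 0)" by (simp_all add: f_def)
  have "X \<bullet> X = B X (f 0) \<bullet> B X (f 0)" by (simp add: f07 B_north X inner_prod_def)
  then have r0: "(\<Sum>k\<in>{0..7}. ?q 0 k) = X \<bullet> X"
    using parseval[of "B X (f 0)" "B X (f 0)"] by (simp only: power2_eq_square)
  have "X \<bullet> X = B X (f 7) \<bullet> B X (f 7)" by (simp add: f07 B_p X inner_prod_def j_inner)
  then have r7: "(\<Sum>k\<in>{0..7}. ?q 7 k) = X \<bullet> X"
    using parseval[of "B X (f 7)" "B X (f 7)"] by (simp only: power2_eq_square)
  have c0: "?q i 0 = ?q 0 i" and c7: "?q i 7 = ?q 7 i" for i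
    using B_skew[OF X, of "f i" "f 0"] B_skew[OF X, of "f i" "f 7"] by (simp_all add: inner_commute)
  \<comment> \<open>Rows and columns meet only in these four entries; as they vanish, nothing is
    counted twice.\<close>
  have z: "?q 0 0 = 0" "?q 0 7 = 0" "?q 7 0 = 0" "?q 7 7 = 0"
    using X j_tangent[OF X] by (simp_all add: f07 B_north B_p inner_prod_def)
  have s0: "(\<Sum>A\<in>{1..6}. ?q 0 A) = X \<bullet> X" and s7: "(\<Sum>A\<in>{1..6}. ?q 7 A) = X \<bullet> X"
    using r0 r7 unfolding sum_0_7 using z by simp_all
  have "(\<Sum>A\<in>{1..6}. ?q A 0 + ?q A 7) \<le> (\<Sum>A\<in>{1..6}. \<Sum>k\<in>{0..7}. ?q A k)"
    unfolding sum_0_7 by (intro sum_mono) (simp add: sum_nonneg)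
  then have "2 * (X \<bullet> X) \<le> (\<Sum>A\<in>{1..6}. \<Sum>k\<in>{0..7}. ?q A k)"
    unfolding sum.distrib c0 c7 s0 s7 by simp
  then have "4 * (X \<bullet> X) \<le> (\<Sum>i\<in>{0..7}. \<Sum>k\<in>{0..7}. ?q i k)"
    by (subst sum_0_7) (simp only: r0 r7)
  then show ?thesis using tr_skew_square[OF B_skew[OF X]] by simp
qed

text \<open>\<open>C X\<close> lives on the tangent block. Cauchy-Schwarz separates \<open>X\<close>
  from the tensor \<open>T\<close>, \<open>sum_sq_antisymmetrization_ge\<close> passes to its
  antisymmetrization, and the \<open>1/4\<close> is the square of the \<open>1/2\<close> in
  \<open>C_antisym\<close>.\<close>

lemma tr_C:
  assumes X: "X \<bullet> p = 0"
  shows "- tr (C X \<odot> C X) \<le> (X \<bullet> X) * (\<Sum>A\<in>{1..6}. \<Sum>B\<in>{1..6}. norm (N (e A) (e B)) ^ 2) / 4"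
proof -
  define T where "T = (\<lambda>A B D. C (e A) (e B, 0) \<bullet> (e D, 0))"
  let ?S = "\<Sum>A\<in>{1..6}. \<Sum>B\<in>{1..6}. \<Sum>D\<in>{1..6}. (T A B D)\<^sup>2"
  have fe: "f A = (e A, 0)" if "A \<in> {1..6}" for A using that by (auto simp: f_def)
  have C07: "C X (f 0) = 0" "C X (f 7) = 0" by (simp_all add: f_def C_north C_p X)
  have Ck: "C X a \<bullet> f 0 = 0" "C X a \<bullet> f 7 = 0" for a
    using C_skew[OF X, of a] C07 by simp_all
  have "- tr (C X \<odot> C X) = (\<Sum>B\<in>{1..6}. \<Sum>D\<in>{1..6}. (C X (f B) \<bullet> f D)\<^sup>2)"
    unfolding tr_skew_square[OF C_skew[OF X]] sum_0_7 by (simp add: C07 Ck)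
  also have "\<dots> \<le> (\<Sum>B\<in>{1..6}. \<Sum>D\<in>{1..6}. (X \<bullet> X) * (\<Sum>A\<in>{1..6}. (T A B D)\<^sup>2))"
  proof (intro sum_mono)
    fix B D :: nat assume BD: "B \<in> {1..6}" "D \<in> {1..6}"
    have X_exp: "X = (\<Sum>A\<in>{1..6}. (X \<bullet> e A) *\<^sub>R e A)"
    proof -
      have "(X, 0::real) = (\<Sum>i\<in>{0..7}. ((X, 0) \<bullet> f i) *\<^sub>R f i)"
        by (rule orthonormal_family_expand[OF _ _ f_orthonormal, symmetric]) auto
      also have "\<dots> = ((X, 0) \<bullet> f 0) *\<^sub>R f 0 + (\<Sum>A\<in>{1..6}. ((X, 0) \<bullet> f A) *\<^sub>R f A) + ((X, 0) \<bullet> f 7) *\<^sub>R f 7"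
        by (simp add: eval_nat_numeral)
      also have "\<dots> = (\<Sum>A\<in>{1..6}. (X \<bullet> e A) *\<^sub>R (e A, 0))"
        using X by (simp add: f_def inner_prod_def zero_prod_def)
      finally show ?thesis by (simp add: prod_eq_iff fst_sum)
    qed
    have C_linear: "linear (\<lambda>X. C X (e B, 0) \<bullet> (e D, 0))"
      by (rule linearI)
        (simp_all add: C_apply linear_add[OF M_linear] linear_scale[OF M_linear] linear_add[OF j_linear]
          linear_scale[OF j_linear] blinfun.bilinear_simps inner_add_left algebra_simps)
    have "C X (f B) \<bullet> f D = (\<Sum>A\<in>{1..6}. (X \<bullet> e A) * T A B D)"
      unfolding fe[OF BD(1)] fe[OF BD(2)] T_def
      using arg_cong[OF X_exp, of "\<lambda>X. C X (e B, 0) \<bullet> (e D, 0)"]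
      by (simp add: linear_sum[OF C_linear] linear_scale[OF C_linear])
    moreover have "(\<Sum>A\<in>{1..6}. (X \<bullet> e A)\<^sup>2) = X \<bullet> X"
      using arg_cong[OF X_exp, of "\<lambda>Z. X \<bullet> Z"] by (simp add: inner_sum_right power2_eq_square)
    ultimately show "(C X (f B) \<bullet> f D)\<^sup>2 \<le> (X \<bullet> X) * (\<Sum>A\<in>{1..6}. (T A B D)\<^sup>2)"
      using Cauchy_Schwarz_ineq_sum[of "\<lambda>A. X \<bullet> e A" "\<lambda>A. T A B D" "{1..6}"] by simp
  qed
  also have "\<dots> = (X \<bullet> X) * (\<Sum>B\<in>{1..6}. \<Sum>D\<in>{1..6}. \<Sum>A\<in>{1..6}. (T A B D)\<^sup>2)"
    by (simp add: sum_distrib_left)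
  also have "(\<Sum>B\<in>{1..6}. \<Sum>D\<in>{1..6}. \<Sum>A\<in>{1..6}. (T A B D)\<^sup>2) = ?S"
    using sum_cyclic3[of "\<lambda>a b d. (T d a b)\<^sup>2" "{1..6}"] by simp
  also have "(X \<bullet> X) * ?S \<le> (X \<bullet> X) * (\<Sum>A\<in>{1..6}. \<Sum>B\<in>{1..6}. \<Sum>D\<in>{1..6}. (T A B D - T B A D)\<^sup>2)"
  proof (intro mult_left_mono sum_sq_antisymmetrization_ge)
    show "T a b d = - T a d b" if "a \<in> {1..6}" "b \<in> {1..6}" "d \<in> {1..6}" for a b d
      unfolding T_def using C_skew[OF e_tangent[OF that(1)], of "(e b, 0)" "(e d, 0)"] by (simp add: inner_commute)
  qed simp
  also have "\<dots> \<le> (X \<bullet> X) * (\<Sum>A\<in>{1..6}. \<Sum>B\<in>{1..6}. norm (N (e A) (e B)) ^ 2 / 4)"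
  proof (intro mult_left_mono sum_mono)
    fix A B :: nat assume A: "A \<in> {1..6}" and B: "B \<in> {1..6}"
    let ?v = "(1/2) *\<^sub>R J (N (e A) (e B))"
    have "(\<Sum>D\<in>{1..6}. (T A B D - T B A D)\<^sup>2) = (\<Sum>D\<in>{1..6}. (?v \<bullet> f D) * (?v \<bullet> f D))"
      unfolding T_def inner_diff_left[symmetric] C_antisym[OF e_tangent[OF A] e_tangent[OF B]]
      by (intro sum.cong refl) (simp only: fe power2_eq_square)
    \<comment> \<open>Adding the two normal components completes the sum to a Parseval sum over all
      of \<open>R^8\<close>.\<close>
    also have "\<dots> \<le> (\<Sum>D\<in>{0..7}. (?v \<bullet> f D) * (?v \<bullet> f D))"
      by (intro sum_mono2) auto
    also have "\<dots> = ?v \<bullet> ?v" by (rule parseval[symmetric])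
    also have "\<dots> = norm (N (e A) (e B)) ^ 2 / 4"
      by (simp add: J_inner power2_norm_eq_inner)
    finally show "(\<Sum>D\<in>{1..6}. (T A B D - T B A D)\<^sup>2) \<le> norm (N (e A) (e B)) ^ 2 / 4" .
  qed simp
  finally show ?thesis by (simp add: sum_divide_distrib[symmetric])
qed

lemma trace_form_negative:
  assumes X: "X \<bullet> p = 0" "X \<noteq> 0"
    and N: "(\<Sum>A\<in>{1..6}. \<Sum>B\<in>{1..6}. norm (N (e A) (e B)) ^ 2) < 16"
  shows "tr (J \<odot> (M X \<odot> M (j X))) < 0"
proof -
  have "0 < X \<bullet> X" using X by simp
  from mult_strict_left_mono[OF N this] show ?thesis
    using tr_B[OF X(1)] tr_C[OF X(1)] trace_form_decomposition[OF X(1)] by simp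
qed

end

subsection \<open>Frames and stereographic charts\<close>

lemma Ck_on_linear_image:
  assumes "bounded_linear T" "open U"
  shows "Ck_on k f U \<Longrightarrow> Ck_on k (\<lambda>x. T (f x)) U"
proof (induction k arbitrary: f)
  case 0
  then show ?case using bounded_linear.continuous_on[OF assms(1)] by simp
next
  case (Suc k)
  show ?case
  proof (rule Ck_on_SucI[OF assms(2)])
    show "((\<lambda>x. T (f x)) has_derivative (\<lambda>v. T (frechet_derivative f (at x) v))) (at x)" if "x \<in> U" for x
      by (rule bounded_linear.has_derivative[OF assms(1) Ck_on_Suc_has_derivative[OF Suc.prems that]])
    show "Ck_on k (\<lambda>x. T (frechet_derivative f (at x) v)) U" for v
      by (rule Suc.IH[OF Ck_on_Suc_derivative[OF Suc.prems]])
  qed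
qed

text \<open>An operator is the sum over the basis of rank-one operators depending linearly on the
  values \<open>f x b\<close>.\<close>

lemma Ck_on_blinfun:
  fixes f :: "'a::euclidean_space \<Rightarrow> ('b::euclidean_space \<Rightarrow>\<^sub>L 'c::real_normed_vector)"
  assumes "open U" "\<And>b. b \<in> Basis \<Longrightarrow> Ck_on k (\<lambda>x. f x b) U"
  shows "Ck_on k f U"
proof -
  have eq: "f x = (\<Sum>b\<in>Basis. blinfun_scaleR_left (f x b) \<odot> blinfun_inner_left b)" for x
  proof (rule blinfun_eqI)
    fix q
    have "f x q = f x (\<Sum>b\<in>Basis. (q \<bullet> b) *\<^sub>R b)" by (simp only: euclidean_representation)
    then show "f x q = (\<Sum>b\<in>Basis. blinfun_scaleR_left (f x b) \<odot> blinfun_inner_left b) q"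
      by (simp add: blinfun.bilinear_simps inner_commute)
  qed
  have "bounded_linear (\<lambda>w::'c. blinfun_scaleR_left w \<odot> blinfun_inner_left b)" for b :: 'b
    using bounded_linear_compose[OF bounded_bilinear.bounded_linear_left[OF bounded_bilinear_blinfun_compose]
        bounded_linear_blinfun_scaleR_left] .
  then have "Ck_on k (\<lambda>x. blinfun_scaleR_left (f x b) \<odot> blinfun_inner_left b) U" if "b \<in> Basis" for b
    using Ck_on_linear_image[of "\<lambda>w. blinfun_scaleR_left w \<odot> blinfun_inner_left b" U k "\<lambda>x. f x b"] assms that
    by blast
  then have "Ck_on k (\<lambda>x. \<Sum>b\<in>Basis. blinfun_scaleR_left (f x b) \<odot> blinfun_inner_left b) U"
    by (rule Ck_on_sum[OF assms(1)])
  then show ?thesis using eq by simp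
qed

text \<open>The index set is left open because it serves both for frames, indexed by
  \<open>{1..6}\<close>, and for the isometry \<open>L\<close>, indexed by the basis of
  \<open>real^6\<close>.\<close>

lemma orthonormal_complement:
  fixes p :: "real^7"
  assumes p: "p \<bullet> p = 1" and I: "finite I" "card I = 6"
  obtains b :: "'i \<Rightarrow> real^7" where "\<And>i. i \<in> I \<Longrightarrow> b i \<bullet> p = 0"
    "\<And>i k. i \<in> I \<Longrightarrow> k \<in> I \<Longrightarrow> b i \<bullet> b k = (if i = k then 1 else 0)"
proof -
  have "norm p = 1" using p by (simp add: norm_eq_1)
  then obtain S where S: "p \<in> S" "pairwise orthogonal S" "\<And>x. x \<in> S \<Longrightarrow> norm x = 1"
    "independent S" "card S = DIM(real^7)" "span S = UNIV" by (rule vector_in_orthonormal_basis) blast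
  have "finite S" using S(4) independent_imp_finite by blast
  then have "card (S - {p}) = 6" "finite (S - {p})" using S(1,5) by simp_all
  then obtain b where b: "bij_betw b I (S - {p})"
    using I finite_same_card_bij[of I "S - {p}"] by auto
  have bS: "b i \<in> S" "b i \<noteq> p" if "i \<in> I" for i using bij_betwE[OF b] that by auto
  show thesis
  proof
    show "b i \<bullet> p = 0" if "i \<in> I" for i
      using S(1,2) bS[OF that] by (auto simp: pairwise_def orthogonal_def)
    show "b i \<bullet> b k = (if i = k then 1 else 0)" if "i \<in> I" "k \<in> I" for i k
    proof (cases "i = k")
      case True
      then show ?thesis using S(3) bS that by (simp add: norm_eq_1)
    next
      case False
      then have "b i \<noteq> b k" using b that by (auto simp: bij_betw_def inj_on_def)
      then show ?thesis using False S(2) bS that by (auto simp: pairwise_def orthogonal_def)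
    qed
  qed
qed

lemma S6_iff: "x \<in> S6 \<longleftrightarrow> x \<bullet> x = 1"
  by (simp add: S6_def norm_eq_1)

text \<open>Ensures that the \<open>SOME\<close> in \<open>nijenhuis_norm2\<close> really selects a
  local orthonormal frame.\<close>

lemma orthonormal_frame_exists:
  assumes p: "p \<in> S6"
  shows "\<exists>e U. openin (top_of_set S6) U \<and> p \<in> U \<and> orthonormal_frame_on U e"
proof -
  have pp: "p \<bullet> p = 1" using p by (simp add: S6_iff)
  obtain b :: "nat \<Rightarrow> real^7" where bt: "\<And>A. A \<in> {1..6} \<Longrightarrow> b A \<bullet> p = 0"
    and bo: "\<And>A B. A \<in> {1..6} \<Longrightarrow> B \<in> {1..6} \<Longrightarrow> b A \<bullet> b B = (if A = B then 1 else 0)"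
    using orthonormal_complement[OF pp, of "{1..6::nat}"] by auto
  define V where "V = {y :: real^7. 1 + p \<bullet> y \<noteq> 0}"
  have V: "open V"
    unfolding V_def by (intro open_Collect_neq continuous_intros)
  \<comment> \<open>The rotation that moves \<open>p\<close> to \<open>y\<close> in the plane they
    span, applied to \<open>b A\<close>.\<close>
  define e where "e = (\<lambda>A y. b A - ((b A \<bullet> y) * inverse (1 + p \<bullet> y)) *\<^sub>R (p + y))"
  have Ck: "Ck_on k (e A) V" for A k
    unfolding e_def
    by (intro Ck_on_diff Ck_on_scaleR Ck_on_mult Ck_on_inner Ck_on_inverse Ck_on_add Ck_on_const Ck_on_id V)
      (simp add: V_def)
  have pair: "e A y \<bullet> e B y = b A \<bullet> b B" if y: "y \<in> S6" "y \<in> V" and AB: "A \<in> {1..6}" "B \<in> {1..6}" for A B y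
  proof -
    define k where "k = inverse (1 + p \<bullet> y)"
    have k: "k * (1 + p \<bullet> y) = 1" using y by (simp add: k_def V_def)
    have pb: "p \<bullet> b B = 0" using bt[OF AB(2)] by (simp add: inner_commute)
    \<comment> \<open>This makes the quadratic term of the inner product cancel the two cross
      terms.\<close>
    have "(p + y) \<bullet> (p + y) = 2 * (1 + p \<bullet> y)"
      using pp y(1) by (simp add: S6_iff inner_add_left inner_add_right inner_commute)
    moreover have "e A y \<bullet> e B y = b A \<bullet> b B - 2 * ((b A \<bullet> y) * (b B \<bullet> y) * k)
        + (b A \<bullet> y) * (b B \<bullet> y) * k * (k * ((p + y) \<bullet> (p + y)))"
      unfolding e_def k_def[symmetric]
      by (simp add: inner_diff_left inner_diff_right inner_add_left inner_add_right bt[OF AB(1)] pb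
          inner_commute[of y "b B"] inner_commute[of y p] algebra_simps)
    moreover have "k * (2 * (1 + p \<bullet> y)) = 2" using k by (simp add: algebra_simps)
    ultimately show ?thesis by simp
  qed
  have tang: "e A y \<bullet> y = 0" if y: "y \<in> S6" "y \<in> V" for A y
  proof -
    have "1 + p \<bullet> y \<noteq> 0" "(p + y) \<bullet> y = 1 + p \<bullet> y"
      using y by (auto simp: V_def S6_iff inner_add_left)
    then show ?thesis by (simp add: e_def inner_diff_left)
  qed
  have "orthonormal_frame_on (S6 \<inter> V) e"
    unfolding orthonormal_frame_on_def vector_field_on_def smooth_on_def tangent_space_def
    using Ck V tang pair bo by auto
  moreover have "p \<in> V" using pp by (simp add: V_def)
  ultimately show ?thesis using p V by (intro exI[of _ e] exI[of _ "S6 \<inter> V"]) auto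
qed

section \<open>Stereographic projection as a conformal chart\<close>

locale stereographic =
  fixes L :: "real^6 \<Rightarrow> real^7" and n :: "real^7"
  assumes L: "linear L" and L_inner: "\<And>y z. L y \<bullet> L z = y \<bullet> z"
    and L_n: "\<And>y. L y \<bullet> n = 0" and n: "n \<bullet> n = 1"
begin

definition lam :: "real^6 \<Rightarrow> real" where
  "lam y = 2 * inverse (1 + y \<bullet> y)"

text \<open>The inverse of stereographic projection from the pole \<open>n\<close>, with
  \<open>L\<close> identifying \<open>real^6\<close> with the hyperplane orthogonal to
  \<open>n\<close>; \<open>lam\<close> is its conformal factor.\<close>

definition st :: "real^6 \<Rightarrow> real^7" where
  "st y = n + lam y *\<^sub>R (L y - n)"

definition dst :: "real^6 \<Rightarrow> real^6 \<Rightarrow> real^7" where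
  "dst y u = lam y *\<^sub>R L u - ((lam y)\<^sup>2 * (y \<bullet> u)) *\<^sub>R (L y - n)"

lemma denom_pos: "0 < 1 + y \<bullet> y" for y :: "real^6"
  by (simp add: add_pos_nonneg)

lemma lam_pos: "0 < lam y" and lam_eq: "lam y * (1 + y \<bullet> y) = 2"
  using denom_pos[of y] by (simp_all add: lam_def field_simps)

lemma n_L: "n \<bullet> L y = 0"
  using L_n[of y] by (simp add: inner_commute)

lemma L_diff_n: "(L y - n) \<bullet> (L y - n) = 1 + y \<bullet> y" "n \<bullet> (L y - n) = - 1" "(L y - n) \<bullet> n = - 1"
  "L u \<bullet> (L y - n) = y \<bullet> u" "(L y - n) \<bullet> L u = y \<bullet> u"
  by (simp_all add: inner_diff_left inner_diff_right L_inner L_n n_L n inner_commute[of u y])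

lemma st_S6: "st y \<in> S6"
proof -
  have "st y \<bullet> st y = 1 - 2 * lam y + lam y * (lam y * (1 + y \<bullet> y))"
    by (simp add: st_def inner_add_left inner_add_right n L_diff_n n_L L_n L_inner algebra_simps)
  then show ?thesis using lam_eq[of y] by (simp add: S6_iff)
qed

lemma lam_deriv: "(lam has_derivative (\<lambda>u. - ((lam y)\<^sup>2 * (y \<bullet> u)))) (at y)"
proof -
  have "((\<lambda>y. 1 + y \<bullet> y) has_derivative (\<lambda>u. 2 * (y \<bullet> u))) (at y)"
    by (rule has_derivative_eq_rhs, (rule derivative_intros)+) (simp add: fun_eq_iff inner_commute)
  from has_derivative_mult_right[OF Deriv.has_derivative_inverse[OF _ this], of 2] show ?thesis
    using denom_pos[of y] by (simp add: lam_def[abs_def] power2_eq_square mult_ac)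
qed

lemma st_deriv: "(st has_derivative dst y) (at y)"
proof -
  have dL: "(L has_derivative L) (at y)"
    using L by (simp add: linear_conv_bounded_linear bounded_linear_imp_has_derivative)
  show ?thesis
    unfolding st_def
    by (rule has_derivative_eq_rhs, (rule derivative_intros lam_deriv dL)+) (simp add: fun_eq_iff dst_def algebra_simps)
qed

text \<open>Conformality: by \<open>lam_eq\<close> the terms in
  \<open>(y \<bullet> u) * (y \<bullet> v)\<close> cancel.\<close>

lemma dst_inner: "dst y u \<bullet> dst y v = (lam y)\<^sup>2 * (u \<bullet> v)"
proof -
  have "dst y u \<bullet> dst y v = (lam y)\<^sup>2 * (u \<bullet> v) - 2 * ((lam y) ^ 3 * (y \<bullet> u) * (y \<bullet> v))
      + (lam y) ^ 3 * (y \<bullet> u) * (y \<bullet> v) * (lam y * (1 + y \<bullet> y))"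
    unfolding dst_def
    by (simp only: inner_diff_left[of "_ *\<^sub>R _"] inner_diff_right[of _ "_ *\<^sub>R _"] inner_scaleR_left
        inner_scaleR_right L_inner L_diff_n) (simp add: power2_eq_square power3_eq_cube algebra_simps)
  then show ?thesis using lam_eq[of y] by simp
qed

lemma norm_dst: "norm (dst y u) = 2 / (1 + (norm y)\<^sup>2) * norm u"
proof -
  have "norm (dst y u) = lam y * norm u"
    using dst_inner[of y u u] lam_pos[of y] by (simp add: norm_eq_sqrt_inner real_sqrt_mult)
  then show ?thesis by (simp add: lam_def divide_inverse power2_norm_eq_inner)
qed

lemma dst_linear: "linear (dst y)"
  by (rule has_derivative_linear[OF st_deriv])

lemma dst_tangent: "dst y u \<bullet> st y = 0"
proof -
  have "((\<lambda>y. st y \<bullet> st y) has_derivative (\<lambda>u. st y \<bullet> dst y u + dst y u \<bullet> st y)) (at y)"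
    by (rule has_derivative_inner[OF st_deriv st_deriv])
  moreover have "(\<lambda>y. st y \<bullet> st y) = (\<lambda>_. 1)" using st_S6 by (simp add: S6_iff)
  ultimately have "((\<lambda>y. 1::real) has_derivative (\<lambda>u. st y \<bullet> dst y u + dst y u \<bullet> st y)) (at y)" by simp
  from fun_cong[OF has_derivative_unique[OF this has_derivative_const], of u]
  show ?thesis by (simp add: inner_commute)
qed

text \<open>By conformality \<open>dst y\<close> is injective, and the tangent space has the same
  dimension \<open>6\<close>. Pointwise relations proved in the chart thereby hold for all tangent
  vectors.\<close>

lemma dst_surj:
  assumes "w \<bullet> st y = 0"
  obtains u where "w = dst y u"
proof -
  have inj: "inj (dst y)"
  proof (rule linear_injective_0[OF dst_linear, THEN iffD2], intro allI impI)
    fix u assume "dst y u = 0"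
    then have "(lam y)\<^sup>2 * (u \<bullet> u) = 0" using dst_inner[of y u u] by simp
    then show "u = 0" using lam_pos[of y] by simp
  qed
  have sub: "subspace (range (dst y))" by (rule linear_subspace_image[OF dst_linear]) simp
  have subT: "subspace {w. st y \<bullet> w = 0}" by (rule subspace_hyperplane)
  have "st y \<noteq> 0" using st_S6[of y] by (auto simp: S6_def)
  then have "dim {w. st y \<bullet> w = 0} = 6" using dim_hyperplane[of "st y"] by simp
  moreover have "dim (range (dst y)) = 6" using dim_image_eq[OF dst_linear] inj by simp
  moreover have "range (dst y) \<subseteq> {w. st y \<bullet> w = 0}" using dst_tangent by (auto simp: inner_commute)
  ultimately have "range (dst y) = {w. st y \<bullet> w = 0}" using subspace_dim_equal[OF sub subT] by simp
  then have "w \<in> range (dst y)" using assms by (simp add: inner_commute)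
  then show thesis using that by blast
qed

lemma Ck_st: "Ck_on k st UNIV"
proof -
  have L': "bounded_linear L" using L by (simp add: linear_conv_bounded_linear)
  show ?thesis
    unfolding st_def lam_def
    by (intro Ck_on_add Ck_on_scaleR Ck_on_mult Ck_on_inverse Ck_on_inner Ck_on_diff Ck_on_const Ck_on_id
        Ck_on_bounded_linear[OF L'] open_UNIV) (use denom_pos in \<open>simp add: less_imp_neq[symmetric]\<close>)
qed

end

lemma stereographic_exists: "\<exists>L n. stereographic L n"
proof -
  define n where "n = (axis 1 1 :: real^7)"
  have n: "n \<bullet> n = 1" by (simp add: n_def inner_axis_axis)
  obtain b :: "real^6 \<Rightarrow> real^7" where b: "\<And>i. i \<in> Basis \<Longrightarrow> b i \<bullet> n = 0"
    "\<And>i k. i \<in> Basis \<Longrightarrow> k \<in> Basis \<Longrightarrow> b i \<bullet> b k = (if i = k then 1 else 0)"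
    using orthonormal_complement[OF n, of "Basis :: (real^6) set"] by auto
  define L where "L = (\<lambda>y. \<Sum>i\<in>Basis. (y \<bullet> i) *\<^sub>R b i)"
  have "stereographic L n"
  proof (rule stereographic.intro)
    show "linear L" unfolding L_def
      by (intro linearI) (simp_all add: inner_add_left scaleR_add_left sum.distrib scaleR_sum_right)
    show "L y \<bullet> L z = y \<bullet> z" for y z
    proof -
      have "b i \<bullet> L z = z \<bullet> i" if "i \<in> Basis" for i
      proof -
        have "b i \<bullet> L z = (\<Sum>k\<in>Basis. (z \<bullet> k) * (if i = k then 1 else 0))"
          unfolding L_def inner_sum_right using b(2) that by (intro sum.cong) auto
        then show ?thesis using that by (simp add: if_distrib[of "\<lambda>z. _ * z"] sum.delta cong: if_cong)
      qed
      then have "L y \<bullet> L z = (\<Sum>i\<in>Basis. (y \<bullet> i) * (z \<bullet> i))"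
        unfolding fun_cong[OF L_def, of y] by (simp add: inner_sum_left)
      then show ?thesis by (simp add: euclidean_inner[symmetric])
    qed
    show "L y \<bullet> n = 0" for y by (simp add: L_def inner_sum_left b(1))
  qed (rule n)
  then show ?thesis by blast
qed

context acs_point
begin

text \<open>The last components of the four terms are \<open>Y \<bullet> j X\<close> and
  \<open>X \<bullet> j Y\<close>, each once with either sign. Hence no length is lost in passing to
  \<open>fst\<close>.\<close>

lemma snd_N:
  assumes X: "X \<bullet> p = 0" and Y: "Y \<bullet> p = 0"
  shows "snd (N X Y) = 0"
proof -
  have snd_eq: "snd q = q \<bullet> (0, 1)" for q :: "(real^7) \<times> real" by (simp add: inner_prod_def)
  have 1: "snd (M (j Z) (W, 0)) = - (W \<bullet> j Z)" if "Z \<bullet> p = 0" for Z W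
    unfolding snd_eq M_skew[OF j_tangent[OF that]] by (simp add: M_north j_tangent that)
  have 2: "snd (J (M Z (W, 0))) = - (W \<bullet> j Z)" if "Z \<bullet> p = 0" for Z W
  proof -
    have "snd (J (M Z (W, 0))) = (W, 0) \<bullet> M Z (p, 0)"
      unfolding snd_eq J_skew J_north using M_skew[OF that] by simp
    also have "M Z (p, 0) = - J (Z, 0)" using M_Ja[OF that, of "(0, 1)"] by (simp add: J_north M_north that)
    finally show ?thesis by (simp add: J_tangent that)
  qed
  show ?thesis using X Y by (simp add: N_def 1 2)
qed

text \<open>Dropping the last coordinate before applying \<open>J\<close> costs a multiple of
  \<open>p\<close>, the image of the last unit vector.\<close>

lemma J_fst: "J (fst q, 0) = J q - (snd q *\<^sub>R p, 0)"
proof -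
  have "(fst q, 0) = q - snd q *\<^sub>R (0, 1)" by (simp add: prod_eq_iff)
  then have "J (fst q, 0) = J q - snd q *\<^sub>R J (0, 1)"
    by (simp only: blinfun.diff_right blinfun.scaleR_right)
  then show ?thesis by (simp add: J_north)
qed

lemma snd_J: "snd (J (w, 0)) = - (w \<bullet> p)"
  using J_skew[of "(w, 0)" "(0, 1)"] J_north by (simp add: inner_prod_def)

text \<open>Here \<open>a\<close>, \<open>a'\<close>, \<open>c\<close>, \<open>c'\<close> stand for the derivatives of \<open>X\<close> along \<open>Y\<close> and \<open>j Y\<close>, and of
  \<open>Y\<close> along \<open>X\<close> and \<open>j X\<close>. They enter the Nijenhuis expression only through their normal parts.\<close>

lemma N_eq_brackets:
  assumes X: "X \<bullet> p = 0" and Y: "Y \<bullet> p = 0"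
    and a: "a \<bullet> p = - (X \<bullet> Y)" and c: "c \<bullet> p = - (X \<bullet> Y)"
  shows "fst (N X Y) =
     ((fst (M (j X) (Y, 0)) + fst (J (c', 0))) - (fst (M (j Y) (X, 0)) + fst (J (a', 0)))) - (c - a)
     - fst (J (c' - (fst (M Y (X, 0)) + fst (J (a, 0))), 0))
     - fst (J ((fst (M X (Y, 0)) + fst (J (c, 0))) - a', 0))"
proof -
  have Jl: "J (v - w, 0) = J (v, 0) - J (w, 0)" "J (v + w, 0) = J (v, 0) + J (w, 0)" for v w
    using blinfun.diff_right[of J "(v, 0)" "(w, 0)"] blinfun.add_right[of J "(v, 0)" "(w, 0)"] by simp_all
  have s: "snd (M Z (W, 0)) = - (W \<bullet> Z)" if "Z \<bullet> p = 0" for Z W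
    using M_skew[OF that, of "(W, 0)" "(0, 1)"] M_north[OF that] by (simp add: inner_prod_def)
  show ?thesis
    by (simp add: N_def Jl J_fst s X Y snd_J a c JJa inner_commute)
qed

end

subsection \<open>The complex structures on \<open>R^8\<close> induced by \<open>J\<close>\<close>

locale orthogonal_acs_S6 =
  fixes J :: "real^7 \<Rightarrow> real^7 \<Rightarrow> real^7"
  assumes acs: "almost_complex_structure J" and orth: "orthogonal_acs J"
begin

lemma J_tangent: "x \<in> S6 \<Longrightarrow> u \<bullet> x = 0 \<Longrightarrow> J x u \<bullet> x = 0"
  and J_J: "x \<in> S6 \<Longrightarrow> u \<bullet> x = 0 \<Longrightarrow> J x (J x u) = - u"
  and J_add: "x \<in> S6 \<Longrightarrow> u \<bullet> x = 0 \<Longrightarrow> v \<bullet> x = 0 \<Longrightarrow> J x (u + v) = J x u + J x v"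
  and J_scale: "x \<in> S6 \<Longrightarrow> u \<bullet> x = 0 \<Longrightarrow> J x (c *\<^sub>R u) = c *\<^sub>R J x u"
  and J_field: "vector_field_on S6 X \<Longrightarrow> vector_field_on S6 (\<lambda>x. J x (X x))"
  using acs unfolding almost_complex_structure_def tangent_space_def by auto

lemma J_inner: "x \<in> S6 \<Longrightarrow> u \<bullet> x = 0 \<Longrightarrow> v \<bullet> x = 0 \<Longrightarrow> J x u \<bullet> J x v = u \<bullet> v"
  using orth unfolding orthogonal_acs_def tangent_space_def by auto

definition pr :: "real^7 \<Rightarrow> real^7 \<Rightarrow> real^7" where
  "pr x v = v - (v \<bullet> x) *\<^sub>R x"

lemma pr_tangent: "x \<in> S6 \<Longrightarrow> pr x v \<bullet> x = 0"
  by (simp add: pr_def S6_iff inner_diff_left)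

lemma pr_id: "v \<bullet> x = 0 \<Longrightarrow> pr x v = v"
  by (simp add: pr_def)

lemma Jpr_linear: "x \<in> S6 \<Longrightarrow> linear (\<lambda>v. J x (pr x v))"
proof (rule linearI)
  assume x: "x \<in> S6"
  show "J x (pr x (v + w)) = J x (pr x v) + J x (pr x w)" for v w
    using J_add[OF x pr_tangent[OF x] pr_tangent[OF x], of v w]
    by (simp add: pr_def inner_add_left algebra_simps)
  show "J x (pr x (c *\<^sub>R v)) = c *\<^sub>R J x (pr x v)" for c v
    using J_scale[OF x pr_tangent[OF x], of c v] by (simp add: pr_def algebra_simps)
qed

text \<open>The orthogonal complex structure on \<open>R^8 = T_x \<oplus> R x \<oplus> R\<close> that extends \<open>J x\<close> and maps the
  last unit vector to \<open>x\<close>.\<close>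

definition JJ :: "real^7 \<Rightarrow> ((real^7) \<times> real) \<Rightarrow>\<^sub>L ((real^7) \<times> real)" where
  "JJ x = Blinfun (\<lambda>q. (J x (pr x (fst q)) + snd q *\<^sub>R x, - (fst q \<bullet> x)))"

lemma JJ_apply: "x \<in> S6 \<Longrightarrow> JJ x q = (J x (pr x (fst q)) + snd q *\<^sub>R x, - (fst q \<bullet> x))"
proof -
  assume x: "x \<in> S6"
  have "linear (\<lambda>q. (J x (pr x (fst q)) + snd q *\<^sub>R x, - (fst q \<bullet> x)))"
    by (rule linearI)
      (simp_all add: linear_add[OF Jpr_linear[OF x]] linear_scale[OF Jpr_linear[OF x]] inner_add_left algebra_simps)
  then show ?thesis
    unfolding JJ_def by (simp add: bounded_linear_Blinfun_apply linear_conv_bounded_linear)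
qed

lemma JJ_tangent: "x \<in> S6 \<Longrightarrow> u \<bullet> x = 0 \<Longrightarrow> JJ x (u, 0) = (J x u, 0)"
  by (simp add: JJ_apply pr_id)

lemma JJ_square: "x \<in> S6 \<Longrightarrow> JJ x \<odot> JJ x = - id_blinfun"
proof (rule blinfun_eqI)
  fix q :: "(real^7) \<times> real" assume x: "x \<in> S6"
  let ?v = "pr x (fst q)"
  have xx: "x \<bullet> x = 1" using x by (simp add: S6_iff)
  have t: "J x ?v \<bullet> x = 0" by (rule J_tangent[OF x pr_tangent[OF x]])
  have "pr x (J x ?v + snd q *\<^sub>R x) = J x ?v"
    by (simp add: pr_def[of x "J x ?v + _"] inner_add_left t xx)
  then have "JJ x (JJ x q) = (- ?v - (fst q \<bullet> x) *\<^sub>R x, - snd q)"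
    by (simp add: JJ_apply[OF x] J_J[OF x pr_tangent[OF x]] inner_add_left t xx)
  also have "\<dots> = - q" by (simp add: pr_def prod_eq_iff)
  finally show "(JJ x \<odot> JJ x) q = (- id_blinfun) q" by (simp add: blinfun.bilinear_simps)
qed

lemma J_pr_inner: "x \<in> S6 \<Longrightarrow> J x (pr x v) \<bullet> w = J x (pr x v) \<bullet> pr x w"
  using J_tangent[OF _ pr_tangent, of x v] by (simp add: pr_def[of x w] inner_diff_right)

lemma JJ_skew: "x \<in> S6 \<Longrightarrow> JJ x a \<bullet> b = - (a \<bullet> JJ x b)"
proof -
  assume x: "x \<in> S6"
  have "J x (pr x v) \<bullet> pr x w = - (pr x v \<bullet> J x (pr x w))" for v w
    using J_inner[OF x J_tangent[OF x pr_tangent[OF x]] pr_tangent[OF x], of v w]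
    by (simp add: J_J[OF x pr_tangent[OF x]])
  then have "J x (pr x v) \<bullet> w = - (v \<bullet> J x (pr x w))" for v w
    unfolding J_pr_inner[OF x, of v w] inner_commute[of v] J_pr_inner[OF x, of w v]
    by (simp only: inner_commute[of "pr x v"])
  from this[of "fst a" "fst b"] show ?thesis
    by (simp add: JJ_apply[OF x] inner_prod_def inner_add_left inner_add_right inner_commute[of x])
qed

lemma JJ_north: "x \<in> S6 \<Longrightarrow> JJ x (0, 1) = (x, 0)"
  using linear_0[OF Jpr_linear] by (simp add: JJ_apply)

lemma norm_JJ: "x \<in> S6 \<Longrightarrow> norm (JJ x) \<le> 1"
proof (rule norm_blinfun_bound)
  fix q assume x: "x \<in> S6"
  have "JJ x (JJ x q) = - q"
    using arg_cong[OF JJ_square[OF x], of "\<lambda>A. blinfun_apply A q"] by (simp add: blinfun.bilinear_simps)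
  then have "JJ x q \<bullet> JJ x q = q \<bullet> q" using JJ_skew[OF x, of q "JJ x q"] by simp
  then show "norm (JJ x q) \<le> 1 * norm q" by (simp add: norm_eq_sqrt_inner)
qed simp

text \<open>Smoothness of \<open>J\<close> is given only through its action on smooth fields over
  the whole sphere, so it is tested on the tangential projections of the constant fields.\<close>

lemma JJ_extension:
  assumes p: "p \<in> S6"
  obtains U g where "open U" "p \<in> U" "\<And>k. Ck_on k g U" "\<And>x. x \<in> U \<Longrightarrow> x \<in> S6 \<Longrightarrow> g x = JJ x"
proof -
  have "\<exists>U g. open U \<and> p \<in> U \<and> (\<forall>k. Ck_on k g U) \<and> (\<forall>y\<in>U \<inter> S6. g y = J y (pr y b))" for b
  proof -
    have "Ck_on k (\<lambda>x. pr x b) UNIV" for k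
      unfolding pr_def
      by (intro Ck_on_diff Ck_on_scaleR Ck_on_inner Ck_on_const Ck_on_id open_UNIV)
    then have "vector_field_on S6 (\<lambda>x. pr x b)"
      unfolding vector_field_on_def smooth_on_def tangent_space_def using pr_tangent by auto
    from J_field[OF this] show ?thesis
      using p unfolding vector_field_on_def smooth_on_def by blast
  qed
  then obtain U g where Ug: "\<And>b. open (U b)" "\<And>b. p \<in> U b" "\<And>b k. Ck_on k (g b) (U b)"
    "\<And>b y. y \<in> U b \<Longrightarrow> y \<in> S6 \<Longrightarrow> g b y = J y (pr y b)" by (metis IntI)
  \<comment> \<open>Only the basis vectors matter, so a finite intersection of neighbourhoods
    suffices.\<close>
  define V where "V = (\<Inter>b\<in>(Basis::(real^7) set). U b)"
  have V: "open V" "p \<in> V" using Ug by (auto simp: V_def intro: open_INT)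
  \<comment> \<open>The formula for \<open>JJ\<close>, with \<open>J x (pr x b)\<close> replaced by
    its smooth extension.\<close>
  define h where "h = (\<lambda>x. Blinfun (\<lambda>q. (\<Sum>b\<in>Basis. (fst q \<bullet> b) *\<^sub>R g b x, 0::real) + snd q *\<^sub>R (x, 0) - (fst q \<bullet> x) *\<^sub>R (0, 1)))"
  have h: "h x q = (\<Sum>b\<in>Basis. (fst q \<bullet> b) *\<^sub>R g b x, 0) + snd q *\<^sub>R (x, 0) - (fst q \<bullet> x) *\<^sub>R (0, 1)" for x q
  proof -
    have "linear (\<lambda>q. (\<Sum>b\<in>Basis. (fst q \<bullet> b) *\<^sub>R g b x, 0::real) + snd q *\<^sub>R (x, 0) - (fst q \<bullet> x) *\<^sub>R (0, 1))"
      by (rule linearI)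
        (simp_all add: inner_add_left scaleR_add_left sum.distrib scaleR_sum_right algebra_simps)
    then show ?thesis
      unfolding h_def by (simp add: bounded_linear_Blinfun_apply linear_conv_bounded_linear)
  qed
  show thesis
  proof
    show "Ck_on k h V" for k
    proof (rule Ck_on_blinfun[OF V(1)])
      fix q :: "(real^7) \<times> real"
      have bl: "bounded_linear (\<lambda>w::real^7. (w, 0::real))"
        by (intro bounded_linear_Pair bounded_linear_ident bounded_linear_zero)
      have "Ck_on k (g b) V" if "b \<in> Basis" for b
        using Ck_on_subset[OF Ug(3)[of k b]] that by (auto simp: V_def)
      then have 1: "Ck_on k (\<lambda>x. \<Sum>b\<in>Basis. (fst q \<bullet> b) *\<^sub>R g b x) V"
        by (intro Ck_on_sum[OF V(1)] Ck_on_scaleR[OF V(1) Ck_on_const[OF V(1)]])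
      show "Ck_on k (\<lambda>x. h x q) V"
        unfolding h
        by (rule Ck_on_diff[OF V(1) Ck_on_add[OF V(1) Ck_on_linear_image[OF bl V(1) 1]
                Ck_on_scaleR[OF V(1) Ck_on_const[OF V(1)] Ck_on_bounded_linear[OF bl V(1)]]]
              Ck_on_scaleR[OF V(1) Ck_on_inner[OF V(1) Ck_on_const[OF V(1)] Ck_on_id[OF V(1)]] Ck_on_const[OF V(1)]]])
    qed
    show "h x = JJ x" if x: "x \<in> V" "x \<in> S6" for x
    proof (rule blinfun_eqI)
      fix q :: "(real^7) \<times> real"
      have "J x (pr x (fst q)) = (\<Sum>b\<in>Basis. (fst q \<bullet> b) *\<^sub>R J x (pr x b))"
        using arg_cong[OF euclidean_representation[of "fst q"], of "\<lambda>v. J x (pr x v)"]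
        by (simp add: linear_sum[OF Jpr_linear[OF x(2)]] linear_scale[OF Jpr_linear[OF x(2)]])
      also have "\<dots> = (\<Sum>b\<in>Basis. (fst q \<bullet> b) *\<^sub>R g b x)"
        using Ug(4) x by (intro sum.cong) (auto simp: V_def)
      finally show "h x q = JJ x q" by (simp add: h JJ_apply[OF x(2)])
    qed
  qed (rule V)+
qed

end

subsection \<open>The contradiction in a chart\<close>

text \<open>Frames are only local, while \<open>J_field\<close> speaks of fields on all of
  \<open>S6\<close>. First derivatives at one point are all that the brackets involve, and this
  weaker notion is preserved by \<open>J\<close>.\<close>

definition tangent_germ :: "(real^7 \<Rightarrow> real^7) \<Rightarrow> real^7 \<Rightarrow> bool" where
  "tangent_germ Z p \<longleftrightarrow> (\<exists>V g. open V \<and> p \<in> V \<and> g differentiable (at p) \<and>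
     (\<forall>x\<in>V \<inter> S6. g x = Z x \<and> Z x \<bullet> x = 0))"

lemma vector_field_tangent_germ:
  assumes "openin (top_of_set S6) U" "p \<in> U" "vector_field_on U Z"
  shows "tangent_germ Z p"
proof -
  obtain O' where O: "open O'" "U = S6 \<inter> O'" using assms(1) by (auto simp: openin_open)
  obtain V g where V: "open V" "p \<in> V" "\<And>k. Ck_on k g V" "\<And>y. y \<in> V \<inter> U \<Longrightarrow> g y = Z y"
    using assms(2,3) unfolding vector_field_on_def smooth_on_def by blast
  have "g differentiable (at p)" using V(2) V(3)[of "Suc 0"] by simp
  then show ?thesis
    unfolding tangent_germ_def using V O assms(2,3)
    by (intro exI[of _ "V \<inter> O'"] exI[of _ g]) (auto simp: vector_field_on_def tangent_space_def)
qed

locale acs_chart = orthogonal_acs_S6 J + stereographic L n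
  for J :: "real^7 \<Rightarrow> real^7 \<Rightarrow> real^7" and L :: "real^6 \<Rightarrow> real^7" and n :: "real^7"
begin

definition jj :: "real^6 \<Rightarrow> ((real^7) \<times> real) \<Rightarrow>\<^sub>L ((real^7) \<times> real)" where
  "jj y = JJ (st y)"

definition djj :: "real^6 \<Rightarrow> real^6 \<Rightarrow> ((real^7) \<times> real) \<Rightarrow>\<^sub>L ((real^7) \<times> real)" where
  "djj y = frechet_derivative jj (at y)"

lemma open_st_vimage: "open U \<Longrightarrow> open (st -` U)"
  by (intro open_vimage continuous_at_imp_continuous_on ballI has_derivative_continuous[OF st_deriv])

lemma djj_extension:
  assumes U: "open U" "st y \<in> U" and g: "Ck_on (Suc 0) g U" and eq: "\<And>x. x \<in> U \<Longrightarrow> x \<in> S6 \<Longrightarrow> g x = JJ x"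
  shows "(jj has_derivative (\<lambda>u. frechet_derivative g (at (st y)) (dst y u))) (at y)"
    and "djj y u = frechet_derivative g (at (st y)) (dst y u)"
proof -
  have "((\<lambda>y. g (st y)) has_derivative (\<lambda>u. frechet_derivative g (at (st y)) (dst y u))) (at y)"
    by (rule has_derivative_compose[OF st_deriv Ck_on_Suc_has_derivative[OF g U(2)]])
  then show d: "(jj has_derivative (\<lambda>u. frechet_derivative g (at (st y)) (dst y u))) (at y)"
    by (rule has_derivative_transform_within_open[OF _ open_st_vimage[OF U(1)]])
      (use U eq st_S6 in \<open>auto simp: jj_def\<close>)
  show "djj y u = frechet_derivative g (at (st y)) (dst y u)"
    unfolding djj_def using frechet_derivative_at[OF d] by metis
qed

lemma jj_deriv: "(jj has_derivative djj y) (at y)"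
proof -
  obtain U g where *: "open U" "st y \<in> U" "\<And>k. Ck_on k g U" "\<And>x. x \<in> U \<Longrightarrow> x \<in> S6 \<Longrightarrow> g x = JJ x"
    using JJ_extension[OF st_S6[of y]] by blast
  show ?thesis
    using djj_extension(1)[OF *(1,2) *(3) *(4)] frechet_derivative_works differentiable_def
    unfolding djj_def by blast
qed

lemma Ck_jj: "Ck_on k jj UNIV"
proof (rule Ck_on_local)
  fix y :: "real^6"
  obtain U g where *: "open U" "st y \<in> U" "\<And>k. Ck_on k g U" "\<And>x. x \<in> U \<Longrightarrow> x \<in> S6 \<Longrightarrow> g x = JJ x"
    using JJ_extension[OF st_S6[of y]] by blast
  note V = open_st_vimage[OF *(1)]
  have "Ck_on k (\<lambda>y. g (st y)) (st -` U)"
    by (rule Ck_on_compose[OF V _ Ck_on_subset[OF Ck_st] *(3)]) auto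
  then have "Ck_on k jj (st -` U)"
    using Ck_on_cong[OF V, of "\<lambda>y. g (st y)" jj] *(4) st_S6 by (auto simp: jj_def)
  then show "\<exists>V. open V \<and> y \<in> V \<and> Ck_on k jj V" using V *(2) by blast
qed

text \<open>\<open>p\<close> may be the pole, which the chart never reaches: the derivative is
  controlled by that of an extension near \<open>p\<close>, relative to the length of the tangent
  vector \<open>dst y u\<close>.\<close>

lemma djj_local_bound:
  assumes p: "p \<in> S6"
  shows "\<exists>W C. open W \<and> p \<in> W \<and> 0 \<le> C \<and> (\<forall>y u. st y \<in> W \<longrightarrow> norm (djj y u) \<le> C * norm (dst y u))"
proof -
  obtain U g where U: "open U" "p \<in> U" "\<And>k. Ck_on k g U" "\<And>x. x \<in> U \<Longrightarrow> x \<in> S6 \<Longrightarrow> g x = JJ x"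
    using JJ_extension[OF p] by blast
  let ?D = "\<lambda>x. frechet_derivative g (at x)"
  define K where "K = (\<lambda>b. norm (?D p b) + 1)"
  define W where "W = U \<inter> (\<Inter>b\<in>Basis. U \<inter> (\<lambda>x. ?D x b) -` ball 0 (K b))"
  have g1: "Ck_on (Suc 0) g U" by (rule U(3))
  have "open (U \<inter> (\<lambda>x. ?D x b) -` ball 0 (K b))" for b
    using Ck_on_Suc_derivative[OF g1] U(1) by (intro continuous_open_preimage) auto
  then have "open W" unfolding W_def using U(1) by (intro open_Int open_INT) auto
  moreover have "p \<in> W" using U(2) by (simp add: W_def K_def)
  moreover have "norm (djj y u) \<le> (\<Sum>b\<in>Basis. K b) * norm (dst y u)" if y: "st y \<in> W" for y u
  proof -
    have yU: "st y \<in> U" using y by (simp add: W_def)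
    let ?w = "dst y u"
    have lin: "linear (?D (st y))" by (rule has_derivative_linear[OF Ck_on_Suc_has_derivative[OF g1 yU]])
    have "djj y u = ?D (st y) (\<Sum>b\<in>Basis. (?w \<bullet> b) *\<^sub>R b)"
      by (simp only: euclidean_representation djj_extension(2)[OF U(1) yU g1 U(4)])
    also have "\<dots> = (\<Sum>b\<in>Basis. (?w \<bullet> b) *\<^sub>R ?D (st y) b)"
      by (simp add: linear_sum[OF lin] linear_scale[OF lin])
    finally have "norm (djj y u) \<le> (\<Sum>b\<in>Basis. norm ((?w \<bullet> b) *\<^sub>R ?D (st y) b))" by (simp only: norm_sum)
    also have "\<dots> \<le> (\<Sum>b\<in>Basis. norm ?w * K b)"
    proof (rule sum_mono)
      fix b :: "real^7" assume b: "b \<in> Basis"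
      have "norm (?D (st y) b) \<le> K b" using y b by (auto simp: W_def)
      then show "norm ((?w \<bullet> b) *\<^sub>R ?D (st y) b) \<le> norm ?w * K b"
        unfolding norm_scaleR using b by (intro mult_mono) (auto simp: Basis_le_norm)
    qed
    finally show ?thesis by (simp add: sum_distrib_right mult.commute)
  qed
  moreover have "0 \<le> (\<Sum>b\<in>Basis. K b)" by (intro sum_nonneg) (simp add: K_def)
  ultimately show ?thesis by blast
qed

text \<open>Finitely many neighbourhoods cover the compact sphere, so the constant is uniform over
  the noncompact chart.\<close>

lemma djj_bound:
  obtains C where "0 \<le> C" "\<And>y u. norm (djj y u) \<le> C * norm (dst y u)"
proof -
  obtain W C where WC: "\<And>p. p \<in> S6 \<Longrightarrow> open (W p)" "\<And>p. p \<in> S6 \<Longrightarrow> p \<in> W p" "\<And>p. p \<in> S6 \<Longrightarrow> 0 \<le> C p"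
    "\<And>p y u. p \<in> S6 \<Longrightarrow> st y \<in> W p \<Longrightarrow> norm (djj y u) \<le> C p * norm (dst y u)"
    using djj_local_bound by metis
  have "compact S6" by (simp add: S6_def)
  then obtain F where F: "F \<subseteq> S6" "finite F" "S6 \<subseteq> (\<Union>p\<in>F. W p)"
    by (rule compactE_image[of S6 S6 W]) (use WC(1,2) in auto)
  show thesis
  proof
    show "0 \<le> (\<Sum>p\<in>F. C p)" using WC(3) F(1) by (intro sum_nonneg) auto
    fix y u
    obtain p where p: "p \<in> F" "st y \<in> W p" using F(3) st_S6 by blast
    have "C p \<le> (\<Sum>p\<in>F. C p)" using WC(3) F(1,2) p(1) by (intro member_le_sum) auto
    then have "C p * norm (dst y u) \<le> (\<Sum>p\<in>F. C p) * norm (dst y u)" by (rule mult_right_mono) simp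
    then show "norm (djj y u) \<le> (\<Sum>p\<in>F. C p) * norm (dst y u)"
      using WC(4)[of p y u] p F(1) by fastforce
  qed
qed

lemma jj_square: "jj y \<odot> jj y = - id_blinfun"
  unfolding jj_def by (rule JJ_square[OF st_S6])

lemma djj_anticommute: "djj y u \<odot> jj y = - (jj y \<odot> djj y u)"
proof -
  have "((\<lambda>y. jj y \<odot> jj y) has_derivative (\<lambda>u. jj y \<odot> djj y u + djj y u \<odot> jj y)) (at y)"
    by (rule blinfun_compose.FDERIV[OF jj_deriv jj_deriv])
  then have "((\<lambda>y. - id_blinfun) has_derivative (\<lambda>u. jj y \<odot> djj y u + djj y u \<odot> jj y)) (at y)"
    by (simp only: jj_square)
  from fun_cong[OF has_derivative_unique[OF this has_derivative_const], of u]
  show ?thesis by (simp add: eq_neg_iff_add_eq_0 add.commute)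
qed

lemma jj_apply_deriv: "((\<lambda>y. jj y a) has_derivative (\<lambda>u. djj y u a)) (at y)"
  by (rule has_derivative_eq_rhs[OF blinfun.FDERIV[OF jj_deriv has_derivative_const]])
    (simp add: blinfun.zero_right)

lemma djj_skew: "djj y u a \<bullet> b = - (a \<bullet> djj y u b)"
proof -
  have "((\<lambda>y. jj y a \<bullet> b + a \<bullet> jj y b) has_derivative (\<lambda>u. djj y u a \<bullet> b + a \<bullet> djj y u b)) (at y)"
    by (rule has_derivative_eq_rhs, (rule derivative_intros jj_apply_deriv)+) simp
  moreover have "(\<lambda>y. jj y a \<bullet> b + a \<bullet> jj y b) = (\<lambda>_. 0)"
    using JJ_skew[OF st_S6] by (simp add: jj_def fun_eq_iff)
  ultimately have "((\<lambda>y. 0::real) has_derivative (\<lambda>u. djj y u a \<bullet> b + a \<bullet> djj y u b)) (at y)" by simp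
  from fun_cong[OF has_derivative_unique[OF this has_derivative_const], of u]
  show ?thesis by simp
qed

text \<open>The value of \<open>JJ x\<close> at the last unit vector is the point \<open>x\<close>
  itself. This identity is the source of the positive term in \<open>tr_B\<close>.\<close>

lemma djj_north: "djj y u (0, 1) = (dst y u, 0)"
proof -
  have "((\<lambda>y. (st y, 0::real)) has_derivative (\<lambda>u. (dst y u, 0))) (at y)"
    by (intro has_derivative_Pair st_deriv has_derivative_const)
  moreover have "(\<lambda>y. jj y (0, 1)) = (\<lambda>y. (st y, 0))" using JJ_north[OF st_S6] by (simp add: jj_def)
  ultimately show ?thesis
    using has_derivative_unique[OF jj_apply_deriv[of "(0, 1)" y]] by (metis (no_types, lifting))
qed

text \<open>Differentiate \<open>Z x \<bullet> x = 0\<close> along the sphere.\<close>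

lemma tangential_deriv_normal:
  assumes Z: "tangent_germ Z (st y)"
  shows "tangential_deriv Z (st y) (dst y u) \<bullet> st y = - (Z (st y) \<bullet> dst y u)"
proof -
  obtain V g where V: "open V" "st y \<in> V" "g differentiable (at (st y))"
    "\<And>x. x \<in> V \<inter> S6 \<Longrightarrow> g x = Z x" "\<And>x. x \<in> V \<inter> S6 \<Longrightarrow> Z x \<bullet> x = 0"
    using Z unfolding tangent_germ_def by blast
  let ?G = "frechet_derivative g (at (st y))"
  have td: "tangential_deriv Z (st y) (dst y u) = ?G (dst y u)"
    by (rule tangential_deriv_eq_extension[OF st_S6 _ V(1-4)]) (simp_all add: tangent_space_def dst_tangent)
  have "((\<lambda>y. g (st y) \<bullet> st y) has_derivative (\<lambda>u. g (st y) \<bullet> dst y u + ?G (dst y u) \<bullet> st y)) (at y)"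
    using V(3) by (intro has_derivative_inner st_deriv has_derivative_compose[OF st_deriv])
      (simp add: frechet_derivative_works)
  then have "((\<lambda>y. 0) has_derivative (\<lambda>u. g (st y) \<bullet> dst y u + ?G (dst y u) \<bullet> st y)) (at y)"
    by (rule has_derivative_transform_within_open[OF _ open_st_vimage[OF V(1)]])
      (use V st_S6 in auto)
  from fun_cong[OF has_derivative_unique[OF this has_derivative_const], of u]
  show ?thesis using V(2,4) st_S6[of y] td by simp
qed

text \<open>On tangent vectors \<open>J x (Z x)\<close> is the first component of
  \<open>JJ x (Z x, 0)\<close>, so the product rule applies in the fixed space
  \<open>R^8\<close>.\<close>

lemma tangential_deriv_J:
  assumes Z: "tangent_germ Z (st y)"
  shows "tangential_deriv (\<lambda>x. J x (Z x)) (st y) (dst y u) =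
      fst (djj y u (Z (st y), 0)) + fst (jj y (tangential_deriv Z (st y) (dst y u), 0))"
    and "tangent_germ (\<lambda>x. J x (Z x)) (st y)"
proof -
  obtain V g where V: "open V" "st y \<in> V" "g differentiable (at (st y))"
    "\<And>x. x \<in> V \<inter> S6 \<Longrightarrow> g x = Z x" "\<And>x. x \<in> V \<inter> S6 \<Longrightarrow> Z x \<bullet> x = 0"
    using Z unfolding tangent_germ_def by blast
  obtain U h where U: "open U" "st y \<in> U" "\<And>k. Ck_on k h U" "\<And>x. x \<in> U \<Longrightarrow> x \<in> S6 \<Longrightarrow> h x = JJ x"
    using JJ_extension[OF st_S6[of y]] by blast
  let ?G = "frechet_derivative g (at (st y))" and ?H = "frechet_derivative h (at (st y))"
  define f where "f = (\<lambda>x. fst (h x (g x, 0)))"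
  have td: "tangential_deriv Z (st y) (dst y u) = ?G (dst y u)"
    by (rule tangential_deriv_eq_extension[OF st_S6 _ V(1-4)]) (simp_all add: tangent_space_def dst_tangent)
  have dG: "(g has_derivative ?G) (at (st y))" using V(3) by (simp add: frechet_derivative_works)
  have dH: "(h has_derivative ?H) (at (st y))" by (rule Ck_on_Suc_has_derivative[OF U(3)[of "Suc 0"] U(2)])
  have df: "(f has_derivative (\<lambda>v. fst (h (st y) (?G v, 0) + ?H v (g (st y), 0)))) (at (st y))"
    unfolding f_def
    by (intro has_derivative_fst blinfun.FDERIV dH has_derivative_Pair dG has_derivative_const)
  have eq: "f x = J x (Z x)" if "x \<in> (V \<inter> U) \<inter> S6" for x
    using that V(4,5)[of x] U(4)[of x] JJ_tangent[of x "Z x"] by (simp add: f_def)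
  have "f differentiable (at (st y))" using df by (auto simp: differentiable_def)
  have op: "open (V \<inter> U)" "st y \<in> V \<inter> U" using U V by auto
  have "tangential_deriv (\<lambda>x. J x (Z x)) (st y) (dst y u) = frechet_derivative f (at (st y)) (dst y u)"
    by (rule tangential_deriv_eq_extension[OF st_S6 _ op \<open>f differentiable (at (st y))\<close> eq])
      (simp_all add: tangent_space_def dst_tangent)
  also have "\<dots> = fst (h (st y) (?G (dst y u), 0) + ?H (dst y u) (g (st y), 0))"
    by (subst frechet_derivative_at[OF df, symmetric]) (rule refl)
  finally show "tangential_deriv (\<lambda>x. J x (Z x)) (st y) (dst y u) =
      fst (djj y u (Z (st y), 0)) + fst (jj y (tangential_deriv Z (st y) (dst y u), 0))"
    using djj_extension(2)[OF U(1,2) U(3) U(4)] V(2) V(4)[of "st y"] U(2) U(4)[of "st y"] st_S6[of y]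
    by (simp add: td jj_def)
  show "tangent_germ (\<lambda>x. J x (Z x)) (st y)"
    unfolding tangent_germ_def
  proof (intro exI conjI ballI)
    show "J x (Z x) \<bullet> x = 0" if "x \<in> (V \<inter> U) \<inter> S6" for x
      using that V(5)[of x] J_tangent[of x "Z x"] by blast
  qed (fact op \<open>f differentiable (at (st y))\<close> eq)+
qed

text \<open>The normal parts of the two derivatives are both \<open>- (X \<bullet> Y)\<close> and
  cancel. Tangency matters because \<open>J x\<close> is meaningful on tangent vectors only.\<close>

lemma lie_bracket_tangent:
  assumes "tangent_germ X (st y)" "tangent_germ Y (st y)" "X (st y) \<bullet> st y = 0" "Y (st y) \<bullet> st y = 0"
  shows "lie_bracket X Y (st y) \<bullet> st y = 0"
proof -
  obtain u where u: "X (st y) = dst y u" using dst_surj[OF assms(3)] .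
  obtain v where v: "Y (st y) = dst y v" using dst_surj[OF assms(4)] .
  show ?thesis
    unfolding lie_bracket_def u v inner_diff_left
    using tangential_deriv_normal[OF assms(2), of u] tangential_deriv_normal[OF assms(1), of v]
    by (simp add: u v inner_commute)
qed

lemma nijenhuis_bound_fails: "\<not> (\<forall>x\<in>S6. nijenhuis_norm2 J x < 16)"
proof
  assume small: "\<forall>x\<in>S6. nijenhuis_norm2 J x < 16"
  obtain C where C: "0 \<le> C" "\<And>y u. norm (djj y u) \<le> C * norm (dst y u)" by (rule djj_bound) blast
  have "\<exists>y u. u \<noteq> 0 \<and> (\<forall>v. tr (jj y \<odot> (djj y u \<odot> djj y v)) = 0)"
    unfolding djj_def
  \<comment> \<open>The \<open>1\<close> covers the norm of \<open>jj\<close>; \<open>2 * C\<close>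
    absorbs the \<open>2\<close> of the conformal factor.\<close>
  proof (rule trace_form_degenerate[where C = "1 + 2 * C"])
    show "norm (jj y) \<le> 1 + 2 * C" for y using norm_JJ[OF st_S6[of y]] C(1) by (simp add: jj_def)
    show "norm (frechet_derivative jj (at y) u) \<le> (1 + 2 * C) / (1 + (norm y)\<^sup>2) * norm u" for y u
    proof -
      have "C * (2 / (1 + (norm y)\<^sup>2) * norm u) \<le> (1 + 2 * C) / (1 + (norm y)\<^sup>2) * norm u"
        using C(1) by (simp add: field_simps add_pos_nonneg)
      then show ?thesis using C(2)[of y u] by (simp add: norm_dst djj_def)
    qed
  qed (simp_all add: jj_square Ck_jj)
  then obtain y u where u: "u \<noteq> 0" and deg: "\<And>v. tr (jj y \<odot> (djj y u \<odot> djj y v)) = 0" by blast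
  define p where "p = st y"
  have pS: "p \<in> S6" by (simp add: p_def st_S6)
  \<comment> \<open>The very frame chosen in the definition of
    \<open>nijenhuis_norm2\<close>.\<close>
  define e where "e = (SOME e. \<exists>U. openin (top_of_set S6) U \<and> p \<in> U \<and> orthonormal_frame_on U e)"
  obtain U where U: "openin (top_of_set S6) U" "p \<in> U" "orthonormal_frame_on U e"
    using someI_ex[OF orthonormal_frame_exists[OF pS]] unfolding e_def by blast
  have germ: "tangent_germ (e A) p" if "A \<in> {1..6}" for A
    using vector_field_tangent_germ[OF U(1,2)] U(3) that by (auto simp: orthonormal_frame_on_def)
  have et: "e A p \<bullet> p = 0" if "A \<in> {1..6}" for A
    using U(2,3) that by (auto simp: orthonormal_frame_on_def vector_field_on_def tangent_space_def)
  obtain V g where V: "open V" "st y \<in> V" "\<And>k. Ck_on k g V" "\<And>x. x \<in> V \<Longrightarrow> x \<in> S6 \<Longrightarrow> g x = JJ x"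
    using JJ_extension[OF st_S6[of y]] by blast
  \<comment> \<open>On tangent vectors this agrees with \<open>djj\<close>; taking the full
    derivative of the extension makes it linear on all of \<open>real^7\<close>.\<close>
  define M where "M = frechet_derivative g (at p)"
  have M: "M (dst y v) = djj y v" for v
    using djj_extension(2)[OF V(1,2) V(3) V(4)] by (simp add: M_def p_def)
  interpret P: acs_point p "JJ p" M "\<lambda>A. e A p"
  proof (rule acs_point.intro)
    show "p \<bullet> p = 1" using pS by (simp add: S6_iff)
    show "JJ p \<odot> JJ p = - id_blinfun" by (rule JJ_square[OF pS])
    show "JJ p a \<bullet> b = - (a \<bullet> JJ p b)" for a b by (rule JJ_skew[OF pS])
    show "JJ p (0, 1) = (p, 0)" by (rule JJ_north[OF pS])
    show "linear M"
      unfolding M_def p_def by (rule has_derivative_linear[OF Ck_on_Suc_has_derivative[OF V(3)[of "Suc 0"] V(2)]])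
    show "M X \<odot> JJ p = - (JJ p \<odot> M X)" if X: "X \<bullet> p = 0" for X
    proof -
      obtain v where "X = dst y v" using dst_surj X unfolding p_def by blast
      then show ?thesis using djj_anticommute[of y v] by (simp add: M jj_def p_def)
    qed
    show "M X a \<bullet> b = - (a \<bullet> M X b)" if X: "X \<bullet> p = 0" for X a b
    proof -
      obtain v where "X = dst y v" using dst_surj X unfolding p_def by blast
      then show ?thesis using djj_skew[of y v] by (simp add: M)
    qed
    show "M X (0, 1) = (X, 0)" if X: "X \<bullet> p = 0" for X
    proof -
      obtain v where "X = dst y v" using dst_surj X unfolding p_def by blast
      then show ?thesis using djj_north[of y v] by (simp add: M)
    qed
    show "e A p \<bullet> p = 0" if "A \<in> {1..6}" for A by (rule et[OF that])
    show "e A p \<bullet> e B p = (if A = B then 1 else 0)" if "A \<in> {1..6}" "B \<in> {1..6}" for A B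
      using U(2,3) that by (auto simp: orthonormal_frame_on_def)
  qed
  have Pj: "P.j X = J p X" if "X \<bullet> p = 0" for X
    by (simp add: P.j_def JJ_tangent[OF pS that])
  have td_J: "tangential_deriv (\<lambda>x. J x (Z x)) p w = fst (M w (Z p, 0)) + fst (JJ p (tangential_deriv Z p w, 0))"
    if Z: "tangent_germ Z p" and w: "w \<bullet> p = 0" for Z w
  proof -
    obtain v where v: "w = dst y v" using dst_surj w unfolding p_def by blast
    show ?thesis using tangential_deriv_J(1)[of Z y v] Z by (simp add: v M p_def jj_def)
  qed
  have td_n: "tangential_deriv Z p w \<bullet> p = - (Z p \<bullet> w)" if Z: "tangent_germ Z p" and w: "w \<bullet> p = 0" for Z w
  proof -
    obtain v where v: "w = dst y v" using dst_surj w unfolding p_def by blast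
    show ?thesis using tangential_deriv_normal[of Z y v] Z by (simp add: v p_def)
  qed
  have N: "norm (nijenhuis J (e A) (e B) p) = norm (P.N (e A p) (e B p))"
    if A: "A \<in> {1..6}" and B: "B \<in> {1..6}" for A B
  proof -
    let ?X = "e A" and ?Y = "e B" and ?JX = "\<lambda>x. J x (e A x)" and ?JY = "\<lambda>x. J x (e B x)"
    have X: "?X p \<bullet> p = 0" and Y: "?Y p \<bullet> p = 0" using et A B by auto
    have JX: "J p (?X p) \<bullet> p = 0" and JY: "J p (?Y p) \<bullet> p = 0"
      using J_tangent[OF pS] X Y by auto
    have gJ: "tangent_germ ?JX p" "tangent_germ ?JY p"
      using tangential_deriv_J(2)[of _ y] germ A B by (auto simp: p_def)
    \<comment> \<open>The brackets are tangent, so \<open>J p\<close> may be replaced by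
      \<open>JJ p\<close>, the form in which \<open>N_eq_brackets\<close> is stated.\<close>
    have br: "J p (lie_bracket ?JX ?Y p) = fst (JJ p (lie_bracket ?JX ?Y p, 0))"
      "J p (lie_bracket ?X ?JY p) = fst (JJ p (lie_bracket ?X ?JY p, 0))"
      using lie_bracket_tangent[of ?JX y ?Y] lie_bracket_tangent[of ?X y ?JY] gJ germ A B X Y JX JY
        JJ_tangent[OF pS] by (simp_all add: p_def)
    have "fst (P.N (?X p) (?Y p)) = nijenhuis J ?X ?Y p"
      unfolding nijenhuis_def br unfolding lie_bracket_def
        td_J[OF germ[OF A] Y] td_J[OF germ[OF A] JY] td_J[OF germ[OF B] X] td_J[OF germ[OF B] JX]
      by (subst P.N_eq_brackets[OF X Y, of "tangential_deriv ?X p (?Y p)" "tangential_deriv ?Y p (?X p)"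
            "tangential_deriv ?Y p (J p (?X p))" "tangential_deriv ?X p (J p (?Y p))"])
        (use td_n[OF germ[OF A] Y] td_n[OF germ[OF B] X] in \<open>simp_all add: Pj[OF X] Pj[OF Y] inner_commute[of "e B p" "e A p"]\<close>)
    then have "P.N (?X p) (?Y p) = (nijenhuis J ?X ?Y p, 0)"
      using P.snd_N[OF X Y] by (simp add: prod_eq_iff)
    then show ?thesis by (simp add: norm_Pair)
  qed
  have "(\<Sum>A\<in>{1..6}. \<Sum>B\<in>{1..6}. norm (P.N (e A p) (e B p)) ^ 2) = nijenhuis_norm2 J p"
    unfolding nijenhuis_norm2_def e_def[symmetric] Let_def using N by (intro sum.cong) auto
  then have lt: "(\<Sum>A\<in>{1..6}. \<Sum>B\<in>{1..6}. norm (P.N (e A p) (e B p)) ^ 2) < 16" using small pS by simp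
  define X where "X = dst y u"
  have X: "X \<bullet> p = 0" by (simp add: X_def p_def dst_tangent)
  have "X \<bullet> X = (lam y)\<^sup>2 * (u \<bullet> u)" by (simp add: X_def dst_inner)
  then have "X \<noteq> 0" using u lam_pos[of y] by auto
  from P.trace_form_negative[OF X this lt] have neg: "tr (JJ p \<odot> (M X \<odot> M (P.j X))) < 0" .
  \<comment> \<open>The degenerate direction pairs to \<open>0\<close> with every \<open>v\<close>,
    in particular with the one representing \<open>P.j X\<close>, where the trace is
    negative.\<close>
  obtain v where "P.j X = dst y v" using dst_surj P.j_tangent[OF X] unfolding p_def by blast
  then show False using neg deg[of v] by (simp add: X_def M jj_def p_def)
qed

end

theorem corollary1:
  shows "\<not> (\<exists>J. almost_complex_structure J \<and> orthogonal_acs J \<and>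
                (\<forall>x\<in>S6. nijenhuis_norm2 J x < 64 / 5))"
proof
  assume "\<exists>J. almost_complex_structure J \<and> orthogonal_acs J \<and> (\<forall>x\<in>S6. nijenhuis_norm2 J x < 64 / 5)"
  then obtain J where J: "almost_complex_structure J" "orthogonal_acs J"
    and small: "\<forall>x\<in>S6. nijenhuis_norm2 J x < 64 / 5" by blast
  obtain L n where "stereographic L n" using stereographic_exists by blast
  then interpret acs_chart J L n
    using J by (intro acs_chart.intro orthogonal_acs_S6.intro)
  \<comment> \<open>\<open>64 / 5 < 16 = 80 / 5\<close>.\<close>
  show False using nijenhuis_bound_fails small by fastforce
qed

end
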